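(* Let $g_S$ be the Simanca metric on the blow-up $\tilde{\mathbb{C}}^2$ of $\mathbb{C}^2$ at the origin. All the coefficients $a_j(x)$ with $j\ge 1$ of the Tian-Yau-Zelditch expansion $$\epsilon_{mg_S}(x)\sim\sum_{j=0}^{\infty}a_j(x)\,m^{2-j}\qquad (m\to+\infty)$$ of the Simanca metric vanish identically on $\tilde{\mathbb{C}}^2$.
   Context: **Geometric quantization and the epsilon function.** Let $(M,g)$ be an $n$-dimensional (not necessarily compact) Kähler manifold with associated Kähler form $\omega$, and let $L\to M$ be a holomorphic line bundle with $c_1(L)=[\omega]$. For an integer $m\ge 1$ let $h_m$ be a Hermitian metric on $L^m=L^{\otimes m}$ such that $\mathrm{Ric}(h_m)=m\omega$, where $\mathrm{Ric}(h_m)$ is the two-form given locally by $\mathrm{Ric}(h_m)=-\frac{i}{2\pi}\partial\bar\partial\log h_m(\sigma(x),\sigma(x))$ for a trivializing holomorphic section $\sigma:U\to L^m\setminus\{0\}$. Let $\mathcal{H}_m$ be the separable complex Hilbert space of global holomorphic sections $s$ of $L^m$ with $$\langle s,s\rangle_{h_m}=\int_M h_m(s(x),s(x))\,\frac{\omega^n}{n!}<\infty .$$ Let $\{s_j\}_{j=0,\dots,d_m}$ be an orthonormal basis of $\mathcal{H}_m$ ($\dim\mathcal{H}_m=d_m+1\le\infty$) and set $$\epsilon_{mg}(x)=\sum_{j=0}^{d_m}h_m(s_j(x),s_j(x)).$$ This function depends only on $mg$, not on the orthonormal basis or on $h_m$. **TYZ expansion.** The Tian-Yau-Zelditch (TYZ)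 expansion of $g$ is the asymptotic expansion in the $C^\infty$ category $$\epsilon_{mg}(x)\sim\sum_{j=0}^\infty a_j(x)m^{n-j},\qquad m\to+\infty,$$ where $a_0(x)=1$ and the $a_j$, $j\ge1$, are smooth functions on $M$. That is, for all integers $k,r\ge0$ and every compact $K\subset M$ there is a constant $C$ such that $\|\epsilon_{mg}-\sum_{j=0}^k a_jm^{n-j}\|_{C^r(K)}\le C\,m^{n-k-1}$ for all large $m$. The coefficients are uniquely determined by the expansion. **Simanca metric.** $\tilde{\mathbb{C}}^2=\{(z_1,z_2,[t_1,t_2])\in\mathbb{C}^2\times\mathbb{C}P^1 : t_1z_2-t_2z_1=0\}$, with exceptional divisor $H=\{(0,[t])\}\simeq\mathbb{C}P^1$. The projection $(z,[t])\mapsto z$ restricts to a biholomorphism $\tilde{\mathbb{C}}^2\setminus H\cong\mathbb{C}^2\setminus\{0\}$. The form $\frac{i}{2\pi}\partial\bar\partial(|z|^2+\log|z|^2)$ on $\mathbb{C}^2\setminus\{0\}$, with $|z|^2=|z_1|^2+|z_2|^2$, pulled back to $\tilde{\mathbb{C}}^2\setminus H$, extends (uniquely) to a Kähler form on all of $\tilde{\mathbb{C}}^2$; this extension is denoted $\omega_S$, and the associated Kähler metric $g_S$ is the Simanca metric. The form $\omega_S$ is integral and $\tilde{\mathbb{C}}^2$ is simply-connected, so there is, up to isomorphism, a unique holomorphic line bundle $L\to\tilde{\mathbb{C}}^2$ with $c_1(L)=[\omega_S]$. *)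

theory Defs
  imports "HOL-Analysis.Analysis"
begin

section \<open>Calculus on open subsets of complex n-space\<close>

definition pderiv_at :: "'b \<Rightarrow> ('b::euclidean_space \<Rightarrow> 'c::real_normed_vector) \<Rightarrow> 'b \<Rightarrow> 'c" where
  "pderiv_at v F = (\<lambda>x. frechet_derivative F (at x) v)"

fun iter_pderiv :: "'b list \<Rightarrow> ('b::euclidean_space \<Rightarrow> 'c::real_normed_vector) \<Rightarrow> 'b \<Rightarrow> 'c" where
  "iter_pderiv [] F = F"
| "iter_pderiv (v # vs) F = pderiv_at v (iter_pderiv vs F)"

text \<open>Class \<open>C\<^sup>r\<close> on an open set \<open>S\<close>.\<close>

definition cr_on :: "nat \<Rightarrow> 'b set \<Rightarrow> ('b::euclidean_space \<Rightarrow> 'c::real_normed_vector) \<Rightarrow> bool" where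
  "cr_on r S F \<longleftrightarrow> (\<forall>vs. set vs \<subseteq> Basis \<and> length vs \<le> r \<longrightarrow>
     continuous_on S (iter_pderiv vs F) \<and>
     (length vs < r \<longrightarrow> iter_pderiv vs F differentiable_on S))"

text \<open>Holomorphy on an open set in several variables: real differentiability with a complex linear
  derivative.\<close>

definition hol_on :: "(complex^'n) set \<Rightarrow> (complex^'n \<Rightarrow> complex) \<Rightarrow> bool" where
  "hol_on S F \<longleftrightarrow> (\<forall>z\<in>S. \<exists>D. (F has_derivative D) (at z) \<and> (\<forall>c v. D (c *s v) = c * D v))"

text \<open>The Wirtinger operators \<open>\<partial>/\<partial>z\<^sub>j\<close> and \<open>\<partial>/\<partial>\<^bold>z\<^sub>j\<close> (the latter with respect to the conjugate
  variable).\<close>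

definition dz :: "'n \<Rightarrow> (complex^'n \<Rightarrow> complex) \<Rightarrow> complex^'n \<Rightarrow> complex" where
  "dz j F = (\<lambda>x. (pderiv_at (axis j 1) F x - \<i> * pderiv_at (axis j \<i>) F x) / 2)"

definition dzbar :: "'n \<Rightarrow> (complex^'n \<Rightarrow> complex) \<Rightarrow> complex^'n \<Rightarrow> complex" where
  "dzbar j F = (\<lambda>x. (pderiv_at (axis j 1) F x + \<i> * pderiv_at (axis j \<i>) F x) / 2)"

text \<open>Throughout, a square matrix \<open>W\<close> stands for the (1,1)-form
  \<open>(i/2\<pi>) \<Sum> W\<^sub>j\<^sub>k dz\<^sub>j \<and> d\<^bold>z\<^sub>k\<close>, so that \<open>ddbar f\<close> is the form \<open>(i/2\<pi>) \<partial>\<partial>\<^sup>- f\<close>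
  (bold \<open>\<^bold>z\<close> and \<open>\<partial>\<^sup>-\<close> denote conjugates).\<close>

definition ddbar :: "(complex^'n \<Rightarrow> real) \<Rightarrow> complex^'n \<Rightarrow> complex^'n^'n" where
  "ddbar f x = (\<chi> j k. dz j (dzbar k (\<lambda>y. complex_of_real (f y))) x)"

text \<open>The matrix at \<open>x\<close> of the pullback, along a map \<open>f\<close> holomorphic near \<open>x\<close>, of a (1,1)-form with
  matrix \<open>W\<close> at \<open>f x\<close>.\<close>

definition pullback11 ::
  "(complex^'n \<Rightarrow> complex^'k) \<Rightarrow> complex^'n \<Rightarrow> complex^'k^'k \<Rightarrow> complex^'n^'n" where
  "pullback11 f x W = (\<chi> j k. \<Sum>a\<in>UNIV. \<Sum>b\<in>UNIV.
     W $ a $ b * dz j (\<lambda>y. f y $ a) x * cnj (dz k (\<lambda>y. f y $ b) x))"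


section \<open>Complex manifolds with a finite atlas\<close>

text \<open>A chart is a coordinate domain with its coordinate map. The manifold itself is the union of the
  domains of its atlas; the atlas is a list, and the order of the list is only used to write down
  integrals.\<close>

type_synonym ('a,'n) chart = "'a set \<times> ('a \<Rightarrow> complex^'n)"
type_synonym ('a,'n) atlas = "('a,'n) chart list"

abbreviation dom :: "('a,'n) chart \<Rightarrow> 'a set" where "dom c \<equiv> fst c"
abbreviation coord :: "('a,'n) chart \<Rightarrow> 'a \<Rightarrow> complex^'n" where "coord c \<equiv> snd c"

definition param :: "('a,'n) chart \<Rightarrow> complex^'n \<Rightarrow> 'a" where
  "param c = inv_into (dom c) (coord c)"

definition mf_points :: "('a,'n) atlas \<Rightarrow> 'a set" where
  "mf_points A = (\<Union>c\<in>set A. dom c)"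

definition mf_topology :: "('a,'n::finite) atlas \<Rightarrow> 'a topology" where
  "mf_topology A = topology (\<lambda>W. W \<subseteq> mf_points A \<and> (\<forall>c\<in>set A. open (coord c ` (W \<inter> dom c))))"

text \<open>In the following three definitions \<open>W\<close> is an open subset of the manifold.\<close>

definition mf_cr_on ::
  "('a,'n::finite) atlas \<Rightarrow> nat \<Rightarrow> 'a set \<Rightarrow> ('a \<Rightarrow> 'c::real_normed_vector) \<Rightarrow> bool" where
  "mf_cr_on A r W f \<longleftrightarrow> (\<forall>c\<in>set A. cr_on r (coord c ` (W \<inter> dom c)) (f \<circ> param c))"

definition mf_smooth_on ::
  "('a,'n::finite) atlas \<Rightarrow> 'a set \<Rightarrow> ('a \<Rightarrow> 'c::real_normed_vector) \<Rightarrow> bool" where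
  "mf_smooth_on A W f \<longleftrightarrow> (\<forall>r. mf_cr_on A r W f)"

definition mf_hol_on :: "('a,'n::finite) atlas \<Rightarrow> 'a set \<Rightarrow> ('a \<Rightarrow> complex) \<Rightarrow> bool" where
  "mf_hol_on A W f \<longleftrightarrow> (\<forall>c\<in>set A. hol_on (coord c ` (W \<inter> dom c)) (f \<circ> param c))"

text \<open>A (1,1)-form is given by its coefficient matrix in each chart at each point of the chart.\<close>

type_synonym ('a,'n) form11 = "('a,'n) chart \<Rightarrow> 'a \<Rightarrow> complex^'n^'n"

definition smooth_form11 :: "('a,'n::finite) atlas \<Rightarrow> ('a,'n) form11 \<Rightarrow> bool" where
  "smooth_form11 A \<omega> \<longleftrightarrow>
     (\<forall>c\<in>set A. \<forall>j k r. cr_on r (coord c ` dom c) (\<lambda>w. \<omega> c (param c w) $ j $ k)) \<and>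
     (\<forall>c\<in>set A. \<forall>c'\<in>set A. \<forall>p\<in>dom c \<inter> dom c'.
        \<omega> c p = pullback11 (coord c' \<circ> param c) (coord c p) (\<omega> c' p))"

text \<open>For a Hermitian coefficient matrix (a real form), \<open>d\<omega> = 0\<close> amounts to \<open>\<partial>\<omega> = 0\<close>, that is, to the
  symmetry of \<open>\<partial>\<omega>\<^sub>j\<^sub>k/\<partial>z\<^sub>l\<close> in \<open>l\<close> and \<open>j\<close>.\<close>

definition kahler_form :: "('a,'n::finite) atlas \<Rightarrow> ('a,'n) form11 \<Rightarrow> bool" where
  "kahler_form A \<omega> \<longleftrightarrow> smooth_form11 A \<omega> \<and>
     (\<forall>c\<in>set A. \<forall>p\<in>dom c.
        (\<forall>j k. \<omega> c p $ j $ k = cnj (\<omega> c p $ k $ j)) \<and>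
        (\<forall>v. v \<noteq> 0 \<longrightarrow> Re (\<Sum>j\<in>UNIV. \<Sum>k\<in>UNIV. \<omega> c p $ j $ k * v $ j * cnj (v $ k)) > 0) \<and>
        (\<forall>j k l. dz l (\<lambda>w. \<omega> c (param c w) $ j $ k) (coord c p)
               = dz j (\<lambda>w. \<omega> c (param c w) $ l $ k) (coord c p)))"

text \<open>Since \<open>(i/2\<pi>) dz \<and> d\<^bold>z = (1/\<pi>) dx \<and> dy\<close>, the density of \<open>\<omega>\<^sup>n/n!\<close> with respect to Lebesgue measure in
  a chart is \<open>det(\<omega>\<^sub>j\<^sub>k)/\<pi>\<^sup>n\<close>.\<close>

definition vol_density :: "('a,'n::finite) form11 \<Rightarrow> ('a,'n) chart \<Rightarrow> 'a \<Rightarrow> real" where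
  "vol_density \<omega> c p = Re (det (\<omega> c p)) / pi ^ CARD('n)"

text \<open>The manifold is the disjoint union of the Borel sets obtained by removing from each coordinate
  domain the preceding ones; the integral against \<open>\<omega>\<^sup>n/n!\<close> is the sum of the integrals over these
  pieces.\<close>

definition piece :: "('a,'n) atlas \<Rightarrow> nat \<Rightarrow> (complex^'n) set" where
  "piece A k = coord (A ! k) ` (dom (A ! k) - (\<Union>j<k. dom (A ! j)))"

definition mf_integrable ::
  "('a,'n::finite) atlas \<Rightarrow> ('a,'n) form11 \<Rightarrow> ('a \<Rightarrow> complex) \<Rightarrow> bool" where
  "mf_integrable A \<omega> f \<longleftrightarrow> (\<forall>k<length A. set_integrable lborel (piece A k)
     (\<lambda>w. f (param (A ! k) w) * of_real (vol_density \<omega> (A ! k) (param (A ! k) w))))"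

definition mf_integral ::
  "('a,'n::finite) atlas \<Rightarrow> ('a,'n) form11 \<Rightarrow> ('a \<Rightarrow> complex) \<Rightarrow> complex" where
  "mf_integral A \<omega> f = (\<Sum>k<length A. set_lebesgue_integral lborel (piece A k)
     (\<lambda>w. f (param (A ! k) w) * of_real (vol_density \<omega> (A ! k) (param (A ! k) w))))"


section \<open>Holomorphic line bundles and Hermitian metrics\<close>

text \<open>A holomorphic line bundle is given by local trivializations \<open>e\<^sub>i\<close> over an open cover
  \<open>(V\<^sub>i)\<^sub>i\<^sub>\<in>\<^sub>I\<close> and transition functions \<open>g\<^sub>i\<^sub>j\<close> with \<open>e\<^sub>j = g\<^sub>i\<^sub>j e\<^sub>i\<close>, so a section \<open>s = s\<^sub>i e\<^sub>i\<close> satisfies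
  \<open>s\<^sub>i = g\<^sub>i\<^sub>j s\<^sub>j\<close>.\<close>

record ('i,'a) line_bundle =
  lb_index :: "'i set"
  lb_cover :: "'i \<Rightarrow> 'a set"
  lb_trans :: "'i \<Rightarrow> 'i \<Rightarrow> 'a \<Rightarrow> complex"

definition hol_line_bundle :: "('a,'n::finite) atlas \<Rightarrow> ('i,'a) line_bundle \<Rightarrow> bool" where
  "hol_line_bundle A L \<longleftrightarrow>
     (\<Union>i\<in>lb_index L. lb_cover L i) = mf_points A \<and>
     (\<forall>i\<in>lb_index L. openin (mf_topology A) (lb_cover L i)) \<and>
     (\<forall>i\<in>lb_index L. \<forall>j\<in>lb_index L.
        mf_hol_on A (lb_cover L i \<inter> lb_cover L j) (lb_trans L i j) \<and>
        (\<forall>x\<in>lb_cover L i \<inter> lb_cover L j. lb_trans L i j x \<noteq> 0)) \<and>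
     (\<forall>i\<in>lb_index L. \<forall>j\<in>lb_index L. \<forall>k\<in>lb_index L.
        \<forall>x\<in>lb_cover L i \<inter> lb_cover L j \<inter> lb_cover L k.
          lb_trans L i j x * lb_trans L j k x = lb_trans L i k x)"

definition tensor_power :: "('i,'a) line_bundle \<Rightarrow> nat \<Rightarrow> ('i,'a) line_bundle" where
  "tensor_power L m = L\<lparr>lb_trans := \<lambda>i j x. lb_trans L i j x ^ m\<rparr>"

type_synonym ('i,'a) lb_section = "'i \<Rightarrow> 'a \<Rightarrow> complex"

definition hol_section ::
  "('a,'n::finite) atlas \<Rightarrow> ('i,'a) line_bundle \<Rightarrow> ('i,'a) lb_section \<Rightarrow> bool" where
  "hol_section A L s \<longleftrightarrow>
     (\<forall>i\<in>lb_index L. mf_hol_on A (lb_cover L i) (s i)) \<and>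
     (\<forall>i\<in>lb_index L. \<forall>j\<in>lb_index L. \<forall>x\<in>lb_cover L i \<inter> lb_cover L j.
        s i x = lb_trans L i j x * s j x)"

text \<open>A Hermitian metric is given by the functions \<open>h\<^sub>i = h(e\<^sub>i, e\<^sub>i)\<close>.\<close>

type_synonym ('i,'a) lb_metric = "'i \<Rightarrow> 'a \<Rightarrow> real"

definition hermitian_metric ::
  "('a,'n::finite) atlas \<Rightarrow> ('i,'a) line_bundle \<Rightarrow> ('i,'a) lb_metric \<Rightarrow> bool" where
  "hermitian_metric A L h \<longleftrightarrow>
     (\<forall>i\<in>lb_index L. mf_smooth_on A (lb_cover L i) (h i) \<and> (\<forall>x\<in>lb_cover L i. h i x > 0)) \<and>
     (\<forall>i\<in>lb_index L. \<forall>j\<in>lb_index L. \<forall>x\<in>lb_cover L i \<inter> lb_cover L j.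
        h j x = (cmod (lb_trans L i j x))\<^sup>2 * h i x)"

text \<open>The value \<open>h(s(x), t(x))\<close>; for sections it does not depend on the chosen trivialization.\<close>

definition herm ::
  "('i,'a) line_bundle \<Rightarrow> ('i,'a) lb_metric \<Rightarrow> ('i,'a) lb_section \<Rightarrow> ('i,'a) lb_section \<Rightarrow> 'a \<Rightarrow> complex"
  where
  "herm L h s t x = (let i = (SOME i. i \<in> lb_index L \<and> x \<in> lb_cover L i)
                     in of_real (h i x) * s i x * cnj (t i x))"

text \<open>\<open>Ric(h) = -(i/2\<pi>) \<partial>\<partial>\<^sup>- log h(e\<^sub>i, e\<^sub>i)\<close> in the chart \<open>c\<close>.\<close>

definition ricci ::
  "('i,'a) lb_metric \<Rightarrow> 'i \<Rightarrow> ('a,'n::finite) form11" where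
  "ricci h i c p = - ddbar (\<lambda>w. ln (h i (param c w))) (coord c p)"

definition has_ricci ::
  "('a,'n::finite) atlas \<Rightarrow> ('i,'a) line_bundle \<Rightarrow> ('i,'a) lb_metric \<Rightarrow> ('a,'n) form11 \<Rightarrow> bool" where
  "has_ricci A L h \<rho> \<longleftrightarrow>
     (\<forall>i\<in>lb_index L. \<forall>c\<in>set A. \<forall>p\<in>lb_cover L i \<inter> dom c. ricci h i c p = \<rho> c p)"

text \<open>Quantization data: \<open>h m\<close> is a metric on \<open>L\<^sup>m\<close> with \<open>Ric(h m) = m\<omega>\<close>, for each \<open>m \<ge> 1\<close>. The case
  \<open>m = 1\<close> contains \<open>c\<^sub>1(L) = [\<omega>]\<close>, since the curvature form \<open>Ric(h 1)\<close> represents \<open>c\<^sub>1(L)\<close>.\<close>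

definition quantization ::
  "('a,'n::finite) atlas \<Rightarrow> ('a,'n) form11 \<Rightarrow> ('i,'a) line_bundle \<Rightarrow> (nat \<Rightarrow> ('i,'a) lb_metric) \<Rightarrow> bool"
  where
  "quantization A \<omega> L h \<longleftrightarrow> hol_line_bundle A L \<and>
     (\<forall>m\<ge>1. hermitian_metric A (tensor_power L m) (h m) \<and>
             has_ricci A (tensor_power L m) (h m) (\<lambda>c p. \<chi> j k. of_nat m * \<omega> c p $ j $ k))"


section \<open>The Hilbert space of square integrable sections and the epsilon function\<close>

definition l2_inner ::
  "('a,'n::finite) atlas \<Rightarrow> ('a,'n) form11 \<Rightarrow> ('i,'a) line_bundle \<Rightarrow> ('i,'a) lb_metric \<Rightarrow>
   ('i,'a) lb_section \<Rightarrow> ('i,'a) lb_section \<Rightarrow> complex" where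
  "l2_inner A \<omega> L h s t = mf_integral A \<omega> (herm L h s t)"

definition l2_sections ::
  "('a,'n::finite) atlas \<Rightarrow> ('a,'n) form11 \<Rightarrow> ('i,'a) line_bundle \<Rightarrow> ('i,'a) lb_metric \<Rightarrow>
   ('i,'a) lb_section set" where
  "l2_sections A \<omega> L h = {s. hol_section A L s \<and> mf_integrable A \<omega> (herm L h s s)}"

definition lin_comb ::
  "('i,'a) lb_section set \<Rightarrow> (('i,'a) lb_section \<Rightarrow> complex) \<Rightarrow> ('i,'a) lb_section" where
  "lin_comb F u = (\<lambda>i x. \<Sum>b\<in>F. u b * b i x)"

definition orthonormal_basis ::
  "('a,'n::finite) atlas \<Rightarrow> ('a,'n) form11 \<Rightarrow> ('i,'a) line_bundle \<Rightarrow> ('i,'a) lb_metric \<Rightarrow>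
   ('i,'a) lb_section set \<Rightarrow> bool" where
  "orthonormal_basis A \<omega> L h B \<longleftrightarrow> B \<subseteq> l2_sections A \<omega> L h \<and>
     (\<forall>s\<in>B. \<forall>t\<in>B. l2_inner A \<omega> L h s t = (if s = t then 1 else 0)) \<and>
     (\<forall>s\<in>l2_sections A \<omega> L h. \<forall>e>0. \<exists>F u. finite F \<and> F \<subseteq> B \<and>
        (let d = (\<lambda>i x. s i x - lin_comb F u i x) in Re (l2_inner A \<omega> L h d d) < e))"

definition epsilon_fun ::
  "('i,'a) line_bundle \<Rightarrow> ('i,'a) lb_metric \<Rightarrow> ('i,'a) lb_section set \<Rightarrow> 'a \<Rightarrow> real" where
  "epsilon_fun L h B x = (\<Sum>\<^sub>\<infinity>s\<in>B. Re (herm L h s s x))"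


section \<open>The Tian-Yau-Zelditch expansion\<close>

text \<open>The \<open>C\<^sup>r\<close> norm over a compact set \<open>K\<close> is taken with respect to a decomposition of \<open>K\<close> into finitely
  many compact pieces, each lying in a coordinate domain; different decompositions give equivalent
  norms. Then \<open>cr_norm_le A r D f b\<close> says that \<open>f\<close> is of class \<open>C\<^sup>r\<close> and has norm at most \<open>b\<close>.\<close>

definition chart_decomposition ::
  "('a,'n::finite) atlas \<Rightarrow> 'a set \<Rightarrow> (('a,'n) chart \<times> 'a set) set \<Rightarrow> bool" where
  "chart_decomposition A K D \<longleftrightarrow> finite D \<and> K = (\<Union>(c,K')\<in>D. K') \<and>
     (\<forall>(c,K')\<in>D. c \<in> set A \<and> K' \<subseteq> dom c \<and> compactin (mf_topology A) K')"

definition cr_norm_le ::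
  "('a,'n::finite) atlas \<Rightarrow> nat \<Rightarrow> (('a,'n) chart \<times> 'a set) set \<Rightarrow> ('a \<Rightarrow> real) \<Rightarrow> real \<Rightarrow> bool" where
  "cr_norm_le A r D f b \<longleftrightarrow> mf_cr_on A r (mf_points A) f \<and>
     (\<forall>(c,K')\<in>D. \<forall>p\<in>K'. \<forall>vs. set vs \<subseteq> Basis \<and> length vs \<le> r \<longrightarrow>
        \<bar>iter_pderiv vs (f \<circ> param c) (coord c p)\<bar> \<le> b)"

definition tyz_expansion ::
  "('a,'n::finite) atlas \<Rightarrow> (nat \<Rightarrow> 'a \<Rightarrow> real) \<Rightarrow> (nat \<Rightarrow> 'a \<Rightarrow> real) \<Rightarrow> bool" where
  "tyz_expansion A eps a \<longleftrightarrow>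
     (\<forall>x\<in>mf_points A. a 0 x = 1) \<and>
     (\<forall>j\<ge>1. mf_smooth_on A (mf_points A) (a j)) \<and>
     (\<forall>k r K D. compactin (mf_topology A) K \<and> chart_decomposition A K D \<longrightarrow>
        (\<exists>C. \<forall>\<^sub>F m in sequentially. cr_norm_le A r D
           (\<lambda>x. eps m x - (\<Sum>j\<le>k. a j x * real m powi (int CARD('n) - int j)))
           (C * real m powi (int CARD('n) - int k - 1))))"


section \<open>The blow-up of the complex plane at the origin and the Simanca metric\<close>

text \<open>A point of the projective line is the set of its homogeneous coordinate vectors.\<close>

definition proj_point :: "complex^2 \<Rightarrow> (complex^2) set" where
  "proj_point t = {c *s t | c. c \<noteq> 0}"

type_synonym blowup_point = "(complex^2) \<times> (complex^2) set"

definition blowup :: "blowup_point set" where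
  "blowup = {(z, proj_point t) | z t. t \<noteq> 0 \<and> t $ 1 * z $ 2 - t $ 2 * z $ 1 = 0}"

definition exceptional_divisor :: "blowup_point set" where
  "exceptional_divisor = {q \<in> blowup. fst q = 0}"

text \<open>The standard charts \<open>(z\<^sub>1, t\<^sub>2/t\<^sub>1)\<close> on \<open>t\<^sub>1 \<noteq> 0\<close> and \<open>(z\<^sub>2, t\<^sub>1/t\<^sub>2)\<close> on \<open>t\<^sub>2 \<noteq> 0\<close>.\<close>

definition blowup_chart1 :: "(blowup_point, 2) chart" where
  "blowup_chart1 = ({q \<in> blowup. \<forall>t\<in>snd q. t $ 1 \<noteq> 0},
     \<lambda>q. let t = (SOME t. t \<in> snd q) in vector [fst q $ 1, t $ 2 / t $ 1])"

definition blowup_chart2 :: "(blowup_point, 2) chart" where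
  "blowup_chart2 = ({q \<in> blowup. \<forall>t\<in>snd q. t $ 2 \<noteq> 0},
     \<lambda>q. let t = (SOME t. t \<in> snd q) in vector [fst q $ 2, t $ 1 / t $ 2])"

definition blowup_atlas :: "(blowup_point, 2) atlas" where
  "blowup_atlas = [blowup_chart1, blowup_chart2]"

lemma mf_points_blowup_atlas: "mf_points blowup_atlas = blowup"
proof
  show "mf_points blowup_atlas \<subseteq> blowup"
    by (auto simp: mf_points_def blowup_atlas_def blowup_chart1_def blowup_chart2_def)
  show "blowup \<subseteq> mf_points blowup_atlas"
  proof
    fix q assume q: "q \<in> blowup"
    then obtain z t where t: "q = (z, proj_point t)" "t \<noteq> 0"
      by (auto simp: blowup_def)
    from t(2) have "t $ 1 \<noteq> 0 \<or> t $ 2 \<noteq> 0"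
      by (auto simp: vec_eq_iff forall_2)
    then show "q \<in> mf_points blowup_atlas"
      using q t(1)
      by (auto simp: mf_points_def blowup_atlas_def blowup_chart1_def blowup_chart2_def proj_point_def)
  qed
qed

definition simanca_potential :: "complex^2 \<Rightarrow> real" where
  "simanca_potential z = (norm z)\<^sup>2 + ln ((norm z)\<^sup>2)"

text \<open>The form \<open>\<omega>\<^sub>S\<close> is characterized as the Kaehler form on the blow-up which, off the exceptional divisor,
  is the pullback of \<open>(i/2\<pi>) \<partial>\<partial>\<^sup>- (|z|\<^sup>2 + log |z|\<^sup>2)\<close> under the projection to the plane.\<close>

definition simanca_form :: "(blowup_point, 2) form11 \<Rightarrow> bool" where
  "simanca_form \<omega> \<longleftrightarrow> kahler_form blowup_atlas \<omega> \<and>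
     (\<forall>c\<in>set blowup_atlas. \<forall>p\<in>dom c - exceptional_divisor.
        \<omega> c p = pullback11 (fst \<circ> param c) (coord c p) (ddbar simanca_potential (fst p)))"

end

theory Submission
  imports Defs "HOL-Complex_Analysis.Cauchy_Integral_Formula" "HOL-Probability.Distributions"
begin

text \<open>
  The epsilon function of the Simanca metric equals \<open>m\<^sup>2\<close> for every \<open>m \<ge> 1\<close>
  (\<open>epsilon_fun_simanca\<close>), so the expansion consists of its leading term alone, and evaluation at a point shows
  that no other expansion exists (\<open>tyz_expansion_unique\<close>).

  To compute the epsilon function, let \<open>z, t\<close> be the coordinates of the first chart, where
  \<open>\<phi> = |z|\<^sup>2 (1 + |t|\<^sup>2) + log (1 + |t|\<^sup>2)\<close> is a potential of the form; the second chart, with coordinates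
  \<open>w = z t\<close> and \<open>u = 1/t\<close>, has the same potential in its own coordinates. A Hermitian metric of curvature \<open>m \<omega>\<close>
  differs locally from \<open>exp (- m \<phi>)\<close> by the squared modulus of a holomorphic function, since the logarithm of the
  quotient is pluriharmonic. Hence there are local holomorphic frames of squared norm \<open>exp (- m \<phi>)\<close>. Two of
  them differ by a constant of modulus one, so they form a locally constant sheaf, which has global sections over
  the simply connected chart (\<open>unit_frame_exists\<close>). The frames over the two charts differ by the factor \<open>t\<^sup>m\<close>
  on the overlap (\<open>unit_frames_two_charts\<close>). In this way every bundle with the given curvature is identified
  with a fixed model: a square integrable section becomes an entire function \<open>f\<close> of \<open>z, t\<close> such that
  \<open>u\<^sup>m f (w u, 1/u)\<close> is entire as well, with the norm of an explicit weighted \<open>L\<^sup>2\<close> space.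

  In the model the monomials \<open>z\<^sup>j t\<^sup>b\<close> with \<open>b \<le> j + m\<close> are orthogonal, with squared norm
  \<open>j! b! (j+m-b)! / (m\<^sup>j\<^sup>+\<^sup>2 (j+m)!)\<close>. By the binomial theorem and the exponential series the normalized
  monomials have squared pointwise norms adding up to \<open>m\<^sup>2\<close> at every point (\<open>sum_monom_sq\<close>). This gives
  the estimate \<open>|s (x)|\<^sup>2 \<le> m\<^sup>2 \<parallel>s\<parallel>\<^sup>2\<close> for all sections (\<open>bergman_inequality\<close>), and the sections dual to the
  evaluation at \<open>x\<close> on spans of monomials show that \<open>m\<^sup>2\<close> is the best constant. The best constant is the value
  at \<open>x\<close> of the epsilon function of any orthonormal basis (\<open>orthonormal_basis_extremal\<close>).
\<close>

section \<open>Holomorphic functions of several variables\<close>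

definition hol_at :: "(complex^'n \<Rightarrow> complex) \<Rightarrow> complex^'n \<Rightarrow> bool" where
  "hol_at F z \<longleftrightarrow> (\<exists>D. (F has_derivative D) (at z) \<and> (\<forall>c v. D (c *s v) = c * D v))"

lemma hol_on_iff_hol_at: "hol_on S F \<longleftrightarrow> (\<forall>z\<in>S. hol_at F z)"
  by (simp add: hol_on_def hol_at_def)

lemma hol_at_const: "hol_at (\<lambda>_. c) z"
  unfolding hol_at_def by (rule exI[of _ "\<lambda>_. 0"]) auto

lemma hol_at_coord: "hol_at (\<lambda>x. x $ k) z"
  unfolding hol_at_def
  by (rule exI[of _ "\<lambda>x. x $ k"]) (auto intro!: bounded_linear_imp_has_derivative bounded_linear_vec_nth)

lemma hol_at_add: "hol_at F z \<Longrightarrow> hol_at G z \<Longrightarrow> hol_at (\<lambda>x. F x + G x) z"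
  unfolding hol_at_def
  by (elim exE conjE, rule_tac x="\<lambda>h. D h + Da h" in exI) (auto intro: has_derivative_add simp: algebra_simps)

lemma hol_at_mult: "hol_at F z \<Longrightarrow> hol_at G z \<Longrightarrow> hol_at (\<lambda>x. F x * G x) z"
  unfolding hol_at_def
  by (elim exE conjE, rule_tac x="\<lambda>h. F z * Da h + D h * G z" in exI, rule conjI, rule has_derivative_mult)
    (auto simp: algebra_simps)

lemma hol_at_chain:
  assumes "hol_at F z" "(f has_field_derivative f') (at (F z))"
  shows "hol_at (\<lambda>x. f (F x)) z"
proof -
  obtain D where D: "(F has_derivative D) (at z)" "\<And>c v. D (c *s v) = c * D v"
    using assms(1) by (auto simp: hol_at_def)
  have "((\<lambda>x. f (F x)) has_derivative (\<lambda>h. f' * D h)) (at z)"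
    using has_derivative_compose[OF D(1) assms(2)[unfolded has_field_derivative_def]] .
  then show ?thesis unfolding hol_at_def using D(2) by (intro exI[of _ "\<lambda>h. f' * D h"]) auto
qed

lemma hol_at_inverse: "hol_at F z \<Longrightarrow> F z \<noteq> 0 \<Longrightarrow> hol_at (\<lambda>x. inverse (F x)) z"
  by (rule hol_at_chain, assumption) (rule DERIV_inverse)

lemma hol_at_divide: "hol_at F z \<Longrightarrow> hol_at G z \<Longrightarrow> G z \<noteq> 0 \<Longrightarrow> hol_at (\<lambda>x. F x / G x) z"
  unfolding divide_inverse by (intro hol_at_mult hol_at_inverse)

lemma hol_at_exp: "hol_at F z \<Longrightarrow> hol_at (\<lambda>x. exp (F x)) z"
  by (rule hol_at_chain, assumption) (rule DERIV_exp)

lemma hol_at_power: "hol_at F z \<Longrightarrow> hol_at (\<lambda>x. F x ^ n) z"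
  by (induction n) (auto intro: hol_at_const hol_at_mult)

lemma hol_at_sum: "finite I \<Longrightarrow> (\<And>i. i \<in> I \<Longrightarrow> hol_at (F i) z) \<Longrightarrow> hol_at (\<lambda>x. \<Sum>i\<in>I. F i x) z"
  by (induction I rule: finite_induct) (auto intro: hol_at_const hol_at_add)

lemma hol_at_cong_open:
  assumes "hol_at F z" "open N" "z \<in> N" "\<And>y. y \<in> N \<Longrightarrow> F y = G y"
  shows "hol_at G z"
  using assms has_derivative_transform_within_open[of F _ z UNIV N G] unfolding hol_at_def by blast

lemma hol_at_continuous: "hol_at F z \<Longrightarrow> isCont F z"
  unfolding hol_at_def by (blast intro: has_derivative_continuous)

lemma hol_at_compose:
  fixes \<Phi> :: "complex^'n \<Rightarrow> complex^'k"
  assumes F: "hol_at F (\<Phi> z)" and \<Phi>: "\<And>k. hol_at (\<lambda>x. \<Phi> x $ k) z"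
  shows "hol_at (\<lambda>x. F (\<Phi> x)) z"
proof -
  obtain D where D: "(F has_derivative D) (at (\<Phi> z))" "\<And>c v. D (c *s v) = c * D v"
    using F by (auto simp: hol_at_def)
  obtain P where P: "\<And>k. ((\<lambda>x. \<Phi> x $ k) has_derivative P k) (at z)" "\<And>k c v. P k (c *s v) = c * P k v"
    using \<Phi> unfolding hol_at_def by metis
  have "(\<Phi> has_derivative (\<lambda>h. \<chi> k. P k h)) (at z)"
  proof -
    have "((\<lambda>x. \<chi> k. \<Phi> x $ k) has_derivative (\<lambda>h. \<chi> k. P k h)) (at z)"
      using P(1) unfolding has_derivative_componentwise_within[of "\<lambda>x. \<chi> k. \<Phi> x $ k"] Basis_vec_def
      by (auto simp: inner_axis intro!: has_derivative_inner_left)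
    then show ?thesis by simp
  qed
  from has_derivative_compose[OF this D(1)]
  have "((\<lambda>x. F (\<Phi> x)) has_derivative (\<lambda>h. D (\<chi> k. P k h))) (at z)" .
  moreover have "(\<chi> k. P k (c *s v)) = c *s (\<chi> k. P k v)" for c v by (simp add: vec_eq_iff P(2))
  ultimately show ?thesis unfolding hol_at_def
    by (intro exI[of _ "\<lambda>h. D (\<chi> k. P k h)"]) (simp add: D(2))
qed

text \<open>If the modulus is constant, differentiating \<open>F\<close> times its conjugate in the directions \<open>v\<close> and
  \<open>\<i> v\<close> shows that the derivative vanishes.\<close>

lemma unimodular_hol_constant:
  fixes F :: "complex^'n \<Rightarrow> complex"
  assumes W: "open W" "connected W" and hol: "\<And>x. x \<in> W \<Longrightarrow> hol_at F x" and mod: "\<And>x. x \<in> W \<Longrightarrow> cmod (F x) = 1"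
  shows "\<exists>c. cmod c = 1 \<and> (\<forall>x\<in>W. F x = c)"
proof (cases "W = {}")
  case True then show ?thesis by (intro exI[of _ 1]) auto
next
  case False
  then obtain x0 where x0: "x0 \<in> W" by auto
  have der: "(F has_derivative (\<lambda>h. 0)) (at x)" if x: "x \<in> W" for x
  proof -
    obtain D where D: "(F has_derivative D) (at x)" "\<And>c v. D (c *s v) = c * D v"
      using hol[OF x] by (auto simp: hol_at_def)
    have "((\<lambda>y. F y * cnj (F y)) has_derivative (\<lambda>h. F x * cnj (D h) + D h * cnj (F x))) (at x)"
      by (intro has_derivative_mult D has_derivative_cnj)
    moreover have "((\<lambda>y. F y * cnj (F y)) has_derivative (\<lambda>h. 0)) (at x)"
      by (rule has_derivative_transform_within_open[OF has_derivative_const W(1) x])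
         (simp add: mod complex_norm_square[symmetric])
    ultimately have "(\<lambda>h. F x * cnj (D h) + D h * cnj (F x)) = (\<lambda>h. 0)"
      by (rule has_derivative_unique)
    then have eq: "F x * cnj (D h) + D h * cnj (F x) = 0" for h by metis
    have "D h = 0" for h
    proof -
      have "\<i> * (D h * cnj (F x) - F x * cnj (D h)) = 0"
        using eq[of "\<i> *s h"] unfolding D(2) by (simp add: algebra_simps)
      then have "D h * cnj (F x) = 0" using eq[of h] by (auto simp: algebra_simps)
      moreover have "F x \<noteq> 0" using mod[OF x] by auto
      ultimately show ?thesis by simp
    qed
    then have "D = (\<lambda>h. 0)" by auto
    with D(1) show ?thesis by simp
  qed
  have "F x = F x0" if "x \<in> W" for x
    using has_derivative_zero_unique_connected[OF W der that x0] by simp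
  with mod[OF x0] show ?thesis by blast
qed


section \<open>Global sections of a locally constant sheaf on a vector space\<close>

text \<open>A section on a ball extends across the bounding sphere, because two small balls
  centred on the sphere which meet also meet inside the ball, on the chord between their centres. So the
  radii of the balls about the origin that carry a section are unbounded, and these sections glue.
  The sections are functions \<open>\<sigma>\<close>, and \<open>LF \<sigma> x\<close> says that the germ of \<open>\<sigma>\<close> at \<open>x\<close> belongs to the sheaf.\<close>

lemma locally_constant_sheaf_global_section:
  fixes LF :: "('e::euclidean_space \<Rightarrow> 'v) \<Rightarrow> 'e \<Rightarrow> bool"
  assumes loc: "\<And>\<sigma> \<tau> N x. LF \<sigma> x \<Longrightarrow> open N \<Longrightarrow> x \<in> N \<Longrightarrow> (\<And>y. y \<in> N \<Longrightarrow> \<sigma> y = \<tau> y) \<Longrightarrow> LF \<tau> x"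
    and trans: "\<And>\<sigma> \<tau> W. open W \<Longrightarrow> connected W \<Longrightarrow> (\<And>y. y \<in> W \<Longrightarrow> LF \<sigma> y) \<Longrightarrow> (\<And>y. y \<in> W \<Longrightarrow> LF \<tau> y) \<Longrightarrow>
        \<exists>\<tau>'. (\<forall>x. LF \<tau> x \<longrightarrow> LF \<tau>' x) \<and> (\<forall>y\<in>W. \<tau>' y = \<sigma> y)"
    and uniq: "\<And>\<sigma> \<tau> W a y. open W \<Longrightarrow> connected W \<Longrightarrow> (\<And>y. y \<in> W \<Longrightarrow> LF \<sigma> y) \<Longrightarrow> (\<And>y. y \<in> W \<Longrightarrow> LF \<tau> y) \<Longrightarrow>
        a \<in> W \<Longrightarrow> \<sigma> a = \<tau> a \<Longrightarrow> y \<in> W \<Longrightarrow> \<sigma> y = \<tau> y"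
    and ex: "\<And>x. \<exists>e>0. \<exists>\<sigma>. \<forall>y\<in>ball x e. LF \<sigma> y"
  shows "\<exists>\<sigma>. \<forall>y. LF \<sigma> y"
proof -
  define R where "R = {r. r > 0 \<and> (\<exists>\<sigma>. \<forall>y\<in>ball 0 r. LF \<sigma> y)}"
  have R_nonempty: "R \<noteq> {}" using ex[of 0] unfolding R_def by blast
  have glue: "\<exists>\<sigma>. \<forall>y\<in>(\<Union>r\<in>R. ball 0 r). LF \<sigma> y"
  proof -
    obtain r1 where r1: "r1 \<in> R" using R_nonempty by auto
    then obtain \<sigma>1 where \<sigma>1: "r1 > 0" "\<And>y. y \<in> ball 0 r1 \<Longrightarrow> LF \<sigma>1 y" unfolding R_def by blast
    have "\<exists>\<tau>. (\<forall>y\<in>ball 0 r. LF \<tau> y) \<and> \<tau> 0 = \<sigma>1 0" if r: "r \<in> R" for r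
    proof -
      obtain \<sigma> where \<sigma>: "r > 0" "\<And>y. y \<in> ball 0 r \<Longrightarrow> LF \<sigma> y" using r unfolding R_def by blast
      have "\<exists>\<tau>'. (\<forall>x. LF \<sigma> x \<longrightarrow> LF \<tau>' x) \<and> (\<forall>y\<in>ball 0 (min r r1). \<tau>' y = \<sigma>1 y)"
        using \<sigma> \<sigma>1 by (intro trans) auto
      then obtain \<tau>' where \<tau>': "\<And>x. LF \<sigma> x \<Longrightarrow> LF \<tau>' x" "\<And>y. y \<in> ball 0 (min r r1) \<Longrightarrow> \<tau>' y = \<sigma>1 y" by blast
      from \<tau>'(2)[of 0] \<sigma>(1) \<sigma>1(1) have "\<tau>' 0 = \<sigma>1 0" by simp
      with \<tau>'(1) \<sigma>(2) show ?thesis by blast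
    qed
    then obtain \<tau> where \<tau>: "\<And>r y. r \<in> R \<Longrightarrow> y \<in> ball 0 r \<Longrightarrow> LF (\<tau> r) y" "\<And>r. r \<in> R \<Longrightarrow> \<tau> r 0 = \<sigma>1 0"
      by metis
    have agree: "\<tau> r y = \<tau> r' y" if "r \<in> R" "r' \<in> R" "y \<in> ball 0 r" "y \<in> ball 0 r'" for r r' y
    proof (rule uniq[of "ball 0 (min r r')" _ _ 0])
      show "0 \<in> ball (0::'e) (min r r')" using that by (auto simp: R_def)
    qed (use that \<tau> in auto)
    define \<sigma> where "\<sigma> y = \<tau> (SOME r. r \<in> R \<and> y \<in> ball 0 r) y" for y
    have \<sigma>: "\<sigma> y = \<tau> r y" if "r \<in> R" "y \<in> ball 0 r" for r y
    proof -
      have "(SOME r. r \<in> R \<and> y \<in> ball 0 r) \<in> R \<and> y \<in> ball 0 (SOME r. r \<in> R \<and> y \<in> ball 0 r)"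
        by (rule someI[of "\<lambda>r. r \<in> R \<and> y \<in> ball 0 r" r]) (use that in blast)
      then show ?thesis unfolding \<sigma>_def using agree that by blast
    qed
    have "LF \<sigma> y" if "r \<in> R" "y \<in> ball 0 r" for r y
      by (rule loc[OF \<tau>(1)[OF that] open_ball that(2)]) (rule \<sigma>[OF that(1), symmetric])
    then show ?thesis by blast
  qed
  have extend: "\<exists>r'\<in>R. r < r'" if r: "r \<in> R" for r
  proof -
    obtain \<sigma> where \<sigma>: "r > 0" "\<And>y. y \<in> ball 0 r \<Longrightarrow> LF \<sigma> y" using r unfolding R_def by blast
    have "\<exists>e \<tau>. e > 0 \<and> (\<forall>y\<in>ball p e. LF \<tau> y) \<and> (\<forall>y\<in>ball p e \<inter> ball 0 r. \<tau> y = \<sigma> y)" for p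
    proof -
      obtain e \<tau> where e: "e > 0" "\<forall>y\<in>ball p e. LF \<tau> y" using ex[of p] by blast
      have "\<exists>\<tau>'. (\<forall>x. LF \<tau> x \<longrightarrow> LF \<tau>' x) \<and> (\<forall>y\<in>ball p e \<inter> ball 0 r. \<tau>' y = \<sigma> y)"
        using e \<sigma> by (intro trans) (auto intro!: convex_connected convex_Int)
      with e show ?thesis by blast
    qed
    then obtain e \<tau> where e: "\<And>p. e p > 0" and \<tau>: "\<And>p y. y \<in> ball p (e p) \<Longrightarrow> LF (\<tau> p) y"
        "\<And>p y. y \<in> ball p (e p) \<Longrightarrow> y \<in> ball 0 r \<Longrightarrow> \<tau> p y = \<sigma> y"
      by (metis IntI)
    have agree: "\<tau> p y = \<tau> q y" if "norm p = r" "norm q = r" "y \<in> ball p (e p)" "y \<in> ball q (e q)" for p q y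
    proof (cases "p = q")
      case False
      \<comment> \<open>Dividing the chord in the ratio of the radii gives a point of both small balls; by strict convexity of
        the norm it lies inside the large ball.\<close>
      define s where "s = e p / (e p + e q)"
      have ep: "e p > 0" "e q > 0" "e p + e q > 0" using e[of p] e[of q] by auto
      have s: "0 < s" "s < 1" "1 - s = e q / (e p + e q)" using ep by (auto simp: s_def field_simps)
      have d: "norm (p - q) < e p + e q"
        using that(3,4) dist_triangle[of p q y] by (simp add: dist_norm norm_minus_commute)
      define c where "c = p + s *\<^sub>R (q - p)"
      have "norm (c - p) = s * norm (p - q)" using s by (simp add: c_def norm_minus_commute)
      also have "\<dots> < e p" using mult_strict_left_mono[OF d ep(1)] ep by (simp add: s_def field_simps)
      finally have cp: "c \<in> ball p (e p)" by (simp add: dist_norm norm_minus_commute)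
      have "c - q = (1 - s) *\<^sub>R (p - q)" by (simp add: c_def algebra_simps)
      then have "norm (c - q) = (1 - s) * norm (p - q)" using s(2) by (metis abs_of_pos diff_gt_0_iff_gt norm_scaleR)
      also have "\<dots> < e q" unfolding s(3) using mult_strict_left_mono[OF d ep(2)] ep by (simp add: field_simps)
      finally have cq: "c \<in> ball q (e q)" by (simp add: dist_norm norm_minus_commute)
      have pp: "p \<bullet> p = r\<^sup>2" "q \<bullet> q = r\<^sup>2" using that by (simp_all add: dot_square_norm)
      have "(norm c)\<^sup>2 = r\<^sup>2 - s * (1 - s) * (norm (p - q))\<^sup>2"
        unfolding power2_norm_eq_inner c_def
        using pp by (simp add: inner_simps inner_commute algebra_simps power2_eq_square)
      also have "\<dots> < r\<^sup>2" using s(1,2) False by simp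
      finally have "norm c < r" using \<sigma>(1) by (simp add: power2_less_imp_less)
      then have "\<tau> p c = \<tau> q c" using \<tau>(2) cp cq by simp
      then show ?thesis
        by (intro uniq[of "ball p (e p) \<inter> ball q (e q)" "\<tau> p" "\<tau> q" c y])
           (use that cp cq \<tau>(1) in \<open>auto intro!: convex_connected convex_Int\<close>)
    qed simp
    define \<sigma>' where "\<sigma>' y = (if y \<in> ball 0 r then \<sigma> y else \<tau> (SOME p. norm p = r \<and> y \<in> ball p (e p)) y)" for y
    have \<sigma>': "\<sigma>' y = \<tau> p y" if "norm p = r" "y \<in> ball p (e p)" for p y
    proof (cases "y \<in> ball 0 r")
      case True then show ?thesis using \<tau>(2) that by (simp add: \<sigma>'_def)
    next
      case False
      define q where "q = (SOME p. norm p = r \<and> y \<in> ball p (e p))"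
      have q: "norm q = r \<and> y \<in> ball q (e q)"
        unfolding q_def by (rule someI[of "\<lambda>p. norm p = r \<and> y \<in> ball p (e p)" p]) (use that in blast)
      have "\<sigma>' y = \<tau> q y" using False by (simp only: \<sigma>'_def q_def if_False)
      also have "\<dots> = \<tau> p y" using q that by (intro agree) auto
      finally show ?thesis .
    qed
    define N where "N = ball 0 r \<union> (\<Union>p\<in>sphere 0 r. ball p (e p))"
    have LFN: "LF \<sigma>' y" if yN: "y \<in> N" for y
    proof -
      consider "y \<in> ball 0 r" | p where "norm p = r" "y \<in> ball p (e p)" using yN by (auto simp: N_def)
      then show ?thesis
      proof cases
        case 1
        show ?thesis by (rule loc[OF \<sigma>(2)[OF 1] open_ball 1]) (simp add: \<sigma>'_def)
      next
        case 2
        show ?thesis by (rule loc[OF \<tau>(1)[OF 2(2)] open_ball 2(2)]) (rule \<sigma>'[OF 2(1), symmetric])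
      qed
    qed
    have "cball 0 r \<subseteq> N" using e by (force simp: N_def dist_norm)
    moreover have "open N" unfolding N_def by auto
    ultimately obtain d where d: "d > 0" "(\<Union>x\<in>cball 0 r. ball x d) \<subseteq> N"
      using compact_subset_open_imp_ball_epsilon_subset[OF compact_cball] by metis
    have "ball 0 (r + d) \<subseteq> N"
    proof
      fix y :: 'e assume "y \<in> ball 0 (r + d)"
      then have y: "norm y < r + d" by simp
      show "y \<in> N"
      proof (cases "norm y \<le> r")
        case True then show ?thesis using \<open>cball 0 r \<subseteq> N\<close> by auto
      next
        case False
        then have ny: "norm y > r" "norm y > 0" using \<sigma>(1) by auto
        have "y - (r / norm y) *\<^sub>R y = (1 - r / norm y) *\<^sub>R y" by (simp add: algebra_simps)
        then have "norm (y - (r / norm y) *\<^sub>R y) = \<bar>1 - r / norm y\<bar> * norm y" by (metis norm_scaleR)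
        also have "\<dots> = norm y - r" using ny by (simp add: field_simps)
        finally have "y \<in> ball ((r / norm y) *\<^sub>R y) d" using y by (simp add: dist_norm norm_minus_commute)
        moreover have "(r / norm y) *\<^sub>R y \<in> cball 0 r" using ny \<sigma>(1) by simp
        ultimately show ?thesis using d(2) by blast
      qed
    qed
    then have "r + d \<in> R" unfolding R_def using LFN \<sigma>(1) d(1) by auto
    then show ?thesis using d(1) by (intro bexI[of _ "r + d"]) auto
  qed
  have "(\<Union>r\<in>R. ball 0 r) = (UNIV :: 'e set)"
  proof (cases "bdd_above R")
    case False
    have "\<exists>r\<in>R. norm y < r" for y :: 'e
      using False unfolding bdd_above_def by (auto simp: not_le)
    then show ?thesis by (metis UNIV_eq_I UN_I mem_ball_0)
  next
    case True
    have sup: "r < Sup R" if "r \<in> R" for r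
      using extend[OF that] cSup_upper[OF _ True] by force
    have "(\<Union>r\<in>R. ball 0 r) = (ball 0 (Sup R) :: 'e set)"
      using sup less_cSup_iff[OF R_nonempty True] by (force simp: dist_norm)
    with glue have "Sup R \<in> R" using sup R_nonempty unfolding R_def by fastforce
    with sup show ?thesis by blast
  qed
  with glue show ?thesis by simp
qed

section \<open>Pluriharmonic functions are locally real parts of holomorphic functions\<close>

definition c1_on :: "'a::euclidean_space set \<Rightarrow> ('a \<Rightarrow> 'b::real_normed_vector) \<Rightarrow> bool" where
  "c1_on S F \<longleftrightarrow> (\<forall>x\<in>S. F differentiable (at x)) \<and>
     (\<forall>v. continuous_on S (\<lambda>x. frechet_derivative F (at x) v))"

lemma c1_onI:
  assumes "\<And>x. x \<in> S \<Longrightarrow> (F has_derivative D x) (at x)" "\<And>v. continuous_on S (\<lambda>x. D x v)"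
  shows "c1_on S F"
proof -
  have "continuous_on S (\<lambda>x. frechet_derivative F (at x) v)" for v
    using assms(2)[of v] by (rule continuous_on_eq) (use assms(1) frechet_derivative_at in metis)
  then show ?thesis using assms(1) by (auto simp: c1_on_def differentiable_def)
qed

lemma c1_on_derivative:
  "c1_on S F \<Longrightarrow> x \<in> S \<Longrightarrow> (F has_derivative frechet_derivative F (at x)) (at x)"
  by (simp add: c1_on_def frechet_derivative_works)

lemma c1_on_continuous: "c1_on S F \<Longrightarrow> continuous_on S F"
  by (auto simp: c1_on_def intro!: continuous_at_imp_continuous_on differentiable_imp_continuous_within)

lemma c1_on_bounded_linear: "bounded_linear f \<Longrightarrow> c1_on S f"
  by (rule c1_onI[where D="\<lambda>_. f"]) (auto intro: bounded_linear_imp_has_derivative)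

lemma c1_on_const: "c1_on S (\<lambda>_. c)"
  by (rule c1_onI[where D="\<lambda>_ _. 0"]) auto

lemma c1_on_add: "c1_on S F \<Longrightarrow> c1_on S G \<Longrightarrow> c1_on S (\<lambda>x. F x + G x)"
  by (rule c1_onI[where D="\<lambda>x h. frechet_derivative F (at x) h + frechet_derivative G (at x) h"])
     (auto intro!: has_derivative_add c1_on_derivative continuous_on_add simp: c1_on_def)

lemma c1_on_mult:
  fixes F :: "_ \<Rightarrow> 'b::real_normed_algebra"
  assumes F: "c1_on S F" and G: "c1_on S G"
  shows "c1_on S (\<lambda>x. F x * G x)"
proof (rule c1_onI[where D="\<lambda>x h. F x * frechet_derivative G (at x) h + frechet_derivative F (at x) h * G x"])
  show "continuous_on S (\<lambda>x. F x * frechet_derivative G (at x) v + frechet_derivative F (at x) v * G x)" for v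
    using F G c1_on_continuous[OF F] c1_on_continuous[OF G] unfolding c1_on_def
    by (intro continuous_on_add continuous_on_mult) auto
qed (auto intro!: has_derivative_mult c1_on_derivative F G)

lemma c1_on_inverse:
  fixes F :: "_ \<Rightarrow> 'b::real_normed_field"
  assumes F: "c1_on S F" and nz: "\<And>x. x \<in> S \<Longrightarrow> F x \<noteq> 0"
  shows "c1_on S (\<lambda>x. inverse (F x))"
proof (rule c1_onI[where D="\<lambda>x h. - (inverse (F x) * frechet_derivative F (at x) h * inverse (F x))"])
  show "continuous_on S (\<lambda>x. - (inverse (F x) * frechet_derivative F (at x) v * inverse (F x)))" for v
    using F c1_on_continuous[OF F] nz unfolding c1_on_def
    by (intro continuous_on_minus continuous_on_mult continuous_on_inverse) auto
qed (auto intro!: Deriv.has_derivative_inverse c1_on_derivative F nz)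

lemma c1_on_linear_compose:
  assumes "bounded_linear f" "c1_on S F"
  shows "c1_on S (\<lambda>x. f (F x))"
proof (rule c1_onI[where D="\<lambda>x h. f (frechet_derivative F (at x) h)"])
  show "((\<lambda>x. f (F x)) has_derivative (\<lambda>h. f (frechet_derivative F (at x) h))) (at x)" if "x \<in> S" for x
    using bounded_linear.has_derivative[OF assms(1) c1_on_derivative[OF assms(2) that]] .
  show "continuous_on S (\<lambda>x. f (frechet_derivative F (at x) v))" for v
    using assms(2) by (intro bounded_linear.continuous_on[OF assms(1)]) (simp add: c1_on_def)
qed

text \<open>Differentiation under the integral sign asks for the derivative as a continuous map into the bounded
  linear maps; it is assembled here from its values on the basis vectors.\<close>

lemma c1_on_blinfun:
  fixes F :: "'a::euclidean_space \<Rightarrow> 'b::real_normed_vector"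
  assumes "c1_on S F"
  obtains F' where "\<And>x. x \<in> S \<Longrightarrow> (F has_derivative blinfun_apply (F' x)) (at x)" "continuous_on S F'"
    "\<And>x. x \<in> S \<Longrightarrow> blinfun_apply (F' x) = frechet_derivative F (at x)"
proof -
  define F' where "F' x = (\<Sum>b\<in>Basis. blinfun_scaleR_left (frechet_derivative F (at x) b) o\<^sub>L blinfun_inner_right b)" for x
  have eq: "blinfun_apply (F' x) = frechet_derivative F (at x)" if x: "x \<in> S" for x
  proof
    fix h
    interpret bounded_linear "frechet_derivative F (at x)"
      using c1_on_derivative[OF assms x] has_derivative_bounded_linear by blast
    have "frechet_derivative F (at x) h = frechet_derivative F (at x) (\<Sum>b\<in>Basis. (h \<bullet> b) *\<^sub>R b)"
      by (simp add: euclidean_representation)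
    also have "\<dots> = blinfun_apply (F' x) h"
      by (simp add: F'_def sum scaleR blinfun.sum_left inner_commute)
    finally show "blinfun_apply (F' x) h = frechet_derivative F (at x) h" ..
  qed
  have "continuous_on S F'"
    unfolding F'_def using assms by (intro continuous_intros) (auto simp: c1_on_def)
  with eq that c1_on_derivative[OF assms] show ?thesis by metis
qed

text \<open>If \<open>du = 2 Re (\<Sum> g\<^sub>k dz\<^sub>k)\<close> with holomorphic \<open>g\<^sub>k\<close>, integrate \<open>\<Sum> g\<^sub>k dz\<^sub>k\<close> along the rays from the
  centre. The integral is holomorphic because the integrand is, and the fundamental theorem of calculus
  on each ray identifies its real part.\<close>

lemma pluriharmonic_real_part:
  fixes u :: "complex^'n \<Rightarrow> real" and g :: "'n \<Rightarrow> complex^'n \<Rightarrow> complex"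
  assumes du: "\<And>y. y \<in> ball x0 r \<Longrightarrow> (u has_derivative (\<lambda>w. 2 * Re (\<Sum>k\<in>UNIV. g k y * w $ k))) (at y)"
    and c1: "\<And>k. c1_on (ball x0 r) (g k)"
    and hol: "\<And>k y. y \<in> ball x0 r \<Longrightarrow> hol_at (g k) y"
  shows "\<exists>F. (\<forall>y\<in>ball x0 r. hol_at F y) \<and> (\<forall>y\<in>ball x0 r. 2 * Re (F y) = u y)"
proof (cases "r > 0")
  case False
  then have "ball x0 r = {}" by (simp add: not_less)
  then show ?thesis by blast
next
  case True
  let ?B = "ball x0 r"
  have "\<exists>G. (\<forall>x\<in>?B. (g k has_derivative blinfun_apply (G x)) (at x)) \<and> continuous_on ?B G" for k
    using c1_on_blinfun[OF c1] by metis
  then obtain G where G: "\<And>k x. x \<in> ?B \<Longrightarrow> (g k has_derivative blinfun_apply (G k x)) (at x)" "\<And>k. continuous_on ?B (G k)"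
    by metis
  have Glin: "blinfun_apply (G k x) (c *s v) = c * blinfun_apply (G k x) v" if "x \<in> ?B" for k x c v
    using hol[OF that, of k] G(1)[OF that, of k] has_derivative_unique unfolding hol_at_def by metis
  have gc: "continuous_on ?B (g k)" for k using c1 by (rule c1_on_continuous)
  have seg: "x0 + s *\<^sub>R (y - x0) \<in> ?B" if "y \<in> ?B" "s \<in> {0..1}" for y s
  proof -
    have "norm (s *\<^sub>R (y - x0)) \<le> norm (y - x0)" using that(2) mult_left_le_one_le[of "norm (y - x0)" "\<bar>s\<bar>"] by auto
    then show ?thesis using that(1) by (simp add: dist_norm norm_minus_commute)
  qed
  define f where "f y s = (\<Sum>k\<in>UNIV. g k (x0 + s *\<^sub>R (y - x0)) * (y - x0) $ k)" for y s
  define co :: "'n \<Rightarrow> ((complex^'n) \<Rightarrow>\<^sub>L complex)" where "co k = Blinfun (\<lambda>w. w $ k)" for k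
  have co: "blinfun_apply (co k) w = w $ k" for k w
    unfolding co_def by (subst bounded_linear_Blinfun_apply) (auto intro: bounded_linear_vec_nth)
  define f' where "f' y s = (\<Sum>k\<in>UNIV. (blinfun_mult_right ((y - x0) $ k) o\<^sub>L (s *\<^sub>R G k (x0 + s *\<^sub>R (y - x0))))
        + (blinfun_mult_right (g k (x0 + s *\<^sub>R (y - x0))) o\<^sub>L co k))" for y s
  have f'_apply: "blinfun_apply (f' y s) w = (\<Sum>k\<in>UNIV. (y - x0) $ k * (s *\<^sub>R blinfun_apply (G k (x0 + s *\<^sub>R (y - x0))) w)
        + g k (x0 + s *\<^sub>R (y - x0)) * w $ k)" for y s w
    by (simp add: f'_def blinfun.sum_left blinfun.add_left blinfun.scaleR_left co)
  have f_der: "((\<lambda>y. f y s) has_derivative blinfun_apply (f' y s)) (at y within ?B)" if y: "y \<in> ?B" and s: "s \<in> cbox 0 1" for y s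
  proof -
    have "((\<lambda>y. g k (x0 + s *\<^sub>R (y - x0)) * (y - x0) $ k) has_derivative
        (\<lambda>h. g k (x0 + s *\<^sub>R (y - x0)) * (h $ k) + blinfun_apply (G k (x0 + s *\<^sub>R (y - x0))) (s *\<^sub>R h) * (y - x0) $ k)) (at y within ?B)" for k
    proof (rule has_derivative_mult)
      have "((\<lambda>y. x0 + s *\<^sub>R (y - x0)) has_derivative (\<lambda>h. s *\<^sub>R h)) (at y within ?B)"
        by (auto intro!: derivative_eq_intros)
      from has_derivative_compose[OF this G(1)[OF seg]] y s
      show "((\<lambda>y. g k (x0 + s *\<^sub>R (y - x0))) has_derivative (\<lambda>h. blinfun_apply (G k (x0 + s *\<^sub>R (y - x0))) (s *\<^sub>R h))) (at y within ?B)"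
        by auto
      have "((\<lambda>y. y - x0) has_derivative (\<lambda>h. h)) (at y within ?B)" by (auto intro!: derivative_eq_intros)
      from bounded_linear.has_derivative[OF bounded_linear_vec_nth this]
      show "((\<lambda>y. (y - x0) $ k) has_derivative (\<lambda>h. h $ k)) (at y within ?B)" .
    qed
    then have "((\<lambda>y. f y s) has_derivative (\<lambda>h. \<Sum>k\<in>UNIV. g k (x0 + s *\<^sub>R (y - x0)) * (h $ k)
        + blinfun_apply (G k (x0 + s *\<^sub>R (y - x0))) (s *\<^sub>R h) * (y - x0) $ k)) (at y within ?B)"
      unfolding f_def by (intro has_derivative_sum)
    moreover have "(\<lambda>h. \<Sum>k\<in>UNIV. g k (x0 + s *\<^sub>R (y - x0)) * (h $ k)
        + blinfun_apply (G k (x0 + s *\<^sub>R (y - x0))) (s *\<^sub>R h) * (y - x0) $ k) = blinfun_apply (f' y s)"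
      by (auto simp: fun_eq_iff f'_apply blinfun.scaleR_right mult.commute add.commute intro!: sum.cong)
    ultimately show ?thesis by simp
  qed
  have segc: "continuous_on (?B \<times> {0..1}) (\<lambda>p. x0 + snd p *\<^sub>R (fst p - x0))" by (intro continuous_intros)
  have f'_cont: "continuous_on (?B \<times> cbox 0 1) (\<lambda>(y, s). f' y s)"
    unfolding f'_def case_prod_beta
    using seg by (intro continuous_intros continuous_on_compose2[OF G(2)] continuous_on_compose2[OF gc]
       bounded_linear.continuous_on[OF bounded_linear_blinfun_mult_right]) auto
  have f_int: "f y integrable_on cbox 0 1" if "y \<in> ?B" for y
    unfolding f_def using seg that by (intro integrable_continuous continuous_intros continuous_on_compose2[OF gc]) auto
  define F where "F y = of_real (u x0 / 2) + integral (cbox 0 1) (f y)" for y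
  have F_hol: "hol_at F y" if y: "y \<in> ?B" for y
  proof -
    have f'_int: "f' y integrable_on cbox 0 1"
    proof (intro integrable_continuous)
      have c: "continuous_on (cbox 0 1) (\<lambda>s. (y, s))" by (intro continuous_intros)
      have "Pair y ` cbox 0 1 \<subseteq> ?B \<times> cbox (0::real) 1" using y by (auto simp del: mem_ball)
      from continuous_on_compose2[OF f'_cont c this] show "continuous_on (cbox 0 1) (f' y)" by (simp only: prod.case)
    qed
    have "((\<lambda>y. integral (cbox 0 1) (f y)) has_derivative blinfun_apply (integral (cbox 0 1) (f' y))) (at y within ?B)"
      by (rule leibniz_rule[OF f_der f_int f'_cont y convex_ball])
    then have "(F has_derivative blinfun_apply (integral (cbox 0 1) (f' y))) (at y)"
      unfolding F_def at_within_open[OF y open_ball] by (auto intro!: derivative_eq_intros)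
    moreover have "blinfun_apply (integral (cbox 0 1) (f' y)) (c *s v) = c * blinfun_apply (integral (cbox 0 1) (f' y)) v" for c v
    proof -
      have "blinfun_apply (integral (cbox 0 1) (f' y)) (c *s v) = integral (cbox 0 1) (\<lambda>s. blinfun_apply (f' y s) (c *s v))"
        by (rule blinfun_apply_integral[OF f'_int])
      also have "\<dots> = integral (cbox 0 1) (\<lambda>s. c * blinfun_apply (f' y s) v)"
        using seg[OF y] by (intro integral_cong) (auto simp: f'_apply Glin sum_distrib_left distrib_left mult.left_commute intro!: sum.cong)
      also have "\<dots> = c * blinfun_apply (integral (cbox 0 1) (f' y)) v"
        unfolding blinfun_apply_integral[OF f'_int] by (rule integral_mult_right)
      finally show ?thesis .
    qed
    ultimately show ?thesis unfolding hol_at_def by blast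
  qed
  have F_re: "2 * Re (F y) = u y" if y: "y \<in> ?B" for y
  proof -
    have "((\<lambda>s. 2 * Re (f y s)) has_integral (u (x0 + 1 *\<^sub>R (y - x0)) - u (x0 + 0 *\<^sub>R (y - x0)))) {0..1}"
    proof (rule fundamental_theorem_of_calculus)
      fix s :: real assume s: "s \<in> {0..1}"
      have "((\<lambda>s. x0 + s *\<^sub>R (y - x0)) has_derivative (\<lambda>h. h *\<^sub>R (y - x0))) (at s within {0..1})"
        by (auto intro!: derivative_eq_intros)
      from has_derivative_compose[OF this du[OF seg[OF y s]]]
      have "((\<lambda>s. u (x0 + s *\<^sub>R (y - x0))) has_derivative (\<lambda>h. 2 * Re (\<Sum>k\<in>UNIV. g k (x0 + s *\<^sub>R (y - x0)) * (h *\<^sub>R (y - x0)) $ k))) (at s within {0..1})" .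
      also have "(\<lambda>h. 2 * Re (\<Sum>k\<in>UNIV. g k (x0 + s *\<^sub>R (y - x0)) * (h *\<^sub>R (y - x0)) $ k)) = (\<lambda>h. h *\<^sub>R (2 * Re (f y s)))"
        by (simp add: fun_eq_iff f_def sum_distrib_left mult_ac)
      finally show "((\<lambda>s. u (x0 + s *\<^sub>R (y - x0))) has_vector_derivative 2 * Re (f y s)) (at s within {0..1})"
        unfolding has_vector_derivative_def .
    qed simp
    then have "integral {0..1} (\<lambda>s. 2 * Re (f y s)) = u y - u x0" by (auto dest: integral_unique)
    moreover have "integral {0..1} (\<lambda>s. 2 * Re (f y s)) = 2 * Re (integral (cbox 0 1) (f y))"
      using integral_linear[OF f_int[OF y] bounded_linear_Re] by (simp add: o_def)
    ultimately show ?thesis by (simp add: F_def)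
  qed
  from F_hol F_re show ?thesis by blast
qed

section \<open>Wirtinger derivatives\<close>

lemma pderiv_at_eq: "(F has_derivative D) (at x) \<Longrightarrow> pderiv_at v F x = D v"
  unfolding pderiv_at_def by (metis frechet_derivative_at)

lemma dz_eq: "(F has_derivative D) (at x) \<Longrightarrow> dz j F x = (D (axis j 1) - \<i> * D (axis j \<i>)) / 2"
  by (simp add: dz_def pderiv_at_eq)

lemma dzbar_eq: "(F has_derivative D) (at x) \<Longrightarrow> dzbar j F x = (D (axis j 1) + \<i> * D (axis j \<i>)) / 2"
  by (simp add: dzbar_def pderiv_at_eq)

lemma axis_nth2: "axis (1::2) a $ 1 = a" "axis (1::2) a $ 2 = 0" "axis (2::2) a $ 1 = 0" "axis (2::2) a $ 2 = a"
  by (simp_all add: axis_def)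

text \<open>In two variables the Wirtinger derivatives are read off from the derivative once it is written as a
  combination of the coordinates and their conjugates.\<close>

lemma wirtinger_read_off:
  fixes F :: "complex^2 \<Rightarrow> complex"
  assumes "(F has_derivative (\<lambda>h. a1 * h $ 1 + a2 * h $ 2 + b1 * cnj (h $ 1) + b2 * cnj (h $ 2))) (at x)"
  shows "dz 1 F x = a1" "dz 2 F x = a2" "dzbar 1 F x = b1" "dzbar 2 F x = b2"
  by (simp_all add: dz_eq[OF assms] dzbar_eq[OF assms] axis_nth2 algebra_simps)

lemma dz_cong_open:
  assumes "open N" "x \<in> N" "\<And>y. y \<in> N \<Longrightarrow> F y = G y" "F differentiable (at x)"
  shows "dz j G x = dz j F x" "dzbar j G x = dzbar j F x"
proof -
  obtain D where D: "(F has_derivative D) (at x)" using assms(4) by (auto simp: differentiable_def)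
  have "(G has_derivative D) (at x)"
    by (rule has_derivative_transform_within_open[OF D assms(1-3)])
  then show "dz j G x = dz j F x" "dzbar j G x = dzbar j F x"
    by (simp_all only: dz_eq[OF D] dzbar_eq[OF D] dz_eq[of G D] dzbar_eq[of G D])
qed

lemma axis_expand: "(h :: complex^'n) = (\<Sum>j\<in>UNIV. Re (h $ j) *\<^sub>R axis j 1 + Im (h $ j) *\<^sub>R axis j \<i>)"
proof (rule vec_eq_iff[THEN iffD2], rule allI)
  fix i
  have "(\<Sum>j\<in>UNIV. Re (h $ j) *\<^sub>R axis j 1 + Im (h $ j) *\<^sub>R axis j \<i>) $ i = (\<Sum>j\<in>UNIV. if j = i then h $ i else 0)"
    unfolding sum_component by (intro sum.cong) (auto simp: axis_def complex_eq_iff)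
  then show "h $ i = (\<Sum>j\<in>UNIV. Re (h $ j) *\<^sub>R axis j 1 + Im (h $ j) *\<^sub>R axis j \<i>) $ i" by simp
qed

lemma complex_split_mult: "of_real (Re a) * w + of_real (Im a) * (\<i> * w) = a * w"
  by (simp add: complex_eq_iff algebra_simps)

text \<open>The Cauchy-Riemann equations say that the derivative commutes with multiplication by \<open>\<i>\<close> on the
  coordinate axes, and these span.\<close>

lemma hol_at_of_dzbar:
  fixes F :: "complex^'n \<Rightarrow> complex"
  assumes "F differentiable (at x)" "\<And>j. dzbar j F x = 0"
  shows "hol_at F x"
proof -
  obtain D where D: "(F has_derivative D) (at x)" using assms(1) by (auto simp: differentiable_def)
  interpret bounded_linear D using D by (rule has_derivative_bounded_linear)
  have ai: "D (axis j \<i>) = \<i> * D (axis j 1)" for j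
  proof -
    have "\<i> * (D (axis j 1) + \<i> * D (axis j \<i>)) = 0" using assms(2)[of j] by (simp add: dzbar_eq[OF D])
    then show ?thesis by (simp add: algebra_simps)
  qed
  have "D h = (\<Sum>j\<in>UNIV. h $ j * D (axis j 1))" for h
  proof -
    have "D h = (\<Sum>j\<in>UNIV. D (Re (h $ j) *\<^sub>R axis j 1 + Im (h $ j) *\<^sub>R axis j \<i>))"
      using arg_cong[OF axis_expand, of D h] by (simp only: sum)
    also have "\<dots> = (\<Sum>j\<in>UNIV. h $ j * D (axis j 1))"
    proof (intro sum.cong refl)
      fix j
      have "D (Re (h $ j) *\<^sub>R axis j 1 + Im (h $ j) *\<^sub>R axis j \<i>) = of_real (Re (h $ j)) * D (axis j 1) + of_real (Im (h $ j)) * (\<i> * D (axis j 1))"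
        unfolding add scaleR ai unfolding scaleR_conv_of_real[where ?'a=complex] ..
      then show "D (Re (h $ j) *\<^sub>R axis j 1 + Im (h $ j) *\<^sub>R axis j \<i>) = h $ j * D (axis j 1)"
        unfolding complex_split_mult .
    qed
    finally show ?thesis .
  qed
  note lin = this
  have "D (c *s v) = c * D v" for c v
    unfolding lin[of "c *s v"] lin[of v] by (simp add: sum_distrib_left mult.assoc)
  with D show ?thesis unfolding hol_at_def by blast
qed


section \<open>The Simanca form in the standard charts\<close>

definition V2 :: "complex \<Rightarrow> complex \<Rightarrow> complex^2" where "V2 a b = vector [a, b]"

lemma V2_nth[simp]: "V2 a b $ 1 = a" "V2 a b $ 2 = b"
  by (simp_all add: V2_def)

lemma V2_eta: "V2 (v $ 1) (v $ 2) = v"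
  by (simp add: vec_eq_iff forall_2)

lemma V2_eq_iff: "v = V2 a b \<longleftrightarrow> v $ 1 = a \<and> v $ 2 = b"
  by (auto simp: vec_eq_iff forall_2)

text \<open>The inverses of the two charts, defined on all of \<open>\<complex>\<^sup>2\<close>: in terms of the homogeneous coordinate the point lies
  over \<open>(z, z t)\<close>, respectively over \<open>(w u, w)\<close>.\<close>

definition blow1 :: "complex^2 \<Rightarrow> blowup_point" where
  "blow1 v = (V2 (v $ 1) (v $ 1 * v $ 2), proj_point (V2 1 (v $ 2)))"

definition blow2 :: "complex^2 \<Rightarrow> blowup_point" where
  "blow2 v = (V2 (v $ 1 * v $ 2) (v $ 1), proj_point (V2 (v $ 2) 1))"

lemma proj_point_scale: "c \<noteq> 0 \<Longrightarrow> proj_point (c *s t) = proj_point t"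
  unfolding proj_point_def
proof (intro equalityI subsetI; clarify)
  fix d assume "c \<noteq> 0" "d \<noteq> (0::complex)"
  then show "\<exists>d'. d *s (c *s t) = d' *s t \<and> d' \<noteq> 0" by (intro exI[of _ "d * c"]) (auto simp: vec_eq_iff)
  show "\<exists>d'. d *s t = d' *s (c *s t) \<and> d' \<noteq> 0" using \<open>c \<noteq> 0\<close> \<open>d \<noteq> 0\<close>
    by (intro exI[of _ "d / c"]) (auto simp: vec_eq_iff)
qed

lemma self_in_proj_point: "t \<in> proj_point t"
  unfolding proj_point_def by (auto intro!: exI[of _ 1] simp: vec_eq_iff)

lemma proj_point_nth:
  assumes "s \<in> proj_point t"
  shows "s $ 1 = 0 \<longleftrightarrow> t $ 1 = 0" "s $ 2 = 0 \<longleftrightarrow> t $ 2 = 0" "s $ 2 / s $ 1 = t $ 2 / t $ 1" "s $ 1 / s $ 2 = t $ 1 / t $ 2"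
  using assms by (auto simp: proj_point_def)

lemma blow1_in_dom1: "blow1 v \<in> dom blowup_chart1"
proof -
  have "blow1 v \<in> blowup" unfolding blow1_def blowup_def
    by (intro CollectI exI[of _ "V2 (v $ 1) (v $ 1 * v $ 2)"] exI[of _ "V2 1 (v $ 2)"]) (simp add: vec_eq_iff forall_2)
  then show ?thesis by (auto simp: blowup_chart1_def blow1_def proj_point_nth(1))
qed

lemma blow2_in_dom2: "blow2 v \<in> dom blowup_chart2"
proof -
  have "blow2 v \<in> blowup" unfolding blow2_def blowup_def
    by (intro CollectI exI[of _ "V2 (v $ 1 * v $ 2) (v $ 1)"] exI[of _ "V2 (v $ 2) 1"]) (simp add: vec_eq_iff forall_2)
  then show ?thesis by (auto simp: blowup_chart2_def blow2_def proj_point_nth(2))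
qed

lemma coord1_blow1: "coord blowup_chart1 (blow1 v) = v"
proof -
  define t where "t = (SOME t. t \<in> snd (blow1 v))"
  have "t \<in> proj_point (V2 1 (v $ 2))"
    unfolding t_def by (rule someI2[of "\<lambda>t. t \<in> snd (blow1 v)"]) (auto simp: blow1_def intro: self_in_proj_point)
  then have t: "t $ 2 / t $ 1 = v $ 2" using proj_point_nth(3)[of t "V2 1 (v $ 2)"] by simp
  have "coord blowup_chart1 (blow1 v) = V2 (fst (blow1 v) $ 1) (t $ 2 / t $ 1)"
    by (simp add: blowup_chart1_def V2_def t_def Let_def)
  then show ?thesis unfolding t by (simp add: blow1_def V2_eta)
qed

lemma coord2_blow2: "coord blowup_chart2 (blow2 v) = v"
proof -
  define t where "t = (SOME t. t \<in> snd (blow2 v))"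
  have "t \<in> proj_point (V2 (v $ 2) 1)"
    unfolding t_def by (rule someI2[of "\<lambda>t. t \<in> snd (blow2 v)"]) (auto simp: blow2_def intro: self_in_proj_point)
  then have t: "t $ 1 / t $ 2 = v $ 2" using proj_point_nth(4)[of t "V2 (v $ 2) 1"] by simp
  have "coord blowup_chart2 (blow2 v) = V2 (fst (blow2 v) $ 2) (t $ 1 / t $ 2)"
    by (simp add: blowup_chart2_def V2_def t_def Let_def)
  then show ?thesis unfolding t by (simp add: blow2_def V2_eta)
qed

lemma dom1_eq: "dom blowup_chart1 = range blow1"
proof (intro equalityI subsetI)
  fix q assume "q \<in> dom blowup_chart1"
  then obtain z t where q: "q = (z, proj_point t)" "t $ 1 * z $ 2 = t $ 2 * z $ 1" "t $ 1 \<noteq> 0"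
    using self_in_proj_point by (auto simp: blowup_chart1_def blowup_def)
  have "t = t $ 1 *s V2 1 (t $ 2 / t $ 1)" using q(3) by (auto simp: vec_eq_iff forall_2)
  with proj_point_scale[OF q(3), of "V2 1 (t $ 2 / t $ 1)"] have "proj_point t = proj_point (V2 1 (t $ 2 / t $ 1))" by simp
  moreover have "z = V2 (z $ 1) (z $ 1 * (t $ 2 / t $ 1))" using q(2,3) by (auto simp: V2_eq_iff field_simps)
  ultimately have "q = blow1 (V2 (z $ 1) (t $ 2 / t $ 1))" by (simp add: blow1_def q(1))
  then show "q \<in> range blow1" by blast
qed (auto intro: blow1_in_dom1)

lemma dom2_eq: "dom blowup_chart2 = range blow2"
proof (intro equalityI subsetI)
  fix q assume "q \<in> dom blowup_chart2"
  then obtain z t where q: "q = (z, proj_point t)" "t $ 1 * z $ 2 = t $ 2 * z $ 1" "t $ 2 \<noteq> 0"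
    using self_in_proj_point by (auto simp: blowup_chart2_def blowup_def)
  have "t = t $ 2 *s V2 (t $ 1 / t $ 2) 1" using q(3) by (auto simp: vec_eq_iff forall_2)
  with proj_point_scale[OF q(3), of "V2 (t $ 1 / t $ 2) 1"] have "proj_point t = proj_point (V2 (t $ 1 / t $ 2) 1)" by simp
  moreover have "z = V2 (z $ 2 * (t $ 1 / t $ 2)) (z $ 2)" using q(2,3) by (auto simp: V2_eq_iff field_simps)
  ultimately have "q = blow2 (V2 (z $ 2) (t $ 1 / t $ 2))" by (simp add: blow2_def q(1))
  then show "q \<in> range blow2" by blast
qed (auto intro: blow2_in_dom2)

lemma param1: "param blowup_chart1 = blow1"
  unfolding param_def
  by (rule ext, rule inv_into_f_eq) (auto simp: dom1_eq inj_on_def coord1_blow1)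

lemma param2: "param blowup_chart2 = blow2"
  unfolding param_def
  by (rule ext, rule inv_into_f_eq) (auto simp: dom2_eq inj_on_def coord2_blow2)

lemma blow1_eq_blow2: "v $ 2 \<noteq> 0 \<Longrightarrow> blow1 v = blow2 (V2 (v $ 1 * v $ 2) (1 / v $ 2))"
proof -
  assume v: "v $ 2 \<noteq> 0"
  have "V2 1 (v $ 2) = v $ 2 *s V2 (1 / v $ 2) 1" using v by (auto simp: vec_eq_iff forall_2)
  with v show ?thesis by (simp add: blow1_def blow2_def proj_point_scale)
qed

lemma blow2_eq_blow1: "v $ 2 \<noteq> 0 \<Longrightarrow> blow2 v = blow1 (V2 (v $ 1 * v $ 2) (1 / v $ 2))"
  using blow1_eq_blow2[of "V2 (v $ 1 * v $ 2) (1 / v $ 2)"] by (simp add: V2_eta)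

lemma blow2_in_dom1: "blow2 v \<in> dom blowup_chart1 \<longleftrightarrow> v $ 2 \<noteq> 0"
proof
  show "blow2 v \<in> dom blowup_chart1 \<Longrightarrow> v $ 2 \<noteq> 0"
    using self_in_proj_point[of "V2 (v $ 2) 1"] by (auto simp: blowup_chart1_def blow2_def)
  show "v $ 2 \<noteq> 0 \<Longrightarrow> blow2 v \<in> dom blowup_chart1"
    by (simp add: blow2_eq_blow1 blow1_in_dom1)
qed

lemma set_blowup_atlas: "set blowup_atlas = {blowup_chart1, blowup_chart2}"
  by (simp add: blowup_atlas_def)

lemma param_blow:
  assumes "c \<in> set blowup_atlas"
  shows "param c v \<in> dom c" "coord c (param c v) = v" "dom c = range (param c)" "q \<in> dom c \<Longrightarrow> param c (coord c q) = q"
  using assms by (auto simp: set_blowup_atlas param1 param2 blow1_in_dom1 blow2_in_dom2 coord1_blow1 coord2_blow2 dom1_eq dom2_eq)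

lemma simanca_ddbar:
  assumes Z: "Z \<noteq> (0 :: complex^2)"
  shows "ddbar simanca_potential Z $ j $ k = (if j = k then 1 + 1 / of_real ((norm Z)\<^sup>2) else 0)
     - cnj (Z $ j) * Z $ k / (of_real ((norm Z)\<^sup>2))\<^sup>2"
proof -
  have inner: "Z \<bullet> axis k 1 = Re (Z $ k)" "Z \<bullet> axis k \<i> = Im (Z $ k)" for Z :: "complex^2" and k
    by (simp_all add: inner_axis inner_complex_def)
  have nd: "((\<lambda>y. (norm y)\<^sup>2) has_derivative (\<lambda>h. 2 * (y \<bullet> h))) (at y)" for y :: "complex^2"
    unfolding power2_norm_eq_inner by (auto intro!: derivative_eq_intros simp: inner_commute)
  have 1: "dzbar k (\<lambda>y. complex_of_real (simanca_potential y)) y = y $ k * (1 + 1 / of_real ((norm y)\<^sup>2))" if y: "y \<noteq> 0" for y and k :: 2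
  proof -
    have "(norm y)\<^sup>2 > 0" using y by simp
    then have "((\<lambda>y. ln ((norm y)\<^sup>2)) has_derivative (\<lambda>h. 2 * (y \<bullet> h) * inverse ((norm y)\<^sup>2))) (at y)"
      by (intro DERIV_compose_FDERIV[OF DERIV_ln nd])
    then have "(simanca_potential has_derivative (\<lambda>h. 2 * (y \<bullet> h) + 2 * (y \<bullet> h) * inverse ((norm y)\<^sup>2))) (at y)"
      unfolding simanca_potential_def[abs_def] by (intro has_derivative_add nd)
    then have "((\<lambda>y. complex_of_real (simanca_potential y)) has_derivative (\<lambda>h. of_real (2 * (y \<bullet> h) + 2 * (y \<bullet> h) * inverse ((norm y)\<^sup>2)))) (at y)"
      by (rule has_derivative_of_real)
    note d = this
    have e: "y $ k = of_real (Re (y $ k)) + \<i> * of_real (Im (y $ k))" by (rule complex_eq)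
    have ring: "(of_real (2 * a + 2 * a * n) + \<i> * of_real (2 * b + 2 * b * n)) / 2 = (of_real a + \<i> * of_real b) * (1 + of_real n)" for a b n :: real
      by (simp add: complex_eq_iff algebra_simps)
    show ?thesis
      unfolding dzbar_eq[OF d] inner ring e[symmetric] by (simp add: divide_inverse)
  qed
  have "((\<lambda>y. y $ k * (1 + 1 / of_real ((norm y)\<^sup>2))) has_derivative
      (\<lambda>h. Z $ k * of_real (- (inverse ((norm Z)\<^sup>2) * (2 * (Z \<bullet> h)) * inverse ((norm Z)\<^sup>2))) + h $ k * (1 + 1 / of_real ((norm Z)\<^sup>2)))) (at Z)"
  proof (rule has_derivative_mult)
    show "((\<lambda>y. y $ k) has_derivative (\<lambda>h. h $ k)) (at Z)"
      by (intro bounded_linear_imp_has_derivative bounded_linear_vec_nth)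
    have "((\<lambda>y. inverse ((norm y)\<^sup>2)) has_derivative (\<lambda>h. - (inverse ((norm Z)\<^sup>2) * (2 * (Z \<bullet> h)) * inverse ((norm Z)\<^sup>2)))) (at Z)"
      using Z by (intro Deriv.has_derivative_inverse nd) auto
    then have "((\<lambda>y. complex_of_real (1 + inverse ((norm y)\<^sup>2))) has_derivative (\<lambda>h. of_real (0 + - (inverse ((norm Z)\<^sup>2) * (2 * (Z \<bullet> h)) * inverse ((norm Z)\<^sup>2))))) (at Z)"
      by (intro has_derivative_of_real has_derivative_add has_derivative_const)
    then show "((\<lambda>y. 1 + 1 / complex_of_real ((norm y)\<^sup>2)) has_derivative (\<lambda>h. of_real (- (inverse ((norm Z)\<^sup>2) * (2 * (Z \<bullet> h)) * inverse ((norm Z)\<^sup>2))))) (at Z)"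
      by (simp add: divide_inverse)
  qed
  then have d: "((\<lambda>y. dzbar k (\<lambda>y. complex_of_real (simanca_potential y)) y) has_derivative
      (\<lambda>h. Z $ k * of_real (- (inverse ((norm Z)\<^sup>2) * (2 * (Z \<bullet> h)) * inverse ((norm Z)\<^sup>2))) + h $ k * (1 + 1 / of_real ((norm Z)\<^sup>2)))) (at Z)"
    by (rule has_derivative_transform_within_open[of _ _ _ _ "- {0}"]) (use Z 1 in auto)
  define \<delta> :: complex where "\<delta> = (if j = k then 1 else 0)"
  have ax: "axis j 1 $ k = \<delta>" "axis j \<i> $ k = \<i> * \<delta>" by (auto simp: axis_def \<delta>_def)
  have cnj: "of_real (Re (Z $ j)) - \<i> * of_real (Im (Z $ j)) = cnj (Z $ j)" by (simp add: complex_eq_iff)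
  have ring: "(z * of_real (- (n * (2 * a) * n)) + \<delta> * d1 - \<i> * (z * of_real (- (n * (2 * b) * n)) + \<i> * \<delta> * d1)) / 2
      = \<delta> * d1 - (of_real a - \<i> * of_real b) * z * (of_real n)\<^sup>2" for z d1 and a b n :: real
    by (simp add: complex_eq_iff power2_eq_square field_simps)
  have "ddbar simanca_potential Z $ j $ k = dz j (\<lambda>y. dzbar k (\<lambda>y. complex_of_real (simanca_potential y)) y) Z"
    by (simp add: ddbar_def)
  also have "\<dots> = \<delta> * (1 + 1 / of_real ((norm Z)\<^sup>2)) - cnj (Z $ j) * Z $ k * (of_real (inverse ((norm Z)\<^sup>2)))\<^sup>2"
    unfolding dz_eq[OF d] inner ax ring cnj ..
  finally show ?thesis
    by (cases "j = k") (simp_all add: \<delta>_def divide_inverse power_inverse)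
qed

text \<open>Off the exceptional divisor this is the pullback of \<open>|Z|\<^sup>2 + log |Z|\<^sup>2\<close> minus the pluriharmonic function
  \<open>log |z|\<^sup>2\<close>, which removes the singularity along the divisor. By the symmetry between the coordinates
  of the plane the same formula serves both charts.\<close>

definition chart_potential :: "complex^2 \<Rightarrow> real" where
  "chart_potential v = (cmod (v $ 1))\<^sup>2 * (1 + (cmod (v $ 2))\<^sup>2) + ln (1 + (cmod (v $ 2))\<^sup>2)"

text \<open>The coefficient matrix of the Simanca form in either chart, that is, of \<open>\<partial>\<partial>\<^sup>-\<close> of the potential above.\<close>

definition chart_matrix :: "complex \<Rightarrow> complex \<Rightarrow> complex^2^2" where
  "chart_matrix z t = vector [vector [1 + t * cnj t, cnj z * t],
      vector [z * cnj t, z * cnj z + 1 / (1 + t * cnj t)\<^sup>2]]"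

lemma one_plus_cnj_nonzero: "1 + t * cnj t \<noteq> 0"
proof -
  have "Re (1 + t * cnj t) > 0" by (simp add: add_pos_nonneg)
  then show ?thesis by force
qed

lemma one_plus_square_pos: "0 < 1 + x\<^sup>2" "1 + x\<^sup>2 \<noteq> 0" for x :: real
  by (simp_all add: add_pos_nonneg add_nonneg_eq_0_iff)

lemma dz_coord:
  "dz 1 (\<lambda>v::complex^2. v $ 1) x = 1" "dz 2 (\<lambda>v::complex^2. v $ 1) x = 0"
  "dz 1 (\<lambda>v::complex^2. v $ 1 * v $ 2) x = x $ 2" "dz 2 (\<lambda>v::complex^2. v $ 1 * v $ 2) x = x $ 1"
proof -
  have d: "((\<lambda>v::complex^2. v $ k) has_derivative (\<lambda>h. h $ k)) (at x)" for k
    by (intro bounded_linear_imp_has_derivative bounded_linear_vec_nth)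
  have "((\<lambda>v::complex^2. v $ 1) has_derivative (\<lambda>h. 1 * h $ 1 + 0 * h $ 2 + 0 * cnj (h $ 1) + 0 * cnj (h $ 2))) (at x)"
    using d[of 1] by simp
  from wirtinger_read_off(1,2)[OF this]
  show "dz 1 (\<lambda>v::complex^2. v $ 1) x = 1" "dz 2 (\<lambda>v::complex^2. v $ 1) x = 0" .
  have "((\<lambda>v::complex^2. v $ 1 * v $ 2) has_derivative (\<lambda>h. x $ 2 * h $ 1 + x $ 1 * h $ 2 + 0 * cnj (h $ 1) + 0 * cnj (h $ 2))) (at x)"
    using has_derivative_mult[OF d[of 1] d[of 2]] by (simp add: mult.commute add.commute)
  from wirtinger_read_off(1,2)[OF this]
  show "dz 1 (\<lambda>v::complex^2. v $ 1 * v $ 2) x = x $ 2" "dz 2 (\<lambda>v::complex^2. v $ 1 * v $ 2) x = x $ 1" .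
qed

lemma V2_norm: "(norm (v :: complex^2))\<^sup>2 = (cmod (v $ 1))\<^sup>2 + (cmod (v $ 2))\<^sup>2"
  by (simp add: norm_vec_def L2_set_def sum_2 real_sqrt_pow2)

lemma matrix2_eqI:
  fixes A B :: "'a^2^2"
  assumes "A $ 1 $ 1 = B $ 1 $ 1" "A $ 1 $ 2 = B $ 1 $ 2" "A $ 2 $ 1 = B $ 2 $ 1" "A $ 2 $ 2 = B $ 2 $ 2"
  shows "A = B"
  using assms by (simp add: vec_eq_iff forall_2)

text \<open>With \<open>R = |z|\<^sup>2\<close> and \<open>T = |t|\<^sup>2\<close>, the squared norm in the plane is \<open>R (1 + T)\<close>, and the matrix of the form
  there is a multiple \<open>s\<close> of the identity minus a matrix of rank one with denominator \<open>q\<close>. Each entry of the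
  pullback is thus an expression in \<open>s\<close> and \<open>1/q\<close>, whose singular parts cancel.\<close>

lemma pullback_simanca:
  assumes c: "c \<in> set blowup_atlas" and v: "v $ 1 \<noteq> 0"
  shows "pullback11 (fst \<circ> param c) v (ddbar simanca_potential (fst (param c v))) = chart_matrix (v $ 1) (v $ 2)"
proof -
  define z t where "z = v $ 1" "t = v $ 2"
  define R T where "R = z * cnj z" "T = t * cnj t"
  have z: "z \<noteq> 0" using v by (simp add: z_t_def)
  have R: "R \<noteq> 0" using z by (simp add: R_T_def)
  have T: "1 + T \<noteq> 0" by (simp add: R_T_def one_plus_cnj_nonzero)
  have nn: "complex_of_real ((norm (V2 z (z * t)))\<^sup>2) = R * (1 + T)" "complex_of_real ((norm (V2 (z * t) z))\<^sup>2) = R * (1 + T)"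
    by (simp_all only: V2_norm V2_nth of_real_add complex_norm_square R_T_def) (simp_all add: algebra_simps)
  have nz: "V2 z (z * t) \<noteq> 0" "V2 (z * t) z \<noteq> 0" using z by (auto simp: vec_eq_iff forall_2)
  define s q where "s = 1 + 1 / (R * (1 + T))" "q = (R * (1 + T))\<^sup>2"
  have alg: "s * (1 + T) - R * (1+T)\<^sup>2 / q = 1 + T" "s * R - R\<^sup>2 * T / q = R + 1 / (1 + T)\<^sup>2"
    "s * a - R * a * (1 + T) / q = a" for a
  proof -
    have "(1 + 1 / (R * X)) * X - R * X\<^sup>2 / (R * X)\<^sup>2 = X" "(1 + 1 / (R * X)) * R - R\<^sup>2 * (X - 1) / (R * X)\<^sup>2 = R + 1 / X\<^sup>2"
      "(1 + 1 / (R * X)) * a - R * a * X / (R * X)\<^sup>2 = a" if "X \<noteq> 0" for X a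
      using R that by (simp_all add: field_simps power2_eq_square)
    from this[OF T] show "s * (1 + T) - R * (1+T)\<^sup>2 / q = 1 + T" "s * R - R\<^sup>2 * T / q = R + 1 / (1 + T)\<^sup>2"
      "s * a - R * a * (1 + T) / q = a" by (simp_all add: s_q_def)
  qed
  have cm: "chart_matrix z t $ 1 $ 1 = 1 + T" "chart_matrix z t $ 1 $ 2 = cnj z * t" "chart_matrix z t $ 2 $ 1 = z * cnj t"
     "chart_matrix z t $ 2 $ 2 = R + 1 / (1 + T)\<^sup>2"
    by (simp_all add: chart_matrix_def R_T_def)
  have W1: "ddbar simanca_potential (V2 z (z * t)) $ j $ k = (if j = k then s else 0) - cnj (V2 z (z * t) $ j) * V2 z (z * t) $ k / q" for j k
    unfolding simanca_ddbar[OF nz(1)] nn s_q_def ..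
  have W2: "ddbar simanca_potential (V2 (z * t) z) $ j $ k = (if j = k then s else 0) - cnj (V2 (z * t) z $ j) * V2 (z * t) z $ k / q" for j k
    unfolding simanca_ddbar[OF nz(2)] nn s_q_def ..
  note ring = R_T_def algebra_simps power2_eq_square add_divide_distrib diff_divide_distrib
  consider "c = blowup_chart1" | "c = blowup_chart2" using c by (auto simp: set_blowup_atlas)
  then show ?thesis
  proof cases
    case 1
    have f: "(\<lambda>y. (fst \<circ> param c) y $ 1) = (\<lambda>v. v $ 1)" "(\<lambda>y. (fst \<circ> param c) y $ 2) = (\<lambda>v. v $ 1 * v $ 2)" "fst (param c v) = V2 z (z * t)"
      by (auto simp: 1 param1 blow1_def z_t_def)
    have P: "pullback11 (fst \<circ> param c) v (ddbar simanca_potential (fst (param c v))) $ j $ k =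
        (\<Sum>a\<in>UNIV. \<Sum>b\<in>UNIV. ddbar simanca_potential (V2 z (z * t)) $ a $ b * dz j (\<lambda>y. (fst \<circ> param c) y $ a) v * cnj (dz k (\<lambda>y. (fst \<circ> param c) y $ b) v))" for j k
      unfolding pullback11_def f(3) by simp
    have "pullback11 (fst \<circ> param c) v (ddbar simanca_potential (fst (param c v))) $ 1 $ 1 = s * (1 + T) - R * (1+T)\<^sup>2 / q"
      "pullback11 (fst \<circ> param c) v (ddbar simanca_potential (fst (param c v))) $ 1 $ 2 = s * (cnj z * t) - R * (cnj z * t) * (1 + T) / q"
      "pullback11 (fst \<circ> param c) v (ddbar simanca_potential (fst (param c v))) $ 2 $ 1 = s * (z * cnj t) - R * (z * cnj t) * (1 + T) / q"
      "pullback11 (fst \<circ> param c) v (ddbar simanca_potential (fst (param c v))) $ 2 $ 2 = s * R - R\<^sup>2 * T / q"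
      unfolding P sum_2 W1 f(1,2) dz_coord z_t_def[symmetric] by (simp_all add: ring)
    then show ?thesis unfolding alg z_t_def[symmetric] by (intro matrix2_eqI) (simp_all only: cm)
  next
    case 2
    have f: "(\<lambda>y. (fst \<circ> param c) y $ 2) = (\<lambda>v. v $ 1)" "(\<lambda>y. (fst \<circ> param c) y $ 1) = (\<lambda>v. v $ 1 * v $ 2)" "fst (param c v) = V2 (z * t) z"
      by (auto simp: 2 param2 blow2_def z_t_def)
    have P: "pullback11 (fst \<circ> param c) v (ddbar simanca_potential (fst (param c v))) $ j $ k =
        (\<Sum>a\<in>UNIV. \<Sum>b\<in>UNIV. ddbar simanca_potential (V2 (z * t) z) $ a $ b * dz j (\<lambda>y. (fst \<circ> param c) y $ a) v * cnj (dz k (\<lambda>y. (fst \<circ> param c) y $ b) v))" for j k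
      unfolding pullback11_def f(3) by simp
    have "pullback11 (fst \<circ> param c) v (ddbar simanca_potential (fst (param c v))) $ 1 $ 1 = s * (1 + T) - R * (1+T)\<^sup>2 / q"
      "pullback11 (fst \<circ> param c) v (ddbar simanca_potential (fst (param c v))) $ 1 $ 2 = s * (cnj z * t) - R * (cnj z * t) * (1 + T) / q"
      "pullback11 (fst \<circ> param c) v (ddbar simanca_potential (fst (param c v))) $ 2 $ 1 = s * (z * cnj t) - R * (z * cnj t) * (1 + T) / q"
      "pullback11 (fst \<circ> param c) v (ddbar simanca_potential (fst (param c v))) $ 2 $ 2 = s * R - R\<^sup>2 * T / q"
      unfolding P sum_2 W2 f(1,2) dz_coord z_t_def[symmetric] by (simp_all add: ring)
    then show ?thesis unfolding alg z_t_def[symmetric] by (intro matrix2_eqI) (simp_all only: cm)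
  qed
qed

lemma continuous_eq_off_line:
  fixes f g :: "complex^2 \<Rightarrow> complex"
  assumes "continuous_on UNIV f" "continuous_on UNIV g" "\<And>v. v $ k \<noteq> 0 \<Longrightarrow> f v = g v"
  shows "f v = g v"
proof (cases "v $ k = 0")
  case True
  define x where "x n = v + inverse (real (Suc n)) *\<^sub>R axis k 1" for n
  have "x \<longlonglongrightarrow> v + 0 *\<^sub>R axis k 1"
    unfolding x_def by (intro tendsto_intros LIMSEQ_inverse_real_of_nat)
  then have x: "x \<longlonglongrightarrow> v" by simp
  have "x n $ k \<noteq> 0" for n using True by (simp add: x_def axis_def del: of_nat_Suc)
  then have eq: "(\<lambda>n. f (x n)) = (\<lambda>n. g (x n))" using assms(3) by auto
  have "(\<lambda>n. f (x n)) \<longlonglongrightarrow> f v" "(\<lambda>n. g (x n)) \<longlonglongrightarrow> g v"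
    using assms(1,2) x by (auto simp: continuous_on_eq_continuous_at intro: isCont_tendsto_compose)
  then show ?thesis unfolding eq by (rule LIMSEQ_unique)
qed (use assms in auto)

lemma chart_matrix_nth:
  "chart_matrix z t $ 1 $ 1 = 1 + t * cnj t" "chart_matrix z t $ 1 $ 2 = cnj z * t"
  "chart_matrix z t $ 2 $ 1 = z * cnj t" "chart_matrix z t $ 2 $ 2 = z * cnj z + 1 / (1 + t * cnj t)\<^sup>2"
  by (simp_all add: chart_matrix_def)

text \<open>The formula holds off the exceptional divisor by the computation above, and on it by continuity.\<close>

lemma simanca_form_chart:
  assumes \<omega>: "simanca_form \<omega>" and c: "c \<in> set blowup_atlas"
  shows "\<omega> c (param c v) = chart_matrix (v $ 1) (v $ 2)"
proof -
  have off: "\<omega> c (param c v) = chart_matrix (v $ 1) (v $ 2)" if v: "v $ 1 \<noteq> 0" for v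
  proof -
    have "fst (param c v) \<noteq> 0"
      using c v by (auto simp: set_blowup_atlas param1 param2 blow1_def blow2_def vec_eq_iff forall_2)
    then have "param c v \<in> dom c - exceptional_divisor"
      using param_blow(1)[OF c] by (simp add: exceptional_divisor_def)
    then show ?thesis
      using \<omega> c pullback_simanca[OF c v] param_blow(2)[OF c] unfolding simanca_form_def by metis
  qed
  have dom: "coord c ` dom c = UNIV"
    using param_blow[OF c] by (metis UNIV_eq_I image_eqI)
  have "cr_on 0 (coord c ` dom c) (\<lambda>w. \<omega> c (param c w) $ j $ k)" for j k
    using \<omega> c unfolding simanca_form_def kahler_form_def smooth_form11_def by blast
  then have c1: "continuous_on UNIV (\<lambda>w. \<omega> c (param c w) $ j $ k)" for j k
    unfolding dom cr_on_def by (auto dest: spec[of _ "[]"])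
  have nz: "(1 + w $ 2 * cnj (w $ 2))\<^sup>2 \<noteq> 0" for w :: "complex^2"
    by (simp add: one_plus_cnj_nonzero)
  have c2: "continuous_on UNIV (\<lambda>w::complex^2. chart_matrix (w $ 1) (w $ 2) $ j $ k)" for j k
  proof -
    have "continuous_on UNIV (\<lambda>w::complex^2. 1 + w $ 2 * cnj (w $ 2))"
      "continuous_on UNIV (\<lambda>w::complex^2. cnj (w $ 1) * w $ 2)" "continuous_on UNIV (\<lambda>w::complex^2. w $ 1 * cnj (w $ 2))"
      "continuous_on UNIV (\<lambda>w::complex^2. w $ 1 * cnj (w $ 1) + 1 / (1 + w $ 2 * cnj (w $ 2))\<^sup>2)"
      by (intro continuous_intros; use nz in blast)+
    then show ?thesis using exhaust_2[of j] exhaust_2[of k] by (elim disjE; simp only: chart_matrix_nth)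
  qed
  have "\<omega> c (param c v) $ j $ k = chart_matrix (v $ 1) (v $ 2) $ j $ k" for j k
    using continuous_eq_off_line[OF c1[of j k] c2[of j k], of 1 v] off by simp
  then show ?thesis by (intro matrix2_eqI)
qed

text \<open>The derivatives \<open>\<partial>\<phi>/\<partial>z\<^sub>k\<close> of the chart potential \<open>\<phi>\<close>.\<close>

definition potential_grad :: "2 \<Rightarrow> complex^2 \<Rightarrow> complex" where
  "potential_grad k v = (if k = 1 then cnj (v $ 1) * (1 + v $ 2 * cnj (v $ 2))
     else v $ 1 * cnj (v $ 1) * cnj (v $ 2) + cnj (v $ 2) * inverse (1 + v $ 2 * cnj (v $ 2)))"

lemma vec_nth_derivative: "((\<lambda>v. v $ k) has_derivative (\<lambda>h. h $ k)) F"
  by (intro bounded_linear_imp_has_derivative bounded_linear_vec_nth)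

lemma cnj_nth_derivative: "((\<lambda>v::complex^'n. cnj (v $ k)) has_derivative (\<lambda>h. cnj (h $ k))) (at x)"
  by (intro has_derivative_cnj vec_nth_derivative)

lemma chart_potential_derivative:
  "(chart_potential has_derivative (\<lambda>h. 2 * Re (\<Sum>k\<in>UNIV. potential_grad k v * h $ k))) (at v)"
proof -
  let ?T = "(cmod (v $ 2))\<^sup>2"
  have sq: "((\<lambda>v::complex^2. (cmod (v $ k))\<^sup>2) has_derivative (\<lambda>h. 2 * (v $ k \<bullet> h $ k))) (at v)" for k
    unfolding power2_norm_eq_inner
    by (auto intro!: derivative_eq_intros vec_nth_derivative simp: inner_commute)
  have one: "((\<lambda>v::complex^2. 1 + (cmod (v $ 2))\<^sup>2) has_derivative (\<lambda>h. 2 * (v $ 2 \<bullet> h $ 2))) (at v)"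
    using has_derivative_add[OF has_derivative_const[of 1] sq[of 2]] by simp
  have ln: "((\<lambda>v::complex^2. ln (1 + (cmod (v $ 2))\<^sup>2)) has_derivative (\<lambda>h. 2 * (v $ 2 \<bullet> h $ 2) * inverse (1 + ?T))) (at v)"
    by (rule DERIV_compose_FDERIV[OF DERIV_ln one]) (rule one_plus_square_pos(1))
  have "(chart_potential has_derivative (\<lambda>h. ((cmod (v $ 1))\<^sup>2 * (2 * (v $ 2 \<bullet> h $ 2)) + 2 * (v $ 1 \<bullet> h $ 1) * (1 + ?T))
      + 2 * (v $ 2 \<bullet> h $ 2) * inverse (1 + ?T))) (at v)"
    unfolding chart_potential_def[abs_def] by (intro has_derivative_add has_derivative_mult sq one ln)
  moreover have "((cmod (v $ 1))\<^sup>2 * (2 * (v $ 2 \<bullet> h $ 2)) + 2 * (v $ 1 \<bullet> h $ 1) * (1 + ?T))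
      + 2 * (v $ 2 \<bullet> h $ 2) * inverse (1 + ?T) = 2 * Re (\<Sum>k\<in>UNIV. potential_grad k v * h $ k)" for h
  proof -
    have in_re: "a \<bullet> b = Re (cnj a * b)" for a b :: complex by (simp add: inner_complex_def)
    have T: "1 + v $ 2 * cnj (v $ 2) = of_real (1 + ?T)" by (simp add: complex_norm_square del: of_real_power)
    have R: "v $ 1 * cnj (v $ 1) = of_real ((cmod (v $ 1))\<^sup>2)" by (simp add: complex_norm_square del: of_real_power)
    obtain iv where iv: "inverse (1 + ?T) = iv" by blast
    have T': "inverse (complex_of_real (1 + ?T)) = of_real iv" by (simp add: iv[symmetric])
    show ?thesis
      unfolding sum_2 potential_grad_def T T' R in_re iv by (simp add: algebra_simps)
  qed
  ultimately show ?thesis by (simp only: )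
qed

lemma potential_grad_c1: "c1_on S (potential_grad k)"
proof -
  have nth: "c1_on S (\<lambda>v::complex^2. v $ j)" for j by (rule c1_on_bounded_linear[OF bounded_linear_vec_nth])
  have cn: "c1_on S (\<lambda>v::complex^2. cnj (v $ j))" for j by (rule c1_on_linear_compose[OF bounded_linear_cnj nth])
  show ?thesis
  proof (cases "k = 1")
    case True
    have "c1_on S (\<lambda>v. cnj (v $ 1) * (1 + v $ 2 * cnj (v $ 2)))" by (intro c1_on_add c1_on_mult c1_on_const nth cn)
    then show ?thesis using True by (simp add: potential_grad_def[abs_def])
  next
    case False
    have "c1_on S (\<lambda>v. v $ 1 * cnj (v $ 1) * cnj (v $ 2) + cnj (v $ 2) * inverse (1 + v $ 2 * cnj (v $ 2)))"
      by (intro c1_on_add c1_on_mult c1_on_const nth cn c1_on_inverse one_plus_cnj_nonzero)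
    then show ?thesis using False by (simp add: potential_grad_def[abs_def])
  qed
qed

lemma potential_grad_dzbar: "dzbar j (potential_grad k) v = cnj (chart_matrix (v $ 1) (v $ 2) $ j $ k)"
proof -
  define z t where "z = v $ 1" "t = v $ 2"
  have T: "1 + t * cnj t \<noteq> 0" by (rule one_plus_cnj_nonzero)
  have one: "((\<lambda>v::complex^2. 1 + v $ 2 * cnj (v $ 2)) has_derivative (\<lambda>h. 0 + (t * cnj (h $ 2) + h $ 2 * cnj t))) (at v)"
    unfolding z_t_def by (intro has_derivative_add has_derivative_mult has_derivative_const vec_nth_derivative cnj_nth_derivative)
  have "(potential_grad 1 has_derivative (\<lambda>h. cnj z * (0 + (t * cnj (h $ 2) + h $ 2 * cnj t)) + cnj (h $ 1) * (1 + t * cnj t))) (at v)"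
    unfolding potential_grad_def[abs_def] using has_derivative_mult[OF cnj_nth_derivative[of 1] one] by (simp add: z_t_def)
  also have "(\<lambda>h. cnj z * (0 + (t * cnj (h $ 2) + h $ 2 * cnj t)) + cnj (h $ 1) * (1 + t * cnj t))
    = (\<lambda>h. 0 * h $ 1 + (cnj z * cnj t) * h $ 2 + (1 + t * cnj t) * cnj (h $ 1) + (cnj z * t) * cnj (h $ 2))"
    by (auto simp: algebra_simps)
  finally have g1: "(potential_grad 1 has_derivative \<dots>) (at v)" .
  have "((\<lambda>v. v $ 1 * cnj (v $ 1) * cnj (v $ 2) + cnj (v $ 2) * inverse (1 + v $ 2 * cnj (v $ 2))) has_derivative
     (\<lambda>h. (z * cnj z * cnj (h $ 2) + (z * cnj (h $ 1) + h $ 1 * cnj z) * cnj t)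
        + (cnj t * (- (inverse (1 + t * cnj t) * (0 + (t * cnj (h $ 2) + h $ 2 * cnj t)) * inverse (1 + t * cnj t))) + cnj (h $ 2) * inverse (1 + t * cnj t)))) (at v)"
    unfolding z_t_def
    by (intro has_derivative_add has_derivative_mult Deriv.has_derivative_inverse vec_nth_derivative cnj_nth_derivative one[unfolded z_t_def] one_plus_cnj_nonzero)
  also have "(\<lambda>h. (z * cnj z * cnj (h $ 2) + (z * cnj (h $ 1) + h $ 1 * cnj z) * cnj t)
        + (cnj t * (- (inverse (1 + t * cnj t) * (0 + (t * cnj (h $ 2) + h $ 2 * cnj t)) * inverse (1 + t * cnj t))) + cnj (h $ 2) * inverse (1 + t * cnj t)))
     = (\<lambda>h. (cnj z * cnj t) * h $ 1 + (- (cnj t * cnj t * (inverse (1 + t * cnj t))\<^sup>2)) * h $ 2 + (z * cnj t) * cnj (h $ 1)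
        + (z * cnj z + inverse (1 + t * cnj t) - t * cnj t * (inverse (1 + t * cnj t))\<^sup>2) * cnj (h $ 2))"
    by (auto simp: algebra_simps power2_eq_square)
  also have "z * cnj z + inverse (1 + t * cnj t) - t * cnj t * (inverse (1 + t * cnj t))\<^sup>2 = z * cnj z + 1 / (1 + t * cnj t)\<^sup>2"
  proof -
    have "inverse X - (X - 1) * (inverse X)\<^sup>2 = 1 / X\<^sup>2" if "X \<noteq> 0" for X :: complex
      using that by (simp add: field_simps power2_eq_square)
    from this[OF T] show ?thesis by simp
  qed
  finally have g2: "(potential_grad 2 has_derivative (\<lambda>h. (cnj z * cnj t) * h $ 1 + (- (cnj t * cnj t * (inverse (1 + t * cnj t))\<^sup>2)) * h $ 2 + (z * cnj t) * cnj (h $ 1)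
        + (z * cnj z + 1 / (1 + t * cnj t)\<^sup>2) * cnj (h $ 2))) (at v)"
    by (simp add: potential_grad_def[abs_def])
  show ?thesis
    using exhaust_2[of j] exhaust_2[of k] wirtinger_read_off(3,4)[OF g1] wirtinger_read_off(3,4)[OF g2]
    unfolding z_t_def[symmetric] by (auto simp: chart_matrix_nth mult.commute[of "cnj t" t])
qed

lemma dz_cnj: "F differentiable (at x) \<Longrightarrow> dz j (\<lambda>y. cnj (F y)) x = cnj (dzbar j F x)"
proof -
  assume "F differentiable (at x)"
  then obtain D where D: "(F has_derivative D) (at x)" by (auto simp: differentiable_def)
  show ?thesis unfolding dz_eq[OF has_derivative_cnj[OF D]] dzbar_eq[OF D] by simp
qed

lemma dzbar_add: "F differentiable (at x) \<Longrightarrow> G differentiable (at x) \<Longrightarrow> dzbar j (\<lambda>y. F y + G y) x = dzbar j F x + dzbar j G x"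
proof -
  assume "F differentiable (at x)" "G differentiable (at x)"
  then obtain D E where D: "(F has_derivative D) (at x)" and E: "(G has_derivative E) (at x)" by (auto simp: differentiable_def)
  show ?thesis unfolding dzbar_eq[OF has_derivative_add[OF D E]] dzbar_eq[OF D] dzbar_eq[OF E]
    by (simp add: algebra_simps add_divide_distrib diff_divide_distrib)
qed

lemma dzbar_cmult: "F differentiable (at x) \<Longrightarrow> dzbar j (\<lambda>y. a * F y) x = a * dzbar j F x"
proof -
  assume "F differentiable (at x)"
  then obtain D where D: "(F has_derivative D) (at x)" by (auto simp: differentiable_def)
  show ?thesis unfolding dzbar_eq[OF has_derivative_mult_right[OF D]] dzbar_eq[OF D] by (simp add: algebra_simps)
qed

lemma c1_on_differentiable: "c1_on S F \<Longrightarrow> x \<in> S \<Longrightarrow> F differentiable (at x)"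
  by (simp add: c1_on_def)

lemma c1_onI_Basis:
  fixes F :: "'a::euclidean_space \<Rightarrow> 'b::real_normed_vector"
  assumes d: "\<And>x. x \<in> S \<Longrightarrow> F differentiable (at x)" and c: "\<And>b. b \<in> Basis \<Longrightarrow> continuous_on S (pderiv_at b F)"
  shows "c1_on S F"
proof (rule c1_onI[where D="\<lambda>x. frechet_derivative F (at x)"])
  show der: "(F has_derivative frechet_derivative F (at x)) (at x)" if "x \<in> S" for x
    using d[OF that] by (simp add: frechet_derivative_works)
  show "continuous_on S (\<lambda>x. frechet_derivative F (at x) v)" for v
  proof (rule continuous_on_eq)
    show "continuous_on S (\<lambda>x. \<Sum>b\<in>Basis. (v \<bullet> b) *\<^sub>R pderiv_at b F x)"
      using c by (intro continuous_intros) auto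
    fix x assume "x \<in> S"
    from has_derivative_bounded_linear[OF der[OF this]]
    interpret bounded_linear "frechet_derivative F (at x)" .
    have "frechet_derivative F (at x) v = frechet_derivative F (at x) (\<Sum>b\<in>Basis. (v \<bullet> b) *\<^sub>R b)"
      by (simp add: euclidean_representation)
    then show "(\<Sum>b\<in>Basis. (v \<bullet> b) *\<^sub>R pderiv_at b F x) = frechet_derivative F (at x) v"
      by (simp only: sum scaleR pderiv_at_def)
  qed
qed

lemma cr_on_2_c1:
  assumes S: "open S" and cr: "cr_on 2 S F"
  shows "c1_on S F" "b \<in> Basis \<Longrightarrow> c1_on S (pderiv_at b F)"
proof -
  have *: "continuous_on S (iter_pderiv vs F)" "length vs < 2 \<Longrightarrow> x \<in> S \<Longrightarrow> iter_pderiv vs F differentiable (at x)"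
    if "set vs \<subseteq> Basis" "length vs \<le> 2" for vs x
    using cr that S unfolding cr_on_def by (auto simp: differentiable_on_eq_differentiable_at)
  show "c1_on S F"
    using *(1)[of "[_]"] *(2)[of "[]"] by (intro c1_onI_Basis) auto
  show "c1_on S (pderiv_at b F)" if "b \<in> Basis"
    using *(1)[of "[_, b]"] *(2)[of "[b]"] that by (intro c1_onI_Basis) auto
qed

text \<open>Two Hermitian metrics on a trivial bundle with the same curvature differ, locally, by the squared modulus
  of a holomorphic function: the logarithm of their quotient is pluriharmonic.\<close>

lemma local_unit_section:
  fixes H :: "complex^2 \<Rightarrow> real"
  assumes S: "open S" and cr: "cr_on 2 S H" and pos: "\<And>v. v \<in> S \<Longrightarrow> H v > 0"
    and curv: "\<And>v j k. v \<in> S \<Longrightarrow> - ddbar (\<lambda>w. ln (H w)) v $ j $ k = of_nat m * chart_matrix (v $ 1) (v $ 2) $ j $ k"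
    and x: "x \<in> S"
  shows "\<exists>r>0. \<exists>\<sigma>. ball x r \<subseteq> S \<and> (\<forall>y\<in>ball x r. hol_at \<sigma> y \<and> (cmod (\<sigma> y))\<^sup>2 * H y = exp (- real m * chart_potential y))"
proof -
  obtain r where r: "r > 0" "ball x r \<subseteq> S" using S x open_contains_ball by blast
  define a where "a k y = (of_real (pderiv_at (axis k 1) H y) + (- \<i>) * of_real (pderiv_at (axis k \<i>) H y)) * inverse (2 * of_real (H y))" for k y
  define g where "g k y = a k y + of_nat m * potential_grad k y" for k y
  have Basis: "axis k 1 \<in> (Basis :: (complex^2) set)" "axis k \<i> \<in> (Basis :: (complex^2) set)" for k
    by (auto simp: Basis_vec_def Basis_complex_def)
  have Hc1: "c1_on S H" by (rule cr_on_2_c1(1)[OF S cr])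
  have H_der: "(H has_derivative (\<lambda>w. 2 * H y * Re (\<Sum>k\<in>UNIV. a k y * w $ k))) (at y)" if y: "y \<in> S" for y
  proof -
    have D: "(H has_derivative frechet_derivative H (at y)) (at y)" by (rule c1_on_derivative[OF Hc1 y])
    from has_derivative_bounded_linear[OF D] interpret bounded_linear "frechet_derivative H (at y)" .
    have "frechet_derivative H (at y) w = 2 * H y * Re (\<Sum>k\<in>UNIV. a k y * w $ k)" for w
    proof -
      have "frechet_derivative H (at y) w = (\<Sum>k\<in>UNIV. Re (w $ k) * pderiv_at (axis k 1) H y + Im (w $ k) * pderiv_at (axis k \<i>) H y)"
        using arg_cong[OF axis_expand, of "frechet_derivative H (at y)" w] by (simp only: sum add scaleR pderiv_at_def real_scaleR_def)
      also have "\<dots> = (\<Sum>k\<in>UNIV. 2 * H y * Re (a k y * w $ k))"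
      proof (intro sum.cong refl)
        fix k
        have "inverse (2 * of_real (H y)) = complex_of_real (inverse (2 * H y))" by simp
        then show "Re (w $ k) * pderiv_at (axis k 1) H y + Im (w $ k) * pderiv_at (axis k \<i>) H y = 2 * H y * Re (a k y * w $ k)"
          unfolding a_def using pos[OF y] by (simp only: ) (simp add: field_simps)
      qed
      finally show ?thesis by (simp add: sum_distrib_left)
    qed
    then have "frechet_derivative H (at y) = (\<lambda>w. 2 * H y * Re (\<Sum>k\<in>UNIV. a k y * w $ k))" by (rule ext)
    with D show ?thesis by (simp only: )
  qed
  have ln_der: "((\<lambda>y. ln (H y)) has_derivative (\<lambda>w. 2 * Re (\<Sum>k\<in>UNIV. a k y * w $ k))) (at y)" if y: "y \<in> S" for y
  proof -
    have "((\<lambda>y. ln (H y)) has_derivative (\<lambda>w. 2 * H y * Re (\<Sum>k\<in>UNIV. a k y * w $ k) * inverse (H y))) (at y)"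
      by (rule DERIV_compose_FDERIV[OF DERIV_ln[OF pos[OF y]] H_der[OF y]])
    moreover have "2 * H y * s * inverse (H y) = 2 * s" for s using pos[OF y] by simp
    ultimately show ?thesis by (simp only: )
  qed
  have a_c1: "c1_on S (a k)" for k
    unfolding a_def[abs_def]
    by (intro c1_on_mult c1_on_add c1_on_const c1_on_inverse c1_on_linear_compose[OF bounded_linear_of_real] cr_on_2_c1[OF S cr] Basis)
       (use pos in force)
  have g_c1: "c1_on S (g k)" for k
    unfolding g_def[abs_def] by (intro c1_on_add c1_on_mult c1_on_const a_c1 potential_grad_c1)
  have a_dzbar: "dzbar j (a k) y = - of_nat m * cnj (chart_matrix (y $ 1) (y $ 2) $ j $ k)" if y: "y \<in> S" for j k y
  proof -
    have "dzbar k (\<lambda>y. complex_of_real (ln (H y))) v = cnj (a k v)" if v: "v \<in> S" for v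
    proof -
      have "(\<Sum>l\<in>UNIV. a l v * axis k e $ l) = a k v * e" for e
      proof -
        have "(\<Sum>l\<in>UNIV. a l v * axis k e $ l) = (\<Sum>l\<in>UNIV. if l = k then a k v * e else 0)"
          by (intro sum.cong) (auto simp: axis_def)
        then show ?thesis by simp
      qed
      then show ?thesis
        unfolding dzbar_eq[OF has_derivative_of_real[OF ln_der[OF v]]] by (simp add: complex_eq_iff)
    qed
    then have "dz j (dzbar k (\<lambda>y. complex_of_real (ln (H y)))) y = dz j (\<lambda>v. cnj (a k v)) y"
    proof (intro dz_cong_open(1)[OF S y])
      obtain D where "(a k has_derivative D) (at y)" using c1_on_differentiable[OF a_c1 y] by (auto simp: differentiable_def)
      from has_derivative_cnj[OF this] show "(\<lambda>v. cnj (a k v)) differentiable (at y)" by (auto simp: differentiable_def)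
    qed auto
    also have "\<dots> = cnj (dzbar j (a k) y)" by (rule dz_cnj[OF c1_on_differentiable[OF a_c1 y]])
    finally have "cnj (dzbar j (a k) y) = - (of_nat m * chart_matrix (y $ 1) (y $ 2) $ j $ k)"
      using curv[OF y, of j k] by (simp add: ddbar_def minus_equation_iff[of "cnj _"])
    then have "cnj (cnj (dzbar j (a k) y)) = cnj (- (of_nat m * chart_matrix (y $ 1) (y $ 2) $ j $ k))" by (rule arg_cong)
    then show ?thesis by simp
  qed
  have g_hol: "hol_at (g k) y" if y: "y \<in> S" for k y
  proof (rule hol_at_of_dzbar)
    have d: "a k differentiable (at y)" "potential_grad k differentiable (at y)" "(\<lambda>y. of_nat m * potential_grad k y) differentiable (at y)"
      using y by (auto intro!: c1_on_differentiable[OF a_c1] c1_on_differentiable[OF potential_grad_c1] c1_on_differentiable[OF c1_on_mult[OF c1_on_const potential_grad_c1]])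
    show "g k differentiable (at y)" by (rule c1_on_differentiable[OF g_c1 y])
    show "dzbar j (g k) y = 0" for j
      unfolding g_def[abs_def] dzbar_add[OF d(1,3)] dzbar_cmult[OF d(2)] a_dzbar[OF y] potential_grad_dzbar by simp
  qed
  define u where "u y = ln (H y) + real m * chart_potential y" for y
  have u_der: "(u has_derivative (\<lambda>w. 2 * Re (\<Sum>k\<in>UNIV. g k y * w $ k))) (at y)" if y: "y \<in> S" for y
  proof -
    have "(u has_derivative (\<lambda>w. 2 * Re (\<Sum>k\<in>UNIV. a k y * w $ k) + real m * (2 * Re (\<Sum>k\<in>UNIV. potential_grad k y * w $ k)))) (at y)"
      unfolding u_def[abs_def] by (intro has_derivative_add ln_der y has_derivative_mult_right chart_potential_derivative)
    moreover have "2 * Re (\<Sum>k\<in>UNIV. a k y * w $ k) + real m * (2 * Re (\<Sum>k\<in>UNIV. potential_grad k y * w $ k)) = 2 * Re (\<Sum>k\<in>UNIV. g k y * w $ k)" for w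
      unfolding g_def sum_2 by (simp add: algebra_simps)
    ultimately show ?thesis by simp
  qed
  obtain F where F: "\<And>y. y \<in> ball x r \<Longrightarrow> hol_at F y" "\<And>y. y \<in> ball x r \<Longrightarrow> 2 * Re (F y) = u y"
  proof -
    have "c1_on (ball x r) (g k)" for k
      using g_c1[of k] r(2) unfolding c1_on_def by (auto intro: continuous_on_subset)
    then have "\<exists>F. (\<forall>y\<in>ball x r. hol_at F y) \<and> (\<forall>y\<in>ball x r. 2 * Re (F y) = u y)"
      using r(2) by (intro pluriharmonic_real_part[of x r u g] u_der g_hol) auto
    with that show ?thesis by blast
  qed
  have "hol_at (\<lambda>y. exp (- 1 * F y)) y \<and> (cmod (exp (- 1 * F y)))\<^sup>2 * H y = exp (- real m * chart_potential y)" if y: "y \<in> ball x r" for y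
  proof
    show "hol_at (\<lambda>y. exp (- 1 * F y)) y" by (intro hol_at_exp hol_at_mult hol_at_const F(1)[OF y])
    have "(cmod (exp (- 1 * F y)))\<^sup>2 = exp (- (2 * Re (F y)))"
      by (simp add: norm_exp_eq_Re exp_double[symmetric] flip: exp_of_nat_mult)
    also have "\<dots> = exp (- real m * chart_potential y) / H y"
      unfolding F(2)[OF y] u_def using pos[of y] y r(2) by (auto simp: exp_minus exp_add exp_diff field_simps)
    finally show "(cmod (exp (- 1 * F y)))\<^sup>2 * H y = exp (- real m * chart_potential y)"
      using pos[of y] y r(2) by (auto simp: field_simps)
  qed
  with r show ?thesis by blast
qed

section \<open>Unitary flat frames of the bundle over the two charts\<close>

lemma chart_image:
  assumes "c \<in> set blowup_atlas"
  shows "coord c ` (W \<inter> dom c) = {v. param c v \<in> W}"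
proof (intro equalityI subsetI)
  fix v assume "v \<in> coord c ` (W \<inter> dom c)"
  then show "v \<in> {v. param c v \<in> W}" using param_blow(4)[OF assms] by auto
next
  fix v assume "v \<in> {v. param c v \<in> W}"
  then show "v \<in> coord c ` (W \<inter> dom c)"
    using param_blow(1,2)[OF assms, of v] by (intro image_eqI[of _ _ "param c v"]) auto
qed

lemma openin_blowup:
  "openin (mf_topology blowup_atlas) W \<longleftrightarrow> W \<subseteq> blowup \<and> (\<forall>c\<in>set blowup_atlas. open {v. param c v \<in> W})"
proof -
  let ?O = "\<lambda>W. W \<subseteq> mf_points blowup_atlas \<and> (\<forall>c\<in>set blowup_atlas. open (coord c ` (W \<inter> dom c)))"
  have O: "?O W \<longleftrightarrow> W \<subseteq> blowup \<and> (\<forall>c\<in>set blowup_atlas. open {v. param c v \<in> W})" for W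
    by (simp add: mf_points_blowup_atlas chart_image)
  have "istopology ?O"
    unfolding istopology_def O by (auto simp: Collect_conj_eq Collect_bex_eq intro!: open_Int open_UN)
  show ?thesis
    unfolding mf_topology_def topology_inverse'[OF \<open>istopology ?O\<close>] by (rule O)
qed

lemma topspace_blowup: "topspace (mf_topology blowup_atlas) = blowup"
proof -
  have "param c v \<in> blowup" if "c \<in> set blowup_atlas" for c v
    using param_blow(1)[OF that, of v] that unfolding mf_points_blowup_atlas[symmetric] mf_points_def by blast
  then have "openin (mf_topology blowup_atlas) blowup"
    unfolding openin_blowup by simp
  then have "blowup \<subseteq> topspace (mf_topology blowup_atlas)" by (rule openin_subset)
  moreover have "topspace (mf_topology blowup_atlas) \<subseteq> blowup"
    using openin_topspace[of "mf_topology blowup_atlas"] unfolding openin_blowup by (rule conjunct1)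
  ultimately show ?thesis by (rule subset_antisym[rotated])
qed

lemma mf_hol_on_blowup:
  "mf_hol_on blowup_atlas W f \<longleftrightarrow> (\<forall>c\<in>set blowup_atlas. \<forall>v. param c v \<in> W \<longrightarrow> hol_at (f \<circ> param c) v)"
  by (auto simp: mf_hol_on_def chart_image hol_on_iff_hol_at)

text \<open>The germ at \<open>v\<close> of a holomorphic frame of squared norm \<open>exp (- m \<phi>)\<close>, given by its components in all
  trivializations. Components in trivializations that are not defined at the point are set to zero, so that equal
  frames are equal functions.\<close>

definition unit_frame ::
  "('i,blowup_point) line_bundle \<Rightarrow> ('i,blowup_point) lb_metric \<Rightarrow> nat \<Rightarrow> (blowup_point,2) chart \<Rightarrow>
   (complex^2 \<Rightarrow> 'i \<Rightarrow> complex) \<Rightarrow> complex^2 \<Rightarrow> bool" where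
  "unit_frame L h m c \<tau> v \<longleftrightarrow>
     (\<forall>i\<in>lb_index L. param c v \<in> lb_cover L i \<longrightarrow>
        hol_at (\<lambda>y. \<tau> y i) v \<and> (cmod (\<tau> v i))\<^sup>2 * h i (param c v) = exp (- real m * chart_potential v) \<and>
        (\<forall>j\<in>lb_index L. param c v \<in> lb_cover L j \<longrightarrow> \<tau> v i = lb_trans L i j (param c v) * \<tau> v j)) \<and>
     (\<forall>i. \<not> (i \<in> lb_index L \<and> param c v \<in> lb_cover L i) \<longrightarrow> \<tau> v i = 0)"

lemma param_in_blowup: "c \<in> set blowup_atlas \<Longrightarrow> param c v \<in> blowup"
  using param_blow(1)[of c v] unfolding mf_points_blowup_atlas[symmetric] mf_points_def by blast

lemma line_bundle_cover:
  assumes "hol_line_bundle blowup_atlas L" "c \<in> set blowup_atlas"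
  shows "\<exists>i\<in>lb_index L. param c v \<in> lb_cover L i" "i \<in> lb_index L \<Longrightarrow> open {v. param c v \<in> lb_cover L i}"
proof -
  have U: "(\<Union>i\<in>lb_index L. lb_cover L i) = blowup" and O: "\<forall>i\<in>lb_index L. openin (mf_topology blowup_atlas) (lb_cover L i)"
    using assms(1) unfolding hol_line_bundle_def mf_points_blowup_atlas by simp_all
  show "\<exists>i\<in>lb_index L. param c v \<in> lb_cover L i"
    using param_in_blowup[OF assms(2), of v] unfolding U[symmetric] by simp
  show "open {v. param c v \<in> lb_cover L i}" if "i \<in> lb_index L"
    using O[rule_format, OF that] assms(2) unfolding openin_blowup by simp
qed

lemma unit_frameD:
  assumes "unit_frame L h m c \<tau> v"
  shows "i \<in> lb_index L \<Longrightarrow> param c v \<in> lb_cover L i \<Longrightarrow> hol_at (\<lambda>y. \<tau> y i) v"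
    "i \<in> lb_index L \<Longrightarrow> param c v \<in> lb_cover L i \<Longrightarrow> (cmod (\<tau> v i))\<^sup>2 * h i (param c v) = exp (- real m * chart_potential v)"
    "i \<in> lb_index L \<Longrightarrow> param c v \<in> lb_cover L i \<Longrightarrow> j \<in> lb_index L \<Longrightarrow> param c v \<in> lb_cover L j \<Longrightarrow>
       \<tau> v i = lb_trans L i j (param c v) * \<tau> v j"
    "\<not> (i \<in> lb_index L \<and> param c v \<in> lb_cover L i) \<Longrightarrow> \<tau> v i = 0"
proof -
  note a = assms[unfolded unit_frame_def, THEN conjunct1, rule_format]
  show "i \<in> lb_index L \<Longrightarrow> param c v \<in> lb_cover L i \<Longrightarrow> hol_at (\<lambda>y. \<tau> y i) v"
    "i \<in> lb_index L \<Longrightarrow> param c v \<in> lb_cover L i \<Longrightarrow> (cmod (\<tau> v i))\<^sup>2 * h i (param c v) = exp (- real m * chart_potential v)"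
    by (rule a[THEN conjunct1] a[THEN conjunct2, THEN conjunct1], assumption+)+
  show "i \<in> lb_index L \<Longrightarrow> param c v \<in> lb_cover L i \<Longrightarrow> j \<in> lb_index L \<Longrightarrow> param c v \<in> lb_cover L j \<Longrightarrow>
       \<tau> v i = lb_trans L i j (param c v) * \<tau> v j"
    by (rule a[THEN conjunct2, THEN conjunct2, rule_format])
  show "\<not> (i \<in> lb_index L \<and> param c v \<in> lb_cover L i) \<Longrightarrow> \<tau> v i = 0"
    by (rule assms[unfolded unit_frame_def, THEN conjunct2, rule_format])
qed

lemma unit_frame_nonzero:
  assumes "unit_frame L h m c \<tau> v" "i \<in> lb_index L" "param c v \<in> lb_cover L i"
  shows "\<tau> v i \<noteq> 0"
proof
  assume "\<tau> v i = 0"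
  with unit_frameD(2)[OF assms] show False by simp
qed

lemma line_bundleD:
  assumes "hol_line_bundle blowup_atlas L" "i \<in> lb_index L" "j \<in> lb_index L"
  shows "mf_hol_on blowup_atlas (lb_cover L i \<inter> lb_cover L j) (lb_trans L i j)"
    "k \<in> lb_index L \<Longrightarrow> x \<in> lb_cover L i \<Longrightarrow> x \<in> lb_cover L j \<Longrightarrow> x \<in> lb_cover L k \<Longrightarrow>
       lb_trans L i j x * lb_trans L j k x = lb_trans L i k x"
proof -
  note a = assms(1)[unfolded hol_line_bundle_def, THEN conjunct2, THEN conjunct2]
  show "mf_hol_on blowup_atlas (lb_cover L i \<inter> lb_cover L j) (lb_trans L i j)"
    using a[THEN conjunct1] assms(2,3) by blast
  show "k \<in> lb_index L \<Longrightarrow> x \<in> lb_cover L i \<Longrightarrow> x \<in> lb_cover L j \<Longrightarrow> x \<in> lb_cover L k \<Longrightarrow>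
       lb_trans L i j x * lb_trans L j k x = lb_trans L i k x"
    using a[THEN conjunct2] assms(2,3) by blast
qed

lemma hermitian_metricD:
  assumes "hermitian_metric blowup_atlas L h" "i \<in> lb_index L"
  shows "mf_smooth_on blowup_atlas (lb_cover L i) (h i)" "x \<in> lb_cover L i \<Longrightarrow> h i x > 0"
    "j \<in> lb_index L \<Longrightarrow> x \<in> lb_cover L i \<Longrightarrow> x \<in> lb_cover L j \<Longrightarrow> h j x = (cmod (lb_trans L i j x))\<^sup>2 * h i x"
proof -
  note a = assms(1)[unfolded hermitian_metric_def]
  show "mf_smooth_on blowup_atlas (lb_cover L i) (h i)" "x \<in> lb_cover L i \<Longrightarrow> h i x > 0"
    using a[THEN conjunct1] assms(2) by blast+
  show "j \<in> lb_index L \<Longrightarrow> x \<in> lb_cover L i \<Longrightarrow> x \<in> lb_cover L j \<Longrightarrow> h j x = (cmod (lb_trans L i j x))\<^sup>2 * h i x"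
    using a[THEN conjunct2] assms(2) by blast
qed

lemma hol_sectionD:
  assumes "hol_section blowup_atlas L s" "i \<in> lb_index L"
  shows "c \<in> set blowup_atlas \<Longrightarrow> param c v \<in> lb_cover L i \<Longrightarrow> hol_at (s i \<circ> param c) v"
    "j \<in> lb_index L \<Longrightarrow> x \<in> lb_cover L i \<Longrightarrow> x \<in> lb_cover L j \<Longrightarrow> s i x = lb_trans L i j x * s j x"
proof -
  note a = assms(1)[unfolded hol_section_def mf_hol_on_blowup]
  show "c \<in> set blowup_atlas \<Longrightarrow> param c v \<in> lb_cover L i \<Longrightarrow> hol_at (s i \<circ> param c) v"
    using a[THEN conjunct1] assms(2) by blast
  show "j \<in> lb_index L \<Longrightarrow> x \<in> lb_cover L i \<Longrightarrow> x \<in> lb_cover L j \<Longrightarrow> s i x = lb_trans L i j x * s j x"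
    using a[THEN conjunct2] assms(2) by blast
qed

lemma unit_frame_scale:
  assumes "unit_frame L h m c \<tau> v" "cmod a = 1"
  shows "unit_frame L h m c (\<lambda>v i. a * \<tau> v i) v"
  unfolding unit_frame_def
proof (intro conjI ballI impI allI)
  fix i assume i: "i \<in> lb_index L" "param c v \<in> lb_cover L i"
  show "hol_at (\<lambda>y. a * \<tau> y i) v" by (intro hol_at_mult hol_at_const unit_frameD(1)[OF assms(1) i])
  show "(cmod (a * \<tau> v i))\<^sup>2 * h i (param c v) = exp (- real m * chart_potential v)"
    unfolding unit_frameD(2)[OF assms(1) i, symmetric] by (simp add: norm_mult assms(2))
  fix j assume "j \<in> lb_index L" "param c v \<in> lb_cover L j"
  from unit_frameD(3)[OF assms(1) i this] show "a * \<tau> v i = lb_trans L i j (param c v) * (a * \<tau> v j)"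
    by (metis mult.left_commute)
next
  fix i assume "\<not> (i \<in> lb_index L \<and> param c v \<in> lb_cover L i)"
  from unit_frameD(4)[OF assms(1) this] show "a * \<tau> v i = 0" by simp
qed

lemma unit_frame_local:
  assumes "unit_frame L h m c \<sigma> x" "open N" "x \<in> N" "\<And>y. y \<in> N \<Longrightarrow> \<sigma> y = \<tau> y"
  shows "unit_frame L h m c \<tau> x"
proof -
  have "hol_at (\<lambda>y. \<tau> y i) x" if "hol_at (\<lambda>y. \<sigma> y i) x" for i
    by (rule hol_at_cong_open[OF that assms(2,3)]) (simp add: assms(4))
  moreover have "\<tau> x = \<sigma> x" using assms(4)[OF assms(3)] by simp
  ultimately show ?thesis using assms(1) unfolding unit_frame_def by metis
qed

text \<open>The quotient of two frames does not depend on the trivialization in which it is computed, because the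
  transition functions cancel. It is holomorphic of modulus one.\<close>

lemma unit_frame_ratio:
  assumes L: "hol_line_bundle blowup_atlas L" and h: "hermitian_metric blowup_atlas L h" and c: "c \<in> set blowup_atlas"
    and W: "open W" "connected W"
    and \<sigma>: "\<And>y. y \<in> W \<Longrightarrow> unit_frame L h m c \<sigma> y" and \<tau>: "\<And>y. y \<in> W \<Longrightarrow> unit_frame L h m c \<tau> y"
  shows "\<exists>a. cmod a = 1 \<and> (\<forall>y\<in>W. \<forall>i. \<sigma> y i = a * \<tau> y i)"
proof -
  define \<iota> where "\<iota> y = (SOME i. i \<in> lb_index L \<and> param c y \<in> lb_cover L i)" for y
  have \<iota>: "\<iota> y \<in> lb_index L" "param c y \<in> lb_cover L (\<iota> y)" for y
    using someI_ex[of "\<lambda>i. i \<in> lb_index L \<and> param c y \<in> lb_cover L i"] line_bundle_cover(1)[OF L c, of y] unfolding \<iota>_def by blast+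
  define \<rho> where "\<rho> y = \<sigma> y (\<iota> y) / \<tau> y (\<iota> y)" for y
  have \<rho>: "\<rho> y = \<sigma> y i / \<tau> y i" if y: "y \<in> W" "i \<in> lb_index L" "param c y \<in> lb_cover L i" for y i
  proof -
    have "\<sigma> y i = lb_trans L i (\<iota> y) (param c y) * \<sigma> y (\<iota> y)" "\<tau> y i = lb_trans L i (\<iota> y) (param c y) * \<tau> y (\<iota> y)"
      by (rule unit_frameD(3)[OF \<sigma>[OF y(1)] y(2,3) \<iota>] unit_frameD(3)[OF \<tau>[OF y(1)] y(2,3) \<iota>])+
    moreover have "\<tau> y i \<noteq> 0" by (rule unit_frame_nonzero[OF \<tau>[OF y(1)] y(2,3)])
    ultimately show ?thesis by (simp add: \<rho>_def)
  qed
  have "\<exists>a. cmod a = 1 \<and> (\<forall>y\<in>W. \<rho> y = a)"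
  proof (rule unimodular_hol_constant[OF W])
    fix x assume x: "x \<in> W"
    let ?N = "W \<inter> {v. param c v \<in> lb_cover L (\<iota> x)}"
    have "hol_at (\<lambda>y. \<sigma> y (\<iota> x) / \<tau> y (\<iota> x)) x"
      by (intro hol_at_divide unit_frameD(1)[OF \<sigma>[OF x] \<iota>] unit_frameD(1)[OF \<tau>[OF x] \<iota>] unit_frame_nonzero[OF \<tau>[OF x] \<iota>])
    then show "hol_at \<rho> x"
    proof (rule hol_at_cong_open[of _ _ ?N])
      show "open ?N" by (intro open_Int W(1) line_bundle_cover(2)[OF L c \<iota>(1)])
      show "x \<in> ?N" using x \<iota>(2) by simp
      show "\<sigma> y (\<iota> x) / \<tau> y (\<iota> x) = \<rho> y" if "y \<in> ?N" for y
        using \<rho>[of y "\<iota> x"] \<iota>(1) that by simp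
    qed
    have hp: "h (\<iota> x) (param c x) > 0" by (rule hermitian_metricD(2)[OF h \<iota>])
    have "(cmod (\<sigma> x (\<iota> x)))\<^sup>2 * h (\<iota> x) (param c x) = (cmod (\<tau> x (\<iota> x)))\<^sup>2 * h (\<iota> x) (param c x)"
      unfolding unit_frameD(2)[OF \<sigma>[OF x] \<iota>] unit_frameD(2)[OF \<tau>[OF x] \<iota>] ..
    then have "cmod (\<sigma> x (\<iota> x)) = cmod (\<tau> x (\<iota> x))" using hp by simp
    then show "cmod (\<rho> x) = 1" using unit_frame_nonzero[OF \<tau>[OF x] \<iota>] by (simp add: \<rho>_def norm_divide)
  qed
  then obtain a where a: "cmod a = 1" "\<And>y. y \<in> W \<Longrightarrow> \<rho> y = a" by blast
  have "\<sigma> y i = a * \<tau> y i" if y: "y \<in> W" for y i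
  proof (cases "i \<in> lb_index L \<and> param c y \<in> lb_cover L i")
    case True
    with \<rho>[OF y, of i] a(2)[OF y] unit_frame_nonzero[OF \<tau>[OF y], of i] show ?thesis by (simp add: field_simps)
  next
    case False
    then show ?thesis using unit_frameD(4)[OF \<sigma>[OF y]] unit_frameD(4)[OF \<tau>[OF y]] by simp
  qed
  with a(1) show ?thesis by blast
qed

text \<open>A unit section in one trivialization is transported to the others by the transition functions.\<close>

lemma unit_frame_locally_exists:
  assumes L: "hol_line_bundle blowup_atlas L" and h: "hermitian_metric blowup_atlas L h" and c: "c \<in> set blowup_atlas"
    and ric: "has_ricci blowup_atlas L h (\<lambda>c p. \<chi> j k. of_nat m * \<omega> c p $ j $ k)" and \<omega>: "simanca_form \<omega>"
  shows "\<exists>e>0. \<exists>\<tau>. \<forall>y\<in>ball x e. unit_frame L h m c \<tau> y"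
proof -
  obtain i where i: "i \<in> lb_index L" "param c x \<in> lb_cover L i" using line_bundle_cover(1)[OF L c] by blast
  let ?S = "{v. param c v \<in> lb_cover L i}"
  have S: "open ?S" by (rule line_bundle_cover(2)[OF L c i(1)])
  have hi: "mf_smooth_on blowup_atlas (lb_cover L i) (h i)" "\<And>x. x \<in> lb_cover L i \<Longrightarrow> h i x > 0"
    by (rule hermitian_metricD[OF h i(1)], assumption?)+
  have "cr_on 2 ?S (h i \<circ> param c)"
    using hi(1) c unfolding mf_smooth_on_def mf_cr_on_def by (metis chart_image)
  moreover have "- ddbar (\<lambda>w. ln ((h i \<circ> param c) w)) v $ j $ k = of_nat m * chart_matrix (v $ 1) (v $ 2) $ j $ k"
    if "v \<in> ?S" for v j k
  proof -
    have "ricci h i c (param c v) = (\<chi> j k. of_nat m * \<omega> c (param c v) $ j $ k)"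
      using ric[unfolded has_ricci_def, rule_format, OF i(1) c, of "param c v"] that param_blow(1)[OF c, of v] by simp
    then have "ricci h i c (param c v) $ j $ k = of_nat m * \<omega> c (param c v) $ j $ k" by simp
    then show ?thesis unfolding ricci_def by (simp add: param_blow(2)[OF c] simanca_form_chart[OF \<omega> c])
  qed
  ultimately have "\<exists>r>0. \<exists>\<sigma>. ball x r \<subseteq> ?S \<and> (\<forall>y\<in>ball x r. hol_at \<sigma> y \<and>
      (cmod (\<sigma> y))\<^sup>2 * (h i \<circ> param c) y = exp (- real m * chart_potential y))"
    by (intro local_unit_section[OF S, of "h i \<circ> param c"]) (use hi(2) i(2) in simp_all)
  then obtain e \<sigma> where e: "e > 0" "ball x e \<subseteq> ?S"
    and \<sigma>: "\<And>y. y \<in> ball x e \<Longrightarrow> hol_at \<sigma> y" "\<And>y. y \<in> ball x e \<Longrightarrow> (cmod (\<sigma> y))\<^sup>2 * h i (param c y) = exp (- real m * chart_potential y)"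
    unfolding o_def by blast
  define \<tau> where "\<tau> y j = (if j \<in> lb_index L \<and> param c y \<in> lb_cover L j then lb_trans L j i (param c y) * \<sigma> y else 0)" for y j
  have "unit_frame L h m c \<tau> y" if y: "y \<in> ball x e" for y
    unfolding unit_frame_def
  proof (intro conjI ballI impI allI)
    have yi: "param c y \<in> lb_cover L i" using y e(2) by blast
    fix j assume j: "j \<in> lb_index L" "param c y \<in> lb_cover L j"
    let ?N = "ball x e \<inter> {v. param c v \<in> lb_cover L j}"
    have "hol_at (lb_trans L j i \<circ> param c) y"
      using line_bundleD(1)[OF L j(1) i(1)] j yi c unfolding mf_hol_on_blowup by simp
    then have "hol_at (\<lambda>v. (lb_trans L j i \<circ> param c) v * \<sigma> v) y" by (intro hol_at_mult \<sigma>(1)[OF y])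
    then show "hol_at (\<lambda>v. \<tau> v j) y"
      by (rule hol_at_cong_open[of _ _ ?N]) (use y j line_bundle_cover(2)[OF L c j(1)] in \<open>auto simp: \<tau>_def\<close>)
    have "h i (param c y) = (cmod (lb_trans L j i (param c y)))\<^sup>2 * h j (param c y)"
      by (rule hermitian_metricD(3)[OF h j(1) i(1) j(2) yi])
    then show "(cmod (\<tau> y j))\<^sup>2 * h j (param c y) = exp (- real m * chart_potential y)"
      using \<sigma>(2)[OF y] j by (simp add: \<tau>_def norm_mult power_mult_distrib mult_ac)
    fix k assume k: "k \<in> lb_index L" "param c y \<in> lb_cover L k"
    have "lb_trans L j k (param c y) * lb_trans L k i (param c y) = lb_trans L j i (param c y)"
      by (rule line_bundleD(2)[OF L j(1) k(1) i(1) j(2) k(2) yi])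
    then show "\<tau> y j = lb_trans L j k (param c y) * \<tau> y k" using j k by (simp add: \<tau>_def mult.assoc[symmetric])
  qed (auto simp: \<tau>_def)
  with e(1) show ?thesis by blast
qed

text \<open>Frames whose norm is \<open>exp (- m \<phi>)\<close> form a locally constant sheaf, since the quotient of two of them is
  holomorphic of modulus one. The coordinate domains are vector spaces, hence there are global frames.\<close>

lemma unit_frame_exists:
  assumes L: "hol_line_bundle blowup_atlas L" and h: "hermitian_metric blowup_atlas L h" and c: "c \<in> set blowup_atlas"
    and ric: "has_ricci blowup_atlas L h (\<lambda>c p. \<chi> j k. of_nat m * \<omega> c p $ j $ k)" and \<omega>: "simanca_form \<omega>"
  shows "\<exists>\<tau>. \<forall>v. unit_frame L h m c \<tau> v"
proof (rule locally_constant_sheaf_global_section)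
  fix \<sigma> \<tau> :: "complex^2 \<Rightarrow> 'a \<Rightarrow> complex" and W
  assume W: "open W" "connected W" and \<sigma>: "\<And>y. y \<in> W \<Longrightarrow> unit_frame L h m c \<sigma> y" and \<tau>: "\<And>y. y \<in> W \<Longrightarrow> unit_frame L h m c \<tau> y"
  from unit_frame_ratio[OF L h c W \<sigma> \<tau>] obtain a where a: "cmod a = 1" "\<forall>y\<in>W. \<forall>i. \<sigma> y i = a * \<tau> y i" by auto
  show "\<exists>\<tau>'. (\<forall>x. unit_frame L h m c \<tau> x \<longrightarrow> unit_frame L h m c \<tau>' x) \<and> (\<forall>y\<in>W. \<tau>' y = \<sigma> y)"
    using a by (intro exI[of _ "\<lambda>v i. a * \<tau> v i"]) (simp add: unit_frame_scale fun_eq_iff)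
  fix b y assume b: "b \<in> W" "\<sigma> b = \<tau> b" "y \<in> W"
  obtain i where i: "i \<in> lb_index L" "param c b \<in> lb_cover L i" using line_bundle_cover(1)[OF L c] by blast
  have "\<tau> b i = a * \<tau> b i" using a(2)[rule_format, OF b(1), of i] unfolding b(2) .
  then have "a = 1" using unit_frame_nonzero[OF \<tau>[OF b(1)] i] by simp
  then show "\<sigma> y = \<tau> y" using a(2) b(3) by (simp add: fun_eq_iff)
next
  show "\<exists>e>0. \<exists>\<tau>. \<forall>y\<in>ball x e. unit_frame L h m c \<tau> y" for x
    by (rule unit_frame_locally_exists[OF assms])
qed (rule unit_frame_local)

definition chart_change :: "complex^2 \<Rightarrow> complex^2" where
  "chart_change v = V2 (v $ 1 * v $ 2) (1 / v $ 2)"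

lemma chart_change_chart_change: "v $ 2 \<noteq> 0 \<Longrightarrow> chart_change (chart_change v) = v"
  by (simp add: chart_change_def V2_eta)

lemma chart_change_param:
  "v $ 2 \<noteq> 0 \<Longrightarrow> param blowup_chart2 (chart_change v) = param blowup_chart1 v"
  "v $ 2 \<noteq> 0 \<Longrightarrow> param blowup_chart1 (chart_change v) = param blowup_chart2 v"
  unfolding param1 param2 chart_change_def
  by (rule blow1_eq_blow2[symmetric] blow2_eq_blow1[symmetric], assumption)+

text \<open>The potentials of the two charts differ by \<open>log |t|\<^sup>2\<close>.\<close>

lemma chart_potential_change:
  fixes v :: "complex^2"
  assumes "v $ 2 \<noteq> 0"
  shows "exp (- real m * chart_potential (chart_change v)) = (cmod (v $ 2) ^ m)\<^sup>2 * exp (- real m * chart_potential v)"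
proof -
  let ?T = "(cmod (v $ 2))\<^sup>2"
  have T: "?T > 0" using assms by simp
  have "ln (1 + 1 / ?T) = ln (1 + ?T) - ln ?T"
  proof -
    have "1 + 1 / ?T = (1 + ?T) / ?T" using T by (simp add: field_simps)
    then show ?thesis using T ln_div[of "1 + ?T" ?T] one_plus_square_pos(1)[of "cmod (v $ 2)"] by (simp split: if_splits)
  qed
  then have "chart_potential (chart_change v) = chart_potential v - ln ?T"
  proof -
    assume ln: "ln (1 + 1 / ?T) = ln (1 + ?T) - ln ?T"
    have "chart_potential (chart_change v) = ((cmod (v $ 1))\<^sup>2 * ?T) * (1 + 1 / ?T) + ln (1 + 1 / ?T)"
      by (simp add: chart_potential_def chart_change_def norm_mult norm_divide power_mult_distrib power_divide)
    moreover have "((cmod (v $ 1))\<^sup>2 * ?T) * (1 + 1 / ?T) = (cmod (v $ 1))\<^sup>2 * (1 + ?T)"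
      using T by (simp add: distrib_left)
    ultimately show ?thesis unfolding ln chart_potential_def by simp
  qed
  then have "exp (- real m * chart_potential (chart_change v)) = exp (- real m * (chart_potential v - ln ?T))" by (simp only: )
  also have "\<dots> = exp (- real m * chart_potential v) * exp (real m * ln ?T)"
    by (simp only: exp_add[symmetric]) (simp add: algebra_simps del: ln_realpow)
  also have "exp (real m * ln ?T) = ?T ^ m" using T by (simp add: exp_of_nat_mult)
  finally show ?thesis by (simp add: power_mult[symmetric] mult.commute)
qed

lemma V2_continuous: "continuous_on S f \<Longrightarrow> continuous_on S g \<Longrightarrow> continuous_on S (\<lambda>x. V2 (f x) (g x))"
proof -
  have "V2 a b = (\<chi> i. if i = 1 then a else b)" for a b by (auto simp: vec_eq_iff forall_2)
  note V = this
  assume fg: "continuous_on S f" "continuous_on S g"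
  have "continuous_on S (\<lambda>x. if i = 1 then f x else g x)" for i :: 2
    using fg by (cases "i = 1") simp_all
  then show ?thesis unfolding V by (intro continuous_on_vec_lambda)
qed

lemma off_line_open_connected:
  "open {v :: complex^2. v $ 2 \<noteq> 0}" "connected {v :: complex^2. v $ 2 \<noteq> 0}"
proof -
  show "open {v :: complex^2. v $ 2 \<noteq> 0}"
    by (intro open_Collect_neq continuous_intros)
  have eq: "{v :: complex^2. v $ 2 \<noteq> 0} = (\<lambda>p. V2 (fst p) (snd p)) ` (UNIV \<times> (- {0}))"
  proof (intro equalityI subsetI)
    fix v :: "complex^2" assume "v \<in> {v. v $ 2 \<noteq> 0}"
    then show "v \<in> (\<lambda>p. V2 (fst p) (snd p)) ` (UNIV \<times> (- {0}))" by (intro image_eqI[of _ _ "(v $ 1, v $ 2)"]) (auto simp: V2_eta)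
  qed auto
  have "connected (UNIV \<times> (- {0}) :: (complex \<times> complex) set)"
    by (intro connected_Times connected_UNIV connected_punctured_universe) simp
  then show "connected {v :: complex^2. v $ 2 \<noteq> 0}" unfolding eq
    by (rule connected_continuous_image[rotated]) (intro V2_continuous continuous_intros)
qed

lemma chart_change_hol: "v $ 2 \<noteq> 0 \<Longrightarrow> hol_at (\<lambda>x. chart_change x $ k) v"
  using exhaust_2[of k] unfolding chart_change_def
  by (elim disjE; simp only: V2_nth; intro hol_at_mult hol_at_coord hol_at_divide hol_at_const)

text \<open>On the overlap of the charts the two frames differ by the factor \<open>t\<^sup>m\<close> and a constant of modulus one,
  which is normalized away.\<close>

lemma unit_frames_two_charts:
  assumes L: "hol_line_bundle blowup_atlas L" and h: "hermitian_metric blowup_atlas L h"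
    and ric: "has_ricci blowup_atlas L h (\<lambda>c p. \<chi> j k. of_nat m * \<omega> c p $ j $ k)" and \<omega>: "simanca_form \<omega>"
  shows "\<exists>\<tau>1 \<tau>2. (\<forall>v. unit_frame L h m blowup_chart1 \<tau>1 v) \<and> (\<forall>v. unit_frame L h m blowup_chart2 \<tau>2 v) \<and>
     (\<forall>v i. v $ 2 \<noteq> 0 \<longrightarrow> \<tau>2 (chart_change v) i = (v $ 2) ^ m * \<tau>1 v i)"
proof -
  have c12: "blowup_chart1 \<in> set blowup_atlas" "blowup_chart2 \<in> set blowup_atlas" by (auto simp: set_blowup_atlas)
  obtain \<tau>1 \<tau>2 where \<tau>1: "\<And>v. unit_frame L h m blowup_chart1 \<tau>1 v" and \<tau>2: "\<And>v. unit_frame L h m blowup_chart2 \<tau>2 v"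
    using unit_frame_exists[OF L h c12(1) ric \<omega>] unit_frame_exists[OF L h c12(2) ric \<omega>] by blast
  define \<sigma> where "\<sigma> v i = \<tau>2 (chart_change v) i / (v $ 2) ^ m" for v i
  have "unit_frame L h m blowup_chart1 \<sigma> v" if v: "v $ 2 \<noteq> 0" for v :: "complex^2"
    unfolding unit_frame_def
  proof (intro conjI ballI impI allI)
    note u = unit_frameD[OF \<tau>2[of "chart_change v"], unfolded chart_change_param(1)[OF v]]
    fix i assume i: "i \<in> lb_index L" "param blowup_chart1 v \<in> lb_cover L i"
    have "v $ 2 ^ m \<noteq> 0" using v by simp
    from hol_at_divide[OF hol_at_compose[OF u(1)[OF i] chart_change_hol[OF v]] hol_at_power[OF hol_at_coord] this]
    show "hol_at (\<lambda>y. \<sigma> y i) v" unfolding \<sigma>_def .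
    have "(cmod (\<tau>2 (chart_change v) i))\<^sup>2 * h i (param blowup_chart1 v) = (cmod (v $ 2) ^ m)\<^sup>2 * exp (- real m * chart_potential v)"
      unfolding u(2)[OF i] chart_potential_change[OF v] ..
    then have "(cmod (\<tau>2 (chart_change v) i))\<^sup>2 / (cmod (v $ 2) ^ m)\<^sup>2 * h i (param blowup_chart1 v) = exp (- real m * chart_potential v)"
      using v by (simp only: times_divide_eq_left) simp
    then show "(cmod (\<sigma> v i))\<^sup>2 * h i (param blowup_chart1 v) = exp (- real m * chart_potential v)"
      unfolding \<sigma>_def norm_divide norm_power power_divide .
    fix j assume j: "j \<in> lb_index L" "param blowup_chart1 v \<in> lb_cover L j"
    show "\<sigma> v i = lb_trans L i j (param blowup_chart1 v) * \<sigma> v j"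
      unfolding \<sigma>_def u(3)[OF i j] by simp
  next
    fix i assume "\<not> (i \<in> lb_index L \<and> param blowup_chart1 v \<in> lb_cover L i)"
    then show "\<sigma> v i = 0" using unit_frameD(4)[OF \<tau>2[of "chart_change v"], unfolded chart_change_param(1)[OF v]] by (simp add: \<sigma>_def)
  qed
  then obtain a where a: "cmod a = 1" "\<And>(y::complex^2) i. y $ 2 \<noteq> 0 \<Longrightarrow> \<sigma> y i = a * \<tau>1 y i"
    using unit_frame_ratio[OF L h c12(1) off_line_open_connected, of m \<sigma> \<tau>1] \<tau>1 by auto
  show ?thesis
  proof (rule exI[of _ "\<lambda>v i. a * \<tau>1 v i"], rule exI[of _ \<tau>2], intro conjI allI impI)
    show "\<tau>2 (chart_change v) i = (v $ 2) ^ m * (a * \<tau>1 v i)" if "v $ 2 \<noteq> 0" for v :: "complex^2" and i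
      using a(2)[OF that, of i] that by (simp add: \<sigma>_def field_simps)
  qed (auto intro: unit_frame_scale \<tau>1 \<tau>2 a(1))
qed

lemma section_in_frame:
  assumes L: "hol_line_bundle blowup_atlas L" and c: "c \<in> set blowup_atlas" and \<tau>: "\<And>v. unit_frame L h m c \<tau> v"
    and s: "hol_section blowup_atlas L s"
  shows "\<exists>f. (\<forall>v. hol_at f v) \<and> (\<forall>v. \<forall>i\<in>lb_index L. param c v \<in> lb_cover L i \<longrightarrow> s i (param c v) = f v * \<tau> v i)"
proof -
  define \<iota> where "\<iota> y = (SOME i. i \<in> lb_index L \<and> param c y \<in> lb_cover L i)" for y
  have \<iota>: "\<iota> y \<in> lb_index L" "param c y \<in> lb_cover L (\<iota> y)" for y
    using someI_ex[of "\<lambda>i. i \<in> lb_index L \<and> param c y \<in> lb_cover L i"] line_bundle_cover(1)[OF L c, of y] unfolding \<iota>_def by blast+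
  define f where "f y = s (\<iota> y) (param c y) / \<tau> y (\<iota> y)" for y
  have f: "f y = s i (param c y) / \<tau> y i" if y: "i \<in> lb_index L" "param c y \<in> lb_cover L i" for y i
  proof -
    have "s i (param c y) = lb_trans L i (\<iota> y) (param c y) * s (\<iota> y) (param c y)"
      by (rule hol_sectionD(2)[OF s y(1) \<iota>(1) y(2) \<iota>(2)])
    moreover have "\<tau> y i = lb_trans L i (\<iota> y) (param c y) * \<tau> y (\<iota> y)"
      by (rule unit_frameD(3)[OF \<tau> y \<iota>])
    moreover have "\<tau> y i \<noteq> 0" by (rule unit_frame_nonzero[OF \<tau> y])
    ultimately show ?thesis by (simp add: f_def)
  qed
  have "hol_at f v" for v
  proof -
    let ?N = "{y. param c y \<in> lb_cover L (\<iota> v)}"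
    have "hol_at (s (\<iota> v) \<circ> param c) v"
      by (rule hol_sectionD(1)[OF s \<iota>(1) c \<iota>(2)])
    then have "hol_at (\<lambda>y. (s (\<iota> v) \<circ> param c) y / \<tau> y (\<iota> v)) v"
      by (intro hol_at_divide unit_frameD(1)[OF \<tau> \<iota>] unit_frame_nonzero[OF \<tau> \<iota>])
    then show ?thesis
    proof (rule hol_at_cong_open[of _ _ ?N])
      show "open ?N" by (rule line_bundle_cover(2)[OF L c \<iota>(1)])
      show "v \<in> ?N" using \<iota>(2) by simp
      show "(s (\<iota> v) \<circ> param c) y / \<tau> y (\<iota> v) = f y" if "y \<in> ?N" for y
        using f[of "\<iota> v" y] \<iota>(1) that by simp
    qed
  qed
  moreover have "s i (param c v) = f v * \<tau> v i" if "i \<in> lb_index L" "param c v \<in> lb_cover L i" for v i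
    using f[OF that] unit_frame_nonzero[OF \<tau> that] by simp
  ultimately show ?thesis by blast
qed

text \<open>The two descriptions of the section agree on the overlap because the factor \<open>t\<^sup>m\<close> between the coefficient
  functions is inverse to the one between the frames.\<close>

lemma section_from_frames:
  assumes \<tau>1: "\<And>v. unit_frame L h m blowup_chart1 \<tau>1 v" and \<tau>2: "\<And>v. unit_frame L h m blowup_chart2 \<tau>2 v"
    and \<tau>12: "\<And>v i. v $ 2 \<noteq> 0 \<Longrightarrow> \<tau>2 (chart_change v) i = (v $ 2) ^ m * \<tau>1 v i"
    and L: "hol_line_bundle blowup_atlas L"
    and f: "\<And>v. hol_at f v" "\<And>v. hol_at g v" "\<And>v. v $ 2 \<noteq> 0 \<Longrightarrow> f v = (v $ 2) ^ m * g (chart_change v)"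
  shows "\<exists>s. hol_section blowup_atlas L s \<and> (\<forall>i v. s i (blow1 v) = f v * \<tau>1 v i) \<and> (\<forall>i v. s i (blow2 v) = g v * \<tau>2 v i)"
proof -
  define s where "s i q = (if q \<in> dom blowup_chart1 then f (coord blowup_chart1 q) * \<tau>1 (coord blowup_chart1 q) i
     else g (coord blowup_chart2 q) * \<tau>2 (coord blowup_chart2 q) i)" for i q
  have s1: "s i (blow1 v) = f v * \<tau>1 v i" for i v
    by (simp add: s_def blow1_in_dom1 coord1_blow1)
  have s2: "s i (blow2 v) = g v * \<tau>2 v i" for i v
  proof (cases "v $ 2 = 0")
    case True then show ?thesis by (simp add: s_def blow2_in_dom1 coord2_blow2)
  next
    case False
    define w where "w = chart_change v"
    have w: "w $ 2 \<noteq> 0" "chart_change w = v" "blow2 v = blow1 w"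
      using False by (auto simp: w_def chart_change_chart_change blow2_eq_blow1 chart_change_def V2_eta)
    show ?thesis unfolding w(3) s1 using f(3)[OF w(1)] \<tau>12[OF w(1), of i] w(2) by simp
  qed
  have "hol_section blowup_atlas L s"
    unfolding hol_section_def mf_hol_on_blowup
  proof (intro conjI ballI allI impI)
    fix i c v assume i: "i \<in> lb_index L" and c: "c \<in> set blowup_atlas" and v: "param c v \<in> lb_cover L i"
    have e1: "s i \<circ> blow1 = (\<lambda>v. f v * \<tau>1 v i)" and e2: "s i \<circ> blow2 = (\<lambda>v. g v * \<tau>2 v i)" using s1 s2 by auto
    consider "c = blowup_chart1" | "c = blowup_chart2" using c by (auto simp: set_blowup_atlas)
    then show "hol_at (s i \<circ> param c) v"
    proof cases
      case 1
      show ?thesis using v unfolding 1 param1 e1 by (intro hol_at_mult f unit_frameD(1)[OF \<tau>1 i]) (simp add: param1)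
    next
      case 2
      show ?thesis using v unfolding 2 param2 e2 by (intro hol_at_mult f unit_frameD(1)[OF \<tau>2 i]) (simp add: param2)
    qed
  next
    fix i j x assume ij: "i \<in> lb_index L" "j \<in> lb_index L" and x: "x \<in> lb_cover L i \<inter> lb_cover L j"
    have "x \<in> mf_points blowup_atlas" using L ij x unfolding hol_line_bundle_def by blast
    then consider v where "x = blow1 v" | v where "x = blow2 v"
      by (auto simp: mf_points_def set_blowup_atlas dom1_eq dom2_eq)
    then show "s i x = lb_trans L i j x * s j x"
    proof cases
      case 1
      have "\<tau>1 v i = lb_trans L i j x * \<tau>1 v j" using unit_frameD(3)[OF \<tau>1[of v] ij(1) _ ij(2)] x unfolding 1 param1 by simp
      then show ?thesis unfolding 1 s1 by simp
    next
      case 2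
      have "\<tau>2 v i = lb_trans L i j x * \<tau>2 v j" using unit_frameD(3)[OF \<tau>2[of v] ij(1) _ ij(2)] x unfolding 2 param2 by simp
      then show ?thesis unfolding 2 s2 by simp
    qed
  qed
  with s1 s2 show ?thesis by blast
qed

section \<open>Lebesgue measure on the complex plane\<close>

lemma lborel_complex_eq: "(lborel :: complex measure) = distr (lborel \<Otimes>\<^sub>M lborel) borel (\<lambda>(x,y). Complex x y)"
proof (rule lborel_eqI)
  have eq: "(\<lambda>(x,y). Complex x y) = (\<lambda>p. of_real (fst p) + \<i> * of_real (snd p))"
    by (auto simp: complex_eq_iff)
  have m: "(\<lambda>(x,y). Complex x y) \<in> (lborel \<Otimes>\<^sub>M lborel :: (real\<times>real) measure) \<rightarrow>\<^sub>M borel"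
    unfolding eq lborel_prod by (simp add: borel_measurable_continuous_onI continuous_intros)
  fix l u :: complex assume le: "\<And>b. b \<in> Basis \<Longrightarrow> l \<bullet> b \<le> u \<bullet> b"
  have vim: "(\<lambda>(x,y). Complex x y) -` box l u \<inter> space (lborel \<Otimes>\<^sub>M lborel) = box (Re l) (Re u) \<times> box (Im l) (Im u)"
    by (auto simp: box_def Basis_complex_def inner_complex_def space_pair_measure)
  have "emeasure (distr (lborel \<Otimes>\<^sub>M lborel) borel (\<lambda>(x,y). Complex x y)) (box l u)
      = emeasure lborel (box (Re l) (Re u)) * emeasure lborel (box (Im l) (Im u))"
    by (subst emeasure_distr[OF m], simp, subst vim, rule lborel.emeasure_pair_measure_Times) auto
  also have "\<dots> = (\<Prod>b\<in>Basis. (u - l) \<bullet> b)"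
    using le[of 1] le[of \<i>]
    by (simp add: Basis_complex_def inner_complex_def ennreal_mult)
  finally show "emeasure (distr (lborel \<Otimes>\<^sub>M lborel) borel (\<lambda>(x,y). Complex x y)) (box l u) = (\<Prod>b\<in>Basis. (u - l) \<bullet> b)" .
qed simp

lemma measurable_Complex[measurable]: "(\<lambda>p. Complex (fst p) (snd p)) \<in> borel_measurable borel"
proof -
  have eq: "(\<lambda>p. Complex (fst p) (snd p)) = (\<lambda>p. of_real (fst p) + \<i> * of_real (snd p))"
    by (auto simp: complex_eq_iff)
  show ?thesis unfolding eq by (intro borel_measurable_continuous_onI continuous_intros)
qed

lemma nn_integral_complex:
  assumes [measurable]: "f \<in> borel_measurable borel"
  shows "(\<integral>\<^sup>+z. f z \<partial>lborel) = (\<integral>\<^sup>+x. \<integral>\<^sup>+y. f (Complex x y) \<partial>lborel \<partial>lborel)"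
    and "(\<integral>\<^sup>+z. f z \<partial>lborel) = (\<integral>\<^sup>+y. \<integral>\<^sup>+x. f (Complex x y) \<partial>lborel \<partial>lborel)"
proof -
  have [measurable]: "(\<lambda>p. Complex (fst p) (snd p)) \<in> borel_measurable (lborel \<Otimes>\<^sub>M lborel)"
    unfolding lborel_prod by simp
  have g[measurable]: "(\<lambda>p. f (Complex (fst p) (snd p))) \<in> borel_measurable (lborel \<Otimes>\<^sub>M lborel)"
    by simp
  have eq: "(\<integral>\<^sup>+z. f z \<partial>lborel) = (\<integral>\<^sup>+p. f (Complex (fst p) (snd p)) \<partial>(lborel \<Otimes>\<^sub>M lborel))"
    by (subst lborel_complex_eq, subst nn_integral_distr) (auto simp: case_prod_beta)
  show "(\<integral>\<^sup>+z. f z \<partial>lborel) = (\<integral>\<^sup>+x. \<integral>\<^sup>+y. f (Complex x y) \<partial>lborel \<partial>lborel)"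
    unfolding eq lborel.nn_integral_fst[OF g, symmetric] by simp
  show "(\<integral>\<^sup>+z. f z \<partial>lborel) = (\<integral>\<^sup>+y. \<integral>\<^sup>+x. f (Complex x y) \<partial>lborel \<partial>lborel)"
    unfolding eq lborel.nn_integral_fst[OF g, symmetric] lborel_pair.Fubini[OF g, symmetric] by simp
qed

lemma nn_integral_shear:
  fixes f :: "complex \<Rightarrow> ennreal" and k :: real
  assumes [measurable]: "f \<in> borel_measurable borel"
  shows "(\<integral>\<^sup>+z. f (z + of_real (k * Im z)) \<partial>lborel) = (\<integral>\<^sup>+z. f z \<partial>lborel)"
    and "(\<integral>\<^sup>+z. f (z + \<i> * of_real (k * Re z)) \<partial>lborel) = (\<integral>\<^sup>+z. f z \<partial>lborel)"
proof -
  have tr: "(\<integral>\<^sup>+x. g (x + c) \<partial>lborel) = (\<integral>\<^sup>+x. g x \<partial>lborel)"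
    if [measurable]: "g \<in> borel_measurable borel" for g :: "real \<Rightarrow> ennreal" and c
    using nn_integral_real_affine[of g 1 c] by (simp add: add.commute)
  have [measurable]: "(\<lambda>x. Complex x y) \<in> borel_measurable borel" "(\<lambda>x. Complex y x) \<in> borel_measurable borel" for y
    by (auto simp: Complex_eq intro!: borel_measurable_continuous_onI continuous_intros)
  have [measurable]: "(\<lambda>z. f (z + of_real (k * Im z))) \<in> borel_measurable borel"
      "(\<lambda>z. f (z + \<i> * of_real (k * Re z))) \<in> borel_measurable borel" by simp_all
  have "(\<integral>\<^sup>+z. f (z + of_real (k * Im z)) \<partial>lborel) = (\<integral>\<^sup>+y. \<integral>\<^sup>+x. f (Complex (x + k*y) y) \<partial>lborel \<partial>lborel)"
    by (subst nn_integral_complex(2)) (auto simp: complex_eq_iff intro!: nn_integral_cong arg_cong[where f=f])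
  also have "\<dots> = (\<integral>\<^sup>+y. \<integral>\<^sup>+x. f (Complex x y) \<partial>lborel \<partial>lborel)"
    by (subst tr[where g="\<lambda>x. f (Complex x _)"]) auto
  finally show "(\<integral>\<^sup>+z. f (z + of_real (k * Im z)) \<partial>lborel) = (\<integral>\<^sup>+z. f z \<partial>lborel)"
    by (simp add: nn_integral_complex(2)[of f])
  have "(\<integral>\<^sup>+z. f (z + \<i> * of_real (k * Re z)) \<partial>lborel) = (\<integral>\<^sup>+x. \<integral>\<^sup>+y. f (Complex x (y + k * x)) \<partial>lborel \<partial>lborel)"
    by (subst nn_integral_complex(1)) (auto simp: complex_eq_iff intro!: nn_integral_cong arg_cong[where f=f])
  also have "\<dots> = (\<integral>\<^sup>+x. \<integral>\<^sup>+y. f (Complex x y) \<partial>lborel \<partial>lborel)"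
    by (subst tr[where g="\<lambda>y. f (Complex _ y)"]) auto
  finally show "(\<integral>\<^sup>+z. f (z + \<i> * of_real (k * Re z)) \<partial>lborel) = (\<integral>\<^sup>+z. f z \<partial>lborel)"
    by (simp add: nn_integral_complex(1)[of f])
qed

text \<open>A rotation by an angle other than \<open>\<pi>\<close> is a product of three shears, and shears preserve
  Lebesgue measure by Fubini's theorem and translation invariance. The excluded rotation is a square.\<close>

lemma nn_integral_rotation:
  fixes f :: "complex \<Rightarrow> ennreal"
  assumes [measurable]: "f \<in> borel_measurable borel" and c: "cmod c = 1"
  shows "(\<integral>\<^sup>+z. f (c * z) \<partial>lborel) = (\<integral>\<^sup>+z. f z \<partial>lborel)"
proof -
  have main: "(\<integral>\<^sup>+z. f (c * z) \<partial>lborel) = (\<integral>\<^sup>+z. f z \<partial>lborel)"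
    if [measurable]: "f \<in> borel_measurable borel" and c: "cmod c = 1" and "Re c \<noteq> -1" for f :: "complex \<Rightarrow> ennreal" and c
  proof -
    have n: "1 + Re c \<noteq> 0" using that by linarith
    \<comment> \<open>For \<open>c = exp (\<i> \<theta>)\<close> this is \<open>- tan (\<theta>/2)\<close>.\<close>
    obtain k where k: "k = - Im c / (1 + Re c)" by blast
    have sq: "(Im c)\<^sup>2 = (1 + Re c) * (1 - Re c)"
      using c by (simp add: cmod_def algebra_simps power2_eq_square)
    have ks: "k * Im c = Re c - 1"
      using sq n unfolding k by (simp add: field_simps power2_eq_square)
    have k2: "k * (1 + Re c) = - Im c" using n unfolding k by simp
    define A where "A = (\<lambda>z. z + of_real (k * Im z) :: complex)"
    define B where "B = (\<lambda>z. z + \<i> * of_real (Im c * Re z) :: complex)"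
    have [measurable]: "A \<in> borel_measurable borel" "B \<in> borel_measurable borel"
      unfolding A_def B_def by simp_all
    have "c * z = A (B (A z))" for z
    proof (rule complex_eqI)
      have "Re (A (B (A z))) = Re z * (1 + k * Im c) + Im z * (k * (1 + (1 + k * Im c)))"
        by (simp add: A_def B_def algebra_simps)
      also have "\<dots> = Re (c * z)" unfolding ks using k2 by (simp add: algebra_simps)
      finally show "Re (c * z) = Re (A (B (A z)))" ..
      have "Im (A (B (A z))) = Im c * Re z + Im z * (1 + k * Im c)"
        by (simp add: A_def B_def algebra_simps)
      also have "\<dots> = Im (c * z)" unfolding ks by (simp add: algebra_simps)
      finally show "Im (c * z) = Im (A (B (A z)))" ..
    qed
    then have "(\<integral>\<^sup>+z. f (c * z) \<partial>lborel) = (\<integral>\<^sup>+z. f (A (B (A z))) \<partial>lborel)" by simp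
    also have "\<dots> = (\<integral>\<^sup>+z. f (A (B z)) \<partial>lborel)"
      using nn_integral_shear(1)[of "\<lambda>z. f (A (B z))" k] by (simp add: A_def)
    also have "\<dots> = (\<integral>\<^sup>+z. f (A z) \<partial>lborel)"
      using nn_integral_shear(2)[of "\<lambda>z. f (A z)" "Im c"] by (simp add: B_def)
    also have "\<dots> = (\<integral>\<^sup>+z. f z \<partial>lborel)"
      using nn_integral_shear(1)[of f k] by (simp add: A_def)
    finally show ?thesis .
  qed
  show ?thesis
  proof (cases "Re c = -1")
    case False then show ?thesis using main[of f c] c by simp
  next
    case True
    then have "Im c = 0" using c by (simp add: cmod_def real_sqrt_eq_1_iff)
    with True have c1: "c = \<i> * \<i>" by (simp add: complex_eq_iff)
    have "(\<integral>\<^sup>+z. f (c * z) \<partial>lborel) = (\<integral>\<^sup>+z. f (\<i> * z) \<partial>lborel)"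
      using main[of "\<lambda>z. f (\<i> * z)" \<i>] unfolding c1 by (simp add: mult.assoc)
    also have "\<dots> = (\<integral>\<^sup>+z. f z \<partial>lborel)" by (rule main) auto
    finally show ?thesis .
  qed
qed

text \<open>Polar coordinates for a radial function, in terms of the squared radius.\<close>

lemma distr_norm_squared:
  "distr lborel borel (\<lambda>z::complex. (cmod z)\<^sup>2) = density lborel (\<lambda>r. ennreal (pi * indicator {0..} r))" (is "?M = ?N")
proof (rule measure_eqI_generator_eq[where E="range atMost" and A="\<lambda>n. {..real n}" and \<Omega>=UNIV])
  show "Int_stable (range (atMost :: real \<Rightarrow> _))" by (auto simp: Int_stable_def)
  show "sets ?M = sigma_sets UNIV (range atMost)" "sets ?N = sigma_sets UNIV (range atMost)"
    by (simp_all add: borel_eq_atMost)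
  fix X assume "X \<in> range (atMost :: real \<Rightarrow> _)"
  then obtain a :: real where X: "X = {..a}" by auto
  have "emeasure ?M X = emeasure lborel ((\<lambda>z::complex. (cmod z)\<^sup>2) -` {..a})"
    unfolding X by (subst emeasure_distr) auto
  also have "\<dots> = ennreal (pi * max 0 a)"
  proof (cases "a \<ge> 0")
    case True
    have "(\<lambda>z::complex. (cmod z)\<^sup>2) -` {..a} = cball 0 (sqrt a)"
      using True by (auto simp: real_le_rsqrt sqrt_ge_absD)
    then show ?thesis using True by (simp add: emeasure_cball unit_ball_vol_2)
  next
    case False
    have "(\<lambda>z::complex. (cmod z)\<^sup>2) -` {..a} = {}"
      using False by (auto simp: not_le dest: order.trans[OF zero_le_power2])
    then show ?thesis using False by simp
  qed
  also have "\<dots> = emeasure ?N X"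
  proof -
    have "emeasure ?N X = (\<integral>\<^sup>+r. ennreal pi * indicator {0..a} r \<partial>lborel)"
      unfolding X by (subst emeasure_density) (auto intro!: nn_integral_cong simp: indicator_def)
    also have "\<dots> = ennreal (pi * max 0 a)"
      by (cases "a \<ge> 0") (auto simp: ennreal_mult nn_integral_cmult)
    finally show ?thesis ..
  qed
  finally show "emeasure ?M X = emeasure ?N X" .
next
  show "emeasure ?M {..real i} \<noteq> \<infinity>" for i
  proof -
    have "(\<lambda>z::complex. (cmod z)\<^sup>2) -` {..real i} = cball 0 (sqrt (real i))"
      by (auto simp: real_le_rsqrt sqrt_ge_absD)
    then show ?thesis by (subst emeasure_distr) (auto simp: emeasure_cball)
  qed
  show "(\<Union>i. {..real i}) = UNIV" by (auto intro: real_arch_simple)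
qed auto

lemma nn_integral_radial:
  assumes [measurable]: "g \<in> borel_measurable borel"
  shows "(\<integral>\<^sup>+z. g ((cmod z)\<^sup>2) \<partial>lborel) = ennreal pi * (\<integral>\<^sup>+r. g r * indicator {0..} r \<partial>lborel)"
proof -
  have "(\<integral>\<^sup>+z. g ((cmod z)\<^sup>2) \<partial>lborel) = (\<integral>\<^sup>+r. g r \<partial>distr lborel borel (\<lambda>z. (cmod z)\<^sup>2))"
    by (subst nn_integral_distr) auto
  also have "\<dots> = (\<integral>\<^sup>+r. ennreal pi * (g r * indicator {0..} r) \<partial>lborel)"
    unfolding distr_norm_squared
    by (subst nn_integral_density) (auto intro!: nn_integral_cong simp: indicator_def)
  finally show ?thesis by (simp add: nn_integral_cmult)
qed

lemma nn_integral_power_exp: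
  assumes a: "a > (0::real)"
  shows "(\<integral>\<^sup>+x. ennreal (x^k * exp (- a * x)) * indicator {0..} x \<partial>lborel) = ennreal (fact k / a^(k+1))"
proof -
  have "ennreal (fact k) = (\<integral>\<^sup>+x. ennreal (x^k * exp (-x)) * indicator {0 ..} x \<partial>lborel)"
    by (subst nn_intergal_power_times_exp_Ici) (simp add: ennreal_of_nat_eq_real_of_nat)
  also have "\<dots> = ennreal a * (\<integral>\<^sup>+x. ennreal ((a*x)^k * exp (-(a*x))) * indicator {0 ..} (a*x) \<partial>lborel)"
    using a by (subst nn_integral_real_affine[where c=a and t=0]) auto
  also have "(\<lambda>x. ennreal ((a*x)^k * exp (-(a*x))) * indicator {0 ..} (a*x))
     = (\<lambda>x. ennreal (a^k) * (ennreal (x^k * exp (- a * x)) * indicator {0..} x))"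
    using a by (auto simp: fun_eq_iff indicator_def power_mult_distrib ennreal_mult[symmetric] zero_le_mult_iff mult_ac)
  also have "(\<integral>\<^sup>+x. \<dots> x \<partial>lborel) = ennreal (a^k) * (\<integral>\<^sup>+x. ennreal (x^k * exp (- a * x)) * indicator {0..} x \<partial>lborel)"
    by (rule nn_integral_cmult) simp
  finally have *: "ennreal (fact k) = ennreal (a^(k+1)) * (\<integral>\<^sup>+x. ennreal (x^k * exp (- a * x)) * indicator {0..} x \<partial>lborel)"
    (is "_ = _ * ?I") using a by (simp add: ennreal_mult mult.assoc)
  have "ennreal (fact k / a^(k+1)) = ennreal (1 / a^(k+1)) * (ennreal (a^(k+1)) * ?I)"
    unfolding *[symmetric] using a by (simp add: ennreal_mult[symmetric] del: power_Suc)
  also have "\<dots> = ?I"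
    using a by (simp add: mult.assoc[symmetric] ennreal_mult[symmetric] del: power_Suc)
  finally show ?thesis ..
qed

text \<open>The Beta integral over the half line. Writing \<open>(1+x)\<^bsup>-N-2\<^esup>\<close> as a Gamma integral in a second
  variable and integrating in the other order leaves two Gamma integrals.\<close>

lemma nn_integral_beta:
  assumes b: "b \<le> N"
  shows "(\<integral>\<^sup>+x. ennreal (x^b / (1+x)^(N+2)) * indicator {0..} x \<partial>lborel)
       = ennreal (fact b * fact (N-b) / fact (N+1))"
proof -
  let ?F = "\<lambda>x s. ennreal (x^b * s^(N+1) * exp (- (1+x) * s)) * indicator {0..} x * indicator {0..} s"
  have 1: "(\<integral>\<^sup>+s. ?F x s \<partial>lborel) = ennreal (fact (N+1)) * (ennreal (x^b / (1+x)^(N+2)) * indicator {0..} x)" for x :: real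
  proof (cases "x \<ge> 0")
    case True
    have "(\<integral>\<^sup>+s. ?F x s \<partial>lborel) = (\<integral>\<^sup>+s. ennreal (x^b) * (ennreal (s^(N+1) * exp (- (1+x) * s)) * indicator {0..} s) \<partial>lborel)"
      using True by (auto intro!: nn_integral_cong simp: indicator_def ennreal_mult[symmetric] mult_ac)
    also have "\<dots> = ennreal (x^b) * ennreal (fact (N+1) / (1+x)^(N+1+1))"
      using True by (subst nn_integral_cmult, simp, subst nn_integral_power_exp) auto
    finally show ?thesis using True by (simp add: ennreal_mult[symmetric] mult_ac)
  qed simp
  have 2: "(\<integral>\<^sup>+x. ?F x s \<partial>lborel) = ennreal (fact b) * (ennreal (s^(N-b) * exp (- 1 * s)) * indicator {0..} s)" if "s \<noteq> 0" for s :: real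
  proof (cases "s \<ge> 0")
    case True
    with that have s: "s > 0" by simp
    have "(\<integral>\<^sup>+x. ?F x s \<partial>lborel) = (\<integral>\<^sup>+x. ennreal (s^(N+1) * exp (-s)) * (ennreal (x^b * exp (- s * x)) * indicator {0..} x) \<partial>lborel)"
      using s by (auto intro!: nn_integral_cong simp: indicator_def ennreal_mult[symmetric] mult_ac algebra_simps exp_diff exp_minus exp_add field_simps)
    also have "\<dots> = ennreal (s^(N+1) * exp (-s)) * ennreal (fact b / s^(b+1))"
      using s by (subst nn_integral_cmult, simp, subst nn_integral_power_exp) auto
    also have "\<dots> = ennreal (s^(N+1) * exp (-s) * (fact b / s^(b+1)))"
      using s by (simp add: ennreal_mult[symmetric])
    also have "s^(N+1) * exp (-s) * (fact b / s^(b+1)) = fact b * (s^(N-b) * exp (- 1 * s))"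
    proof -
      have "s^(N+1) = s^(N-b) * s^(b+1)" using b by (simp add: power_add[symmetric])
      then show ?thesis using s by (simp del: power_Suc)
    qed
    finally show ?thesis using s by (simp add: ennreal_mult[symmetric] mult_ac)
  qed simp
  have "ennreal (fact (N+1)) * (\<integral>\<^sup>+x. ennreal (x^b / (1+x)^(N+2)) * indicator {0..} x \<partial>lborel)
      = (\<integral>\<^sup>+x. \<integral>\<^sup>+s. ?F x s \<partial>lborel \<partial>lborel)"
    unfolding 1 by (subst nn_integral_cmult) auto
  also have "\<dots> = (\<integral>\<^sup>+s. \<integral>\<^sup>+x. ?F x s \<partial>lborel \<partial>lborel)"
    by (rule lborel_pair.Fubini'[symmetric]) simp
  also have "\<dots> = (\<integral>\<^sup>+s. ennreal (fact b) * (ennreal (s^(N-b) * exp (- 1 * s)) * indicator {0..} s) \<partial>lborel)"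
    by (rule nn_integral_cong_AE, rule AE_mp[OF AE_lborel_singleton[of 0]]) (use 2 in auto)
  also have "\<dots> = ennreal (fact b) * ennreal (fact (N-b) / 1^(N-b+1))"
    by (subst nn_integral_cmult, simp, subst nn_integral_power_exp) auto
  finally have *: "ennreal (fact (N+1)) * (\<integral>\<^sup>+x. ennreal (x^b / (1+x)^(N+2)) * indicator {0..} x \<partial>lborel) = ennreal (fact b * fact (N-b))"
    (is "_ * ?I = _") by (simp add: ennreal_mult)
  have "?I = ennreal (1 / fact (N+1)) * (ennreal (fact (N+1)) * ?I)"
    by (simp add: mult.assoc[symmetric] ennreal_mult[symmetric] del: fact_Suc)
  also have "\<dots> = ennreal (fact b * fact (N-b) / fact (N+1))"
    unfolding * by (simp add: ennreal_mult[symmetric] del: fact_Suc)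
  finally show ?thesis .
qed

section \<open>A weighted L2 space of entire functions of two variables\<close>

lemma nn_integral_pair:
  fixes f :: "complex \<times> complex \<Rightarrow> ennreal"
  assumes [measurable]: "f \<in> borel_measurable borel"
  shows "(\<integral>\<^sup>+p. f p \<partial>lborel) = (\<integral>\<^sup>+t. \<integral>\<^sup>+z. f (z,t) \<partial>lborel \<partial>lborel)"
    and "(\<integral>\<^sup>+p. f p \<partial>lborel) = (\<integral>\<^sup>+z. \<integral>\<^sup>+t. f (z,t) \<partial>lborel \<partial>lborel)"
proof -
  have f: "f \<in> borel_measurable (lborel \<Otimes>\<^sub>M lborel)" unfolding lborel_prod by simp
  show "(\<integral>\<^sup>+p. f p \<partial>lborel) = (\<integral>\<^sup>+z. \<integral>\<^sup>+t. f (z,t) \<partial>lborel \<partial>lborel)"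
    unfolding lborel.nn_integral_fst[OF f] by (simp add: lborel_prod)
  then show "(\<integral>\<^sup>+p. f p \<partial>lborel) = (\<integral>\<^sup>+t. \<integral>\<^sup>+z. f (z,t) \<partial>lborel \<partial>lborel)"
    unfolding lborel_pair.Fubini[OF f] .
qed

lemma lborel_rotate_pair:
  fixes a b :: complex
  assumes "cmod a = 1" "cmod b = 1"
  shows "distr lborel borel (\<lambda>p. (a * fst p, b * snd p)) = (lborel :: (complex \<times> complex) measure)"
proof (rule measure_eqI)
  have [measurable]: "(\<lambda>p. (a * fst p, b * snd p)) \<in> borel_measurable borel"
    by (intro borel_measurable_continuous_onI continuous_intros)
  fix X assume "X \<in> sets (distr lborel borel (\<lambda>p. (a * fst p, b * snd p)))"
  then have [measurable]: "X \<in> sets (borel :: (complex \<times> complex) measure)" by simp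
  have [measurable]: "(\<lambda>t. (z, t)) \<in> borel_measurable borel" "(\<lambda>t. (t, z)) \<in> borel_measurable borel" for z :: complex
    by (intro borel_measurable_continuous_onI continuous_intros)+
  have i: "(\<lambda>p. indicator X p :: ennreal) \<in> borel_measurable (lborel \<Otimes>\<^sub>M lborel)" unfolding lborel_prod by simp
  have [measurable]: "(\<lambda>z. \<integral>\<^sup>+t. indicator X (z, t) \<partial>lborel) \<in> borel_measurable borel"
    using lborel.borel_measurable_nn_integral_fst[OF i] by simp
  have "emeasure (distr lborel borel (\<lambda>p. (a * fst p, b * snd p))) X
      = (\<integral>\<^sup>+p. indicator X (a * fst p, b * snd p) \<partial>lborel)"
    by (subst nn_integral_indicator[symmetric], simp, subst nn_integral_distr) auto
  also have "\<dots> = (\<integral>\<^sup>+z. \<integral>\<^sup>+t. indicator X (a * z, b * t) \<partial>lborel \<partial>lborel)"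
    by (subst nn_integral_pair(2)) auto
  also have "\<dots> = (\<integral>\<^sup>+z. \<integral>\<^sup>+t. indicator X (a * z, t) \<partial>lborel \<partial>lborel)"
    using assms by (subst nn_integral_rotation[where c=b and f="\<lambda>t. indicator X (_, t)"]) auto
  also have "\<dots> = (\<integral>\<^sup>+z. \<integral>\<^sup>+t. indicator X (z, t) \<partial>lborel \<partial>lborel)"
    using assms by (subst nn_integral_rotation[where c=a and f="\<lambda>z. (\<integral>\<^sup>+t. indicator X (z, t) \<partial>lborel)"]) auto
  also have "\<dots> = emeasure lborel X"
    by (subst nn_integral_pair(2)[symmetric]) auto
  finally show "emeasure (distr lborel borel (\<lambda>p. (a * fst p, b * snd p))) X = emeasure lborel X" .
qed simp

lemma integral_rotate_pair:
  fixes F :: "complex \<times> complex \<Rightarrow> complex"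
  assumes "cmod a = 1" "cmod b = 1" and [measurable]: "F \<in> borel_measurable borel"
  shows "(\<integral>p. F (a * fst p, b * snd p) \<partial>lborel) = (\<integral>p. F p \<partial>lborel)"
    and "integrable lborel F \<Longrightarrow> integrable lborel (\<lambda>p. F (a * fst p, b * snd p))"
proof -
  have [measurable]: "(\<lambda>p. (a * fst p, b * snd p)) \<in> borel_measurable borel"
    by (intro borel_measurable_continuous_onI continuous_intros)
  show "(\<integral>p. F (a * fst p, b * snd p) \<partial>lborel) = (\<integral>p. F p \<partial>lborel)"
    by (subst lborel_rotate_pair[OF assms(1,2), symmetric], subst integral_distr) auto
  show "integrable lborel F \<Longrightarrow> integrable lborel (\<lambda>p. F (a * fst p, b * snd p))"
    by (subst (asm) lborel_rotate_pair[OF assms(1,2), symmetric], subst (asm) integrable_distr_eq) auto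
qed

text \<open>The weight \<open>exp (- m \<phi>)\<close> in the coordinates of a chart; \<open>fibre_weight_potential\<close> below makes the link.\<close>

definition fibre_weight :: "nat \<Rightarrow> complex \<Rightarrow> complex \<Rightarrow> real" where
  "fibre_weight m z t = exp (- real m * (cmod z)\<^sup>2 * (1 + (cmod t)\<^sup>2)) / (1 + (cmod t)\<^sup>2) ^ m"

text \<open>The second factor is the density of \<open>\<omega>\<^sup>2/2\<close> with respect to Lebesgue measure.\<close>

definition l2_weight :: "nat \<Rightarrow> complex \<times> complex \<Rightarrow> real" where
  "l2_weight m p = fibre_weight m (fst p) (snd p)
     * (((cmod (fst p))\<^sup>2 + 1 / (1 + (cmod (snd p))\<^sup>2)) / pi\<^sup>2)"

lemma fibre_weight_pos: "fibre_weight m z t > 0"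
  by (simp add: fibre_weight_def one_plus_square_pos)

lemma l2_weight_nonneg: "l2_weight m p \<ge> 0"
  by (simp add: l2_weight_def fibre_weight_pos less_imp_le)

lemma l2_weight_continuous: "continuous_on S (l2_weight m)"
  unfolding l2_weight_def fibre_weight_def
  by (intro continuous_intros) (auto simp: one_plus_square_pos)

lemma l2_weight_measurable[measurable]: "l2_weight m \<in> borel_measurable borel"
  by (rule borel_measurable_continuous_onI[OF l2_weight_continuous])

definition monom2 :: "nat \<times> nat \<Rightarrow> complex \<times> complex \<Rightarrow> complex" where
  "monom2 i p = fst p ^ fst i * snd p ^ snd i"

text \<open>The squared norm of the monomial \<open>z\<^sup>j t\<^sup>b\<close>, where \<open>i = (j, b)\<close> and \<open>b \<le> j + m\<close>.\<close>

definition monom_sq :: "nat \<Rightarrow> nat \<times> nat \<Rightarrow> real" where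
  "monom_sq m i = fact (fst i) * fact (snd i) * fact (fst i + m - snd i) / (real m ^ (fst i + 2) * fact (fst i + m))"

text \<open>The bound on the second exponent is the condition for the monomial to be square integrable.\<close>

definition monom_index :: "nat \<Rightarrow> nat \<Rightarrow> (nat \<times> nat) set" where
  "monom_index m N = Sigma {..N} (\<lambda>j. {..j + m})"

lemma finite_monom_index[simp]: "finite (monom_index m N)"
  by (simp add: monom_index_def)

lemma monom_sq_pos: "m \<ge> 1 \<Longrightarrow> monom_sq m i > 0"
  by (simp add: monom_sq_def)

lemma monom2_continuous: "continuous_on S (monom2 i)"
  unfolding monom2_def by (intro continuous_intros)

lemma monom2_measurable[measurable]: "monom2 i \<in> borel_measurable borel"
  by (rule borel_measurable_continuous_onI[OF monom2_continuous])

text \<open>In polar coordinates the integral over \<open>z\<close> is a sum of two Gamma integrals, which combine to a multiple of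
  \<open>|t|\<^sup>2\<^sup>b (1 + |t|\<^sup>2)\<^bsup>-j-m-2\<^esup>\<close>; the integral over \<open>t\<close> is then a Beta integral.\<close>

lemma nn_integral_monom:
  assumes m: "m \<ge> 1" and b: "b \<le> j + m"
  shows "(\<integral>\<^sup>+p. ennreal ((cmod (monom2 (j,b) p))\<^sup>2 * l2_weight m p) \<partial>lborel) = ennreal (monom_sq m (j,b))"
proof -
  have inner: "(\<integral>\<^sup>+z. ennreal ((cmod (monom2 (j,b) (z,t)))\<^sup>2 * l2_weight m (z,t)) \<partial>lborel)
     = ennreal (fact j * (real j + real m + 1) / (pi * real m^(j+2)) * (((cmod t)\<^sup>2)^b / (1 + (cmod t)\<^sup>2)^(j+m+2)))" for t
  proof -
    define q where "q = (cmod t)\<^sup>2"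
    have q: "q \<ge> 0" "1 + q > 0" by (auto simp: q_def one_plus_square_pos)
    define al where "al = real m * (1 + q)"
    have al: "al > 0" using m q by (simp add: al_def)
    define C where "C = q^b / ((1+q)^m * pi\<^sup>2)"
    have C: "C \<ge> 0" using q by (simp add: C_def)
    have "(\<integral>\<^sup>+z. ennreal ((cmod (monom2 (j,b) (z,t)))\<^sup>2 * l2_weight m (z,t)) \<partial>lborel)
      = (\<integral>\<^sup>+z. ennreal (C * (((cmod z)\<^sup>2)^(j+1) * exp (- al * (cmod z)\<^sup>2))
            + C / (1+q) * (((cmod z)\<^sup>2)^j * exp (- al * (cmod z)\<^sup>2))) \<partial>lborel)"
    proof (intro nn_integral_cong arg_cong[where f=ennreal])
      fix z
      have mon: "(cmod (monom2 (j,b) (z,t)))\<^sup>2 = ((cmod z)\<^sup>2)^j * q^b"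
        by (simp add: monom2_def norm_mult norm_power power_mult_distrib q_def power_mult[symmetric] mult.commute)
      have "(R^j * B) * (E / Y * ((R + 1 / X) / P)) = B / (Y * P) * (R^(j+1) * E) + B / (Y * P) / X * (R^j * E)"
        if "X \<noteq> 0" "Y \<noteq> 0" "P \<noteq> 0" for R E X Y P B :: real
        using that by (simp add: field_simps)
      from this[of "1+q" "(1+q)^m" "pi\<^sup>2"] q
      have alg: "(R^j * q^b) * (E / (1+q)^m * ((R + 1 / (1+q)) / pi\<^sup>2)) = C * (R^(j+1) * E) + C / (1+q) * (R^j * E)" for R E
        unfolding C_def by auto
      have "exp (- real m * (cmod z)\<^sup>2 * (1 + q)) = exp (- al * (cmod z)\<^sup>2)" by (simp add: al_def mult_ac)
      with alg[of "(cmod z)\<^sup>2" "exp (- al * (cmod z)\<^sup>2)"] show "(cmod (monom2 (j,b) (z,t)))\<^sup>2 * l2_weight m (z,t)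
          = C * (((cmod z)\<^sup>2)^(j+1) * exp (- al * (cmod z)\<^sup>2)) + C / (1+q) * (((cmod z)\<^sup>2)^j * exp (- al * (cmod z)\<^sup>2))"
        by (simp only: mon l2_weight_def fibre_weight_def fst_conv snd_conv q_def[symmetric])
    qed
    also have "\<dots> = ennreal pi * (\<integral>\<^sup>+r. ennreal (C * (r^(j+1) * exp (- al * r)) + C / (1+q) * (r^j * exp (- al * r))) * indicator {0..} r \<partial>lborel)"
      by (subst nn_integral_radial[where g="\<lambda>r. ennreal (C * (r^(j+1) * exp (- al * r)) + C / (1+q) * (r^j * exp (- al * r)))", symmetric]) auto
    also have "(\<integral>\<^sup>+r. ennreal (C * (r^(j+1) * exp (- al * r)) + C / (1+q) * (r^j * exp (- al * r))) * indicator {0..} r \<partial>lborel)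
       = (\<integral>\<^sup>+r. ennreal C * (ennreal (r^(j+1) * exp (- al * r)) * indicator {0..} r)
            + ennreal (C / (1+q)) * (ennreal (r^j * exp (- al * r)) * indicator {0..} r) \<partial>lborel)"
      using C q by (intro nn_integral_cong) (auto simp: indicator_def ennreal_mult[symmetric] ennreal_plus[symmetric] simp del: ennreal_plus)
    also have "\<dots> = ennreal C * ennreal (fact (j+1) / al^(j+1+1)) + ennreal (C / (1+q)) * ennreal (fact j / al^(j+1))"
      by (subst nn_integral_add, simp, simp, subst nn_integral_cmult, simp, subst nn_integral_cmult, simp)
         (simp only: nn_integral_power_exp[OF al])
    also have "\<dots> = ennreal (C * (fact (j+1) / al^(j+1+1)) + C / (1+q) * (fact j / al^(j+1)))"
      using C al q by (simp add: ennreal_mult[symmetric] ennreal_plus[symmetric] del: ennreal_plus fact_Suc power_Suc)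
    also have "ennreal pi * \<dots> = ennreal (pi * (C * (fact (j+1) / al^(j+1+1)) + C / (1+q) * (fact j / al^(j+1))))"
      using C al q by (subst ennreal_mult) auto
    also have "pi * (C * (fact (j+1) / al^(j+1+1)) + C / (1+q) * (fact j / al^(j+1)))
        = fact j * (real j + real m + 1) / (pi * real m^(j+2)) * (q^b / (1 + q)^(j+m+2))"
    proof -
      have "C * (fact (j+1) / al^(j+1+1)) + C / (1+q) * (fact j / al^(j+1))
          = C * fact j * (real (j+1) / al^(j+2) + al / ((1+q) * al^(j+2)))"
      proof -
        have "al^(j+1) \<noteq> 0" "al^(j+1+1) = al * al^(j+1)" "al^(j+2) = al * al^(j+1)" using al by simp_all
        then have "\<exists>D. D \<noteq> 0 \<and> al^(j+1) = D \<and> al^(j+1+1) = al * D \<and> al^(j+2) = al * D" by blast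
        then obtain D where D: "D \<noteq> 0" "al^(j+1) = D" "al^(j+1+1) = al * D" "al^(j+2) = al * D" by blast
        show ?thesis unfolding D(2-4) using D(1) al q by (simp add: distrib_left) (simp add: algebra_simps)
      qed
      also have "al / ((1+q) * al^(j+2)) = m / al^(j+2)"
        using al q by (simp add: al_def)
      also have "real (j+1) / al^(j+2) + m / al^(j+2) = (real j + real m + 1) / al^(j+2)"
        by (simp add: add_divide_distrib)
      finally have "C * (fact (j+1) / al^(j+1+1)) + C / (1+q) * (fact j / al^(j+1)) = C * fact j * ((real j + real m + 1) / al^(j+2))" .
      moreover have "(1 + q)^(j+m+2) = (1+q)^m * (1+q)^(j+2)" by (simp add: power_add[symmetric] add_ac)
      moreover have "al^(j+2) = real m^(j+2) * (1+q)^(j+2)" by (simp add: al_def power_mult_distrib)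
      moreover have "pi * (x / (A * pi\<^sup>2) * F * (J / (M * B))) = F * J / (pi * M) * (x / (A * B))" for x A F J M B :: real
        by (simp add: power2_eq_square) (simp add: mult_ac)
      ultimately show ?thesis unfolding C_def by (simp only:)
    qed
    finally show ?thesis unfolding q_def .
  qed
  have "(\<integral>\<^sup>+p. ennreal ((cmod (monom2 (j,b) p))\<^sup>2 * l2_weight m p) \<partial>lborel)
     = (\<integral>\<^sup>+t. ennreal (fact j * (real j + real m + 1) / (pi * real m^(j+2)) * (((cmod t)\<^sup>2)^b / (1 + (cmod t)\<^sup>2)^(j+m+2))) \<partial>lborel)"
    by (subst nn_integral_pair(1)) (simp_all add: inner)
  also have "\<dots> = ennreal pi * (\<integral>\<^sup>+r. ennreal (fact j * (real j + real m + 1) / (pi * real m^(j+2)) * (r^b / (1 + r)^(j+m+2))) * indicator {0..} r \<partial>lborel)"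
    by (subst nn_integral_radial[where g="\<lambda>r. ennreal (fact j * (real j + real m + 1) / (pi * real m^(j+2)) * (r^b / (1 + r)^(j+m+2)))", symmetric]) auto
  also have "(\<integral>\<^sup>+r. ennreal (fact j * (real j + real m + 1) / (pi * real m^(j+2)) * (r^b / (1 + r)^(j+m+2))) * indicator {0..} r \<partial>lborel)
     = (\<integral>\<^sup>+r. ennreal (fact j * (real j + real m + 1) / (pi * real m^(j+2))) * (ennreal (r^b / (1 + r)^(j+m+2)) * indicator {0..} r) \<partial>lborel)"
    using m by (intro nn_integral_cong) (auto simp: indicator_def ennreal_mult[symmetric])
  also have "\<dots> = ennreal (fact j * (real j + real m + 1) / (pi * real m^(j+2))) * ennreal (fact b * fact (j+m-b) / fact (j+m+1))"
    by (subst nn_integral_cmult, simp, subst nn_integral_beta[OF b]) simp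
  also have "ennreal pi * \<dots> = ennreal (pi * (fact j * (real j + real m + 1) / (pi * real m^(j+2)) * (fact b * fact (j+m-b) / fact (j+m+1))))"
    by (simp add: ennreal_mult[symmetric] del: fact_Suc)
  also have "pi * (fact j * (real j + real m + 1) / (pi * real m^(j+2)) * (fact b * fact (j+m-b) / fact (j+m+1))) = monom_sq m (j,b)"
  proof -
    have F: "fact (j+m+1) = (real j + real m + 1) * fact (j+m)" by (simp add: algebra_simps)
    have "pi * (A * J / (pi * M) * (B / (J * F))) = A * B / (M * F)" if "J \<noteq> 0" for A J M B F :: real
      using that by simp
    from this[of "real j + real m + 1"] show ?thesis
      unfolding F monom_sq_def by (auto simp: mult_ac)
  qed
  finally show ?thesis .
qed

definition l2_fun :: "nat \<Rightarrow> (complex \<times> complex \<Rightarrow> complex) \<Rightarrow> bool" where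
  "l2_fun m f \<longleftrightarrow> continuous_on UNIV f \<and> integrable lborel (\<lambda>p. (cmod (f p))\<^sup>2 * l2_weight m p)"

definition l2_ip :: "nat \<Rightarrow> (complex \<times> complex \<Rightarrow> complex) \<Rightarrow> (complex \<times> complex \<Rightarrow> complex) \<Rightarrow> complex" where
  "l2_ip m f g = (\<integral>p. f p * cnj (g p) * of_real (l2_weight m p) \<partial>lborel)"

lemma cmod_prod_le: "cmod (a * cnj b) \<le> (cmod a)\<^sup>2 + (cmod b)\<^sup>2"
proof -
  have "0 \<le> (cmod a - cmod b)\<^sup>2" by simp
  then have "2 * (cmod a * cmod b) \<le> (cmod a)\<^sup>2 + (cmod b)\<^sup>2" by (simp add: power2_diff)
  moreover have "0 \<le> cmod a * cmod b" by simp
  moreover have "cmod (a * cnj b) = cmod a * cmod b" by (simp add: norm_mult)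
  ultimately show ?thesis by linarith
qed

lemma l2_ip_integrable:
  assumes "l2_fun m f" "l2_fun m g"
  shows "integrable lborel (\<lambda>p. f p * cnj (g p) * of_real (l2_weight m p))"
proof (rule Bochner_Integration.integrable_bound)
  show "integrable lborel (\<lambda>p. (cmod (f p))\<^sup>2 * l2_weight m p + (cmod (g p))\<^sup>2 * l2_weight m p)"
    using assms by (simp add: l2_fun_def)
  have [measurable]: "f \<in> borel_measurable borel" "g \<in> borel_measurable borel"
    using assms by (auto simp: l2_fun_def intro: borel_measurable_continuous_onI)
  have "(\<lambda>p. f p * cnj (g p) * of_real (l2_weight m p)) \<in> borel_measurable borel"
    using assms by (intro borel_measurable_continuous_onI continuous_intros l2_weight_continuous) (auto simp: l2_fun_def)
  then show "(\<lambda>p. f p * cnj (g p) * of_real (l2_weight m p)) \<in> borel_measurable lborel" by simp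
  show "AE p in lborel. norm (f p * cnj (g p) * of_real (l2_weight m p))
       \<le> norm ((cmod (f p))\<^sup>2 * l2_weight m p + (cmod (g p))\<^sup>2 * l2_weight m p)"
  proof (rule AE_I2)
    fix p
    have "norm (f p * cnj (g p) * of_real (l2_weight m p)) = cmod (f p * cnj (g p)) * l2_weight m p"
      by (simp add: norm_mult l2_weight_nonneg)
    also have "\<dots> \<le> ((cmod (f p))\<^sup>2 + (cmod (g p))\<^sup>2) * l2_weight m p"
      by (intro mult_right_mono cmod_prod_le l2_weight_nonneg)
    finally show "norm (f p * cnj (g p) * of_real (l2_weight m p))
       \<le> norm ((cmod (f p))\<^sup>2 * l2_weight m p + (cmod (g p))\<^sup>2 * l2_weight m p)"
      by (simp add: distrib_right l2_weight_nonneg)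
  qed
qed

lemma l2_ip_self: "l2_ip m f f = of_real (\<integral>p. (cmod (f p))\<^sup>2 * l2_weight m p \<partial>lborel)"
  unfolding l2_ip_def
  by (subst integral_complex_of_real[symmetric]) (simp add: complex_norm_square[symmetric])

lemma l2_fun_add:
  assumes "l2_fun m f" "l2_fun m g" shows "l2_fun m (\<lambda>p. f p + g p)"
proof -
  have c: "continuous_on UNIV (\<lambda>p. f p + g p)" using assms by (auto simp: l2_fun_def intro!: continuous_intros)
  have "integrable lborel (\<lambda>p. (cmod (f p + g p))\<^sup>2 * l2_weight m p)"
  proof (rule Bochner_Integration.integrable_bound)
    show "integrable lborel (\<lambda>p. 2 * ((cmod (f p))\<^sup>2 * l2_weight m p) + 2 * ((cmod (g p))\<^sup>2 * l2_weight m p))"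
      using assms by (simp add: l2_fun_def)
    have "(\<lambda>p. (cmod (f p + g p))\<^sup>2 * l2_weight m p) \<in> borel_measurable borel"
      by (intro borel_measurable_continuous_onI continuous_on_mult continuous_on_power continuous_on_norm c l2_weight_continuous)
    then show "(\<lambda>p. (cmod (f p + g p))\<^sup>2 * l2_weight m p) \<in> borel_measurable lborel" by simp
    show "AE p in lborel. norm ((cmod (f p + g p))\<^sup>2 * l2_weight m p)
       \<le> norm (2 * ((cmod (f p))\<^sup>2 * l2_weight m p) + 2 * ((cmod (g p))\<^sup>2 * l2_weight m p))"
    proof (rule AE_I2)
      fix p
      have "(cmod (f p + g p))\<^sup>2 \<le> (cmod (f p) + cmod (g p))\<^sup>2"
        by (intro power_mono norm_triangle_ineq) simp
      also have "\<dots> \<le> 2 * (cmod (f p))\<^sup>2 + 2 * (cmod (g p))\<^sup>2"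
        using zero_le_power2[of "cmod (f p) - cmod (g p)"] by (simp add: power2_sum power2_diff)
      finally have "(cmod (f p + g p))\<^sup>2 * l2_weight m p \<le> (2 * (cmod (f p))\<^sup>2 + 2 * (cmod (g p))\<^sup>2) * l2_weight m p"
        by (intro mult_right_mono l2_weight_nonneg)
      then show "norm ((cmod (f p + g p))\<^sup>2 * l2_weight m p)
       \<le> norm (2 * ((cmod (f p))\<^sup>2 * l2_weight m p) + 2 * ((cmod (g p))\<^sup>2 * l2_weight m p))"
        by (simp add: algebra_simps l2_weight_nonneg)
    qed
  qed
  with c show ?thesis by (simp add: l2_fun_def)
qed

lemma l2_fun_scale: "l2_fun m f \<Longrightarrow> l2_fun m (\<lambda>p. c * f p)"
  by (auto simp: l2_fun_def norm_mult power_mult_distrib mult.assoc intro: continuous_intros)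

lemma l2_fun_zero: "l2_fun m (\<lambda>p. 0)"
  by (simp add: l2_fun_def)

lemma l2_fun_sum: "finite I \<Longrightarrow> (\<And>i. i \<in> I \<Longrightarrow> l2_fun m (f i)) \<Longrightarrow> l2_fun m (\<lambda>p. \<Sum>i\<in>I. c i * f i p)"
  by (induction I rule: finite_induct) (auto intro!: l2_fun_add l2_fun_scale l2_fun_zero)

lemma l2_ip_sum_left:
  assumes "finite I" "\<And>i. i \<in> I \<Longrightarrow> l2_fun m (f i)" "l2_fun m g"
  shows "l2_ip m (\<lambda>p. \<Sum>i\<in>I. c i * f i p) g = (\<Sum>i\<in>I. c i * l2_ip m (f i) g)"
proof -
  have "l2_ip m (\<lambda>p. \<Sum>i\<in>I. c i * f i p) g = (\<integral>p. (\<Sum>i\<in>I. c i * (f i p * cnj (g p) * of_real (l2_weight m p))) \<partial>lborel)"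
    unfolding l2_ip_def by (simp add: sum_distrib_right mult.assoc)
  also have "\<dots> = (\<Sum>i\<in>I. \<integral>p. c i * (f i p * cnj (g p) * of_real (l2_weight m p)) \<partial>lborel)"
    by (rule Bochner_Integration.integral_sum) (intro integrable_mult_right l2_ip_integrable assms)
  also have "\<dots> = (\<Sum>i\<in>I. c i * l2_ip m (f i) g)"
    unfolding l2_ip_def by simp
  finally show ?thesis .
qed

lemma l2_ip_commute: "l2_ip m g f = cnj (l2_ip m f g)"
proof -
  have "(\<lambda>p. g p * cnj (f p) * of_real (l2_weight m p)) = (\<lambda>p. cnj (f p * cnj (g p) * of_real (l2_weight m p)))"
    by (auto simp: mult_ac)
  then show ?thesis unfolding l2_ip_def by (simp only: Bochner_Integration.integral_cnj)
qed

lemma l2_fun_monom: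
  assumes "m \<ge> 1" "snd i \<le> fst i + m"
  shows "l2_fun m (monom2 i)"
  unfolding l2_fun_def
proof
  show "continuous_on UNIV (monom2 i)" by (rule monom2_continuous)
  obtain j b where i: "i = (j,b)" by (cases i)
  show "integrable lborel (\<lambda>p. (cmod (monom2 i p))\<^sup>2 * l2_weight m p)"
    using nn_integral_monom[of m b j] assms unfolding i
    by (intro integrableI_nonneg) (auto simp: l2_weight_nonneg)
qed

text \<open>Distinct monomials are orthogonal because some rotation of the coordinates multiplies their inner
  product by \<open>-1\<close>.\<close>

lemma l2_ip_monom:
  assumes m: "m \<ge> 1" and i: "snd i \<le> fst i + m" and k: "snd k \<le> fst k + m"
  shows "l2_ip m (monom2 i) (monom2 k) = (if i = k then of_real (monom_sq m i) else 0)"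
proof (cases "i = k")
  case True
  have "(\<integral>p. (cmod (monom2 i p))\<^sup>2 * l2_weight m p \<partial>lborel) = monom_sq m i"
    using nn_integral_monom[of m "snd i" "fst i"] m i monom_sq_pos[of m i]
    by (intro nn_integral_eq_integrable[THEN iffD1, THEN conjunct2]) (auto simp: l2_weight_nonneg less_imp_le)
  with True show ?thesis by (simp add: l2_ip_self)
next
  case False
  define a where "a = (if fst i = fst k then 1 else cis (pi / (real (fst i) - real (fst k))))"
  define b where "b = (if fst i = fst k then cis (pi / (real (snd i) - real (snd k))) else 1)"
  have ab: "cmod a = 1" "cmod b = 1" by (auto simp: a_def b_def)
  have cis: "cis (pi / (real x - real y)) ^ x * cnj (cis (pi / (real x - real y)) ^ y) = -1" if "x \<noteq> y" for x y
  proof -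
    have "cis (pi / (real x - real y)) ^ x * cnj (cis (pi / (real x - real y)) ^ y)
        = cis ((real x - real y) * (pi / (real x - real y)))"
      unfolding Complex.DeMoivre cis_cnj cis_mult
      by (rule arg_cong[where f=cis]) (simp add: algebra_simps diff_divide_distrib)
    also have "(real x - real y) * (pi / (real x - real y)) = pi" using that by simp
    finally show ?thesis by simp
  qed
  have unit: "x ^ n * cnj (x ^ n) = 1" if "cmod x = 1" for x :: complex and n
    using that by (simp add: power_mult_distrib[symmetric] complex_norm_square[symmetric])
  have minus: "a ^ fst i * cnj (a ^ fst k) * (b ^ snd i * cnj (b ^ snd k)) = -1"
  proof (cases "fst i = fst k")
    case True
    then have "snd i \<noteq> snd k" using False by (simp add: prod_eq_iff)
    with True cis[of "snd i" "snd k"] show ?thesis by (simp add: a_def b_def)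
  next
    case False
    with cis[of "fst i" "fst k"] show ?thesis by (simp add: a_def b_def)
  qed
  define F where "F = (\<lambda>p. monom2 i p * cnj (monom2 k p) * of_real (l2_weight m p))"
  have F: "F \<in> borel_measurable borel"
    unfolding F_def by (intro borel_measurable_continuous_onI continuous_intros l2_weight_continuous monom2_continuous)
  have w: "l2_weight m (a * fst p, b * snd p) = l2_weight m p" for p
    using ab by (simp add: l2_weight_def fibre_weight_def norm_mult)
  have "F (a * fst p, b * snd p) = - F p" for p
  proof -
    have "F (a * fst p, b * snd p) = (a ^ fst i * cnj (a ^ fst k) * (b ^ snd i * cnj (b ^ snd k))) * F p"
      unfolding F_def w by (simp add: monom2_def power_mult_distrib mult_ac)
    then show ?thesis unfolding minus by simp
  qed
  then have "(\<integral>p. F p \<partial>lborel) = - (\<integral>p. F p \<partial>lborel)"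
    using integral_rotate_pair(1)[OF ab F] by simp
  then have "(\<integral>p. F p \<partial>lborel) = 0" by simp
  with False show ?thesis by (simp add: l2_ip_def F_def)
qed

section \<open>Taylor coefficients as circle averages\<close>

definition circ :: "real \<Rightarrow> complex" where "circ s = exp (2 * of_real pi * \<i> * of_real s)"

lemma cmod_circ[simp]: "cmod (circ s) = 1"
  by (simp add: circ_def)

lemma circ_nonzero[simp]: "circ s \<noteq> 0"
  by (simp add: circ_def)

lemma circ_continuous[continuous_intros]: "continuous_on S f \<Longrightarrow> continuous_on S (\<lambda>x. circ (f x))"
  unfolding circ_def by (intro continuous_intros)

text \<open>The \<open>j\<close>-th Taylor coefficient at the origin of an entire function. As an average over the unit circle it
  depends well on parameters and can be compared with integrals over the plane by rotation invariance.\<close>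

definition circle_coeff :: "nat \<Rightarrow> (complex \<Rightarrow> complex) \<Rightarrow> complex" where
  "circle_coeff j g = integral {0..1} (\<lambda>s. g (circ s) / circ s ^ j)"

lemma circle_coeff_deriv:
  assumes g: "g holomorphic_on UNIV"
  shows "circle_coeff j g = (deriv ^^ j) g 0 / fact j"
proof -
  have "((\<lambda>u. g u / (u-0) ^ Suc j) has_contour_integral ((2 * pi * \<i>) / (fact j) * (deriv ^^ j) g 0)) (circlepath 0 1)"
    by (rule Cauchy_has_contour_integral_higher_derivative_circlepath)
       (auto intro: holomorphic_on_imp_continuous_on holomorphic_on_subset[OF g])
  then have "((\<lambda>s. g (circ s) / circ s ^ Suc j * (2 * pi * \<i> * circ s)) has_integral ((2 * pi * \<i>) / (fact j) * (deriv ^^ j) g 0)) {0..1}"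
    unfolding has_contour_integral vector_derivative_circlepath
    by (simp add: circlepath circ_def)
  then have "((\<lambda>s. (1 / (2 * pi * \<i>)) * (g (circ s) / circ s ^ Suc j * (2 * pi * \<i> * circ s))) has_integral
      (1 / (2 * pi * \<i>)) * ((2 * pi * \<i>) / (fact j) * (deriv ^^ j) g 0)) {0..1}"
    by (rule has_integral_mult_right)
  then have "((\<lambda>s. g (circ s) / circ s ^ j) has_integral ((deriv ^^ j) g 0 / fact j)) {0..1}"
    by simp
  then show ?thesis unfolding circle_coeff_def by (rule integral_unique)
qed

lemma holomorphic_on_UNIV_compose:
  assumes "g holomorphic_on UNIV" "a holomorphic_on UNIV"
  shows "(\<lambda>w. g (a w)) holomorphic_on UNIV"
  using holomorphic_on_compose_gen[OF assms(2,1)] by (simp add: o_def)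

lemma circle_coeff_dilate:
  assumes g: "g holomorphic_on UNIV"
  shows "circle_coeff j (\<lambda>w. g (z * w)) = circle_coeff j g * z ^ j"
proof -
  have "(\<lambda>w. g (z * w)) holomorphic_on UNIV"
    by (intro holomorphic_on_UNIV_compose[OF g] holomorphic_intros)
  then show ?thesis
    by (simp add: circle_coeff_deriv g higher_deriv_compose_linear[OF g open_UNIV open_UNIV])
qed

lemma circle_coeff_sums:
  assumes g: "g holomorphic_on UNIV"
  shows "(\<lambda>j. circle_coeff j g * z ^ j) sums g z"
  using holomorphic_power_series[of g 0 "cmod z + 1" z] g
  by (simp add: circle_coeff_deriv holomorphic_on_subset)

text \<open>Cauchy's formula for the derivative in the second variable makes that derivative jointly
  continuous, so one may differentiate under the integral sign.\<close>

lemma circle_coeff_holomorphic: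
  fixes f :: "complex \<Rightarrow> complex \<Rightarrow> complex"
  assumes cont: "continuous_on UNIV (\<lambda>p. f (fst p) (snd p))"
    and hol: "\<And>z. f z holomorphic_on UNIV"
  shows "(\<lambda>t. circle_coeff j (\<lambda>z. f z t)) holomorphic_on UNIV"
proof -
  have cf: "continuous_on S (\<lambda>x. f (a x) (b x))" if "continuous_on S a" "continuous_on S b" for S :: "'x::topological_space set" and a b
    using continuous_on_compose2[OF cont, of S "\<lambda>x. (a x, b x)"] that by (auto intro: continuous_intros)
  define D where "D z t = circle_coeff 1 (\<lambda>w. f z (t + w))" for z t
  have der: "(f z has_field_derivative D z t) (at t)" for z t
  proof -
    have "(\<lambda>w. f z (t + w)) holomorphic_on UNIV"
      by (intro holomorphic_on_UNIV_compose[OF hol] holomorphic_intros)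
    then have "D z t = deriv (\<lambda>w. f z (t + w)) 0"
      unfolding D_def by (simp add: circle_coeff_deriv)
    moreover have "((\<lambda>w. f z (t + w)) has_field_derivative deriv (f z) t) (at 0)"
      using holomorphic_derivI[OF hol open_UNIV UNIV_I, of z t]
      using DERIV_chain2[of "f z" "deriv (f z) t" "\<lambda>w. t + w" 0 "0 + 1", OF _ DERIV_add[OF DERIV_const DERIV_ident]]
      by simp
    ultimately have "D z t = deriv (f z) t" by (simp add: DERIV_imp_deriv)
    with holomorphic_derivI[OF hol open_UNIV UNIV_I, of z t] show ?thesis by simp
  qed
  have contD: "continuous_on UNIV (\<lambda>p. D (fst p) (snd p))"
    unfolding D_def circle_coeff_def box_real(2)[symmetric]
    by (rule integral_continuous_on_param) (auto simp: case_prod_beta intro!: continuous_intros cf)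
  have cD: "continuous_on S (\<lambda>x. D (a x) (b x))" if "continuous_on S a" "continuous_on S b" for S :: "'x::topological_space set" and a b
    using continuous_on_compose2[OF contD, of S "\<lambda>x. (a x, b x)"] that by (auto intro: continuous_intros)
  show ?thesis
    unfolding holomorphic_on_def field_differentiable_def
  proof
    fix t :: complex
    have "((\<lambda>t. integral (cbox 0 1) (\<lambda>s. f (circ s) t / circ s ^ j)) has_field_derivative
        integral (cbox 0 1) (\<lambda>s. D (circ s) t / circ s ^ j)) (at t within UNIV)"
    proof (rule leibniz_rule_field_derivative)
      show "((\<lambda>t. f (circ s) t / circ s ^ j) has_field_derivative D (circ s) t / circ s ^ j) (at t within UNIV)" for t s
        by (intro DERIV_cdivide der)
      show "(\<lambda>s. f (circ s) t / circ s ^ j) integrable_on cbox 0 1" for t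
        by (intro integrable_continuous continuous_intros cf) auto
      show "continuous_on (UNIV \<times> cbox 0 1) (\<lambda>(t, s). D (circ s) t / circ s ^ j)"
        unfolding case_prod_beta by (intro continuous_intros cD) auto
    qed auto
    then show "\<exists>f'. ((\<lambda>t. circle_coeff j (\<lambda>z. f z t)) has_field_derivative f') (at t within UNIV)"
      unfolding circle_coeff_def by auto
  qed
qed

text \<open>Average the rotation invariance of Lebesgue measure in the first variable over all rotations, and
  exchange the integrals.\<close>

lemma integral_circle_average:
  fixes F :: "complex \<times> complex \<Rightarrow> complex"
  assumes cont: "continuous_on UNIV F" and int: "integrable lborel F"
  shows "(\<integral>p. F p \<partial>lborel) = (\<integral>p. integral {0..1} (\<lambda>s. F (circ s * fst p, snd p)) \<partial>lborel)"
proof -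
  let ?G = "\<lambda>(s,p). indicator {0..1::real} s *\<^sub>R F (circ s * fst p, snd p)"
  have F[measurable]: "F \<in> borel_measurable borel" by (rule borel_measurable_continuous_onI[OF cont])
  have cF: "continuous_on S (\<lambda>x. F (a x, b x))" if "continuous_on S a" "continuous_on S b" for S :: "'x::topological_space set" and a b
    using continuous_on_compose2[OF cont, of S "\<lambda>x. (a x, b x)"] that by (auto intro: continuous_intros)
  have "(\<lambda>q. F (circ (fst q) * fst (snd q), snd (snd q))) \<in> borel_measurable (borel :: (real \<times> complex \<times> complex) measure)"
    by (intro borel_measurable_continuous_onI cF continuous_intros)
  then have [measurable]: "(\<lambda>q. F (circ (fst q) * fst (snd q), snd (snd q))) \<in> borel_measurable (lborel \<Otimes>\<^sub>M lborel)"
    unfolding lborel_prod by simp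
  have Gm: "?G \<in> borel_measurable (lborel \<Otimes>\<^sub>M lborel)"
    unfolding case_prod_beta by measurable
  have rot: "(\<integral>p. F (circ s * fst p, snd p) \<partial>lborel) = (\<integral>p. F p \<partial>lborel)"
      "integrable lborel (\<lambda>p. F (circ s * fst p, snd p))" for s
    using integral_rotate_pair[of "circ s" 1 F] int by simp_all
  have rotn: "(\<integral>p. cmod (F (circ s * fst p, snd p)) \<partial>lborel) = (\<integral>p. cmod (F p) \<partial>lborel)" for s
  proof -
    have "(\<integral>p. complex_of_real (cmod (F (circ s * fst p, snd p))) \<partial>lborel) = (\<integral>p. complex_of_real (cmod (F p)) \<partial>lborel)"
      using integral_rotate_pair(1)[of "circ s" 1 "\<lambda>p. complex_of_real (cmod (F p))"] by simp
    then show ?thesis by simp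
  qed
  have Gint: "integrable (lborel \<Otimes>\<^sub>M lborel) ?G"
  proof (rule lborel_pair.Fubini_integrable[OF Gm])
    have "(\<lambda>s. \<integral>p. norm (?G (s,p)) \<partial>lborel) = (\<lambda>s. indicator {0..1} s *\<^sub>R (\<integral>p. cmod (F p) \<partial>lborel))"
      by (simp add: rotn fun_eq_iff)
    then show "integrable lborel (\<lambda>s. \<integral>p. norm (?G (s,p)) \<partial>lborel)"
      by simp
    show "AE s in lborel. integrable lborel (\<lambda>p. ?G (s,p))"
      using rot(2) by simp
  qed
  have inner: "(\<integral>s. ?G (s,p) \<partial>lborel) = integral {0..1} (\<lambda>s. F (circ s * fst p, snd p))" for p
  proof -
    have "set_integrable lborel {0..1} (\<lambda>s. F (circ s * fst p, snd p))"
      by (intro borel_integrable_atLeastAtMost' cF continuous_intros)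
    from set_borel_integral_eq_integral(2)[OF this] show ?thesis
      by (simp add: set_lebesgue_integral_def)
  qed
  have "(\<integral>p. F p \<partial>lborel) = (\<integral>s. indicator {0..1::real} s *\<^sub>R (\<integral>p. F p \<partial>lborel) \<partial>lborel)"
    by (simp add: integral_scaleR_left)
  also have "\<dots> = (\<integral>s. (\<integral>p. ?G (s,p) \<partial>lborel) \<partial>lborel)"
    by (simp add: rot)
  also have "\<dots> = (\<integral>p. (\<integral>s. ?G (s,p) \<partial>lborel) \<partial>lborel)"
    using lborel_pair.Fubini_integral[of "\<lambda>s p. ?G (s,p)"] Gint by (simp add: case_prod_beta)
  finally show ?thesis unfolding inner .
qed

lemma sum_monom_index: "(\<Sum>i\<in>monom_index m N. f i) = (\<Sum>j\<le>N. \<Sum>b\<le>j+m. f (j,b))"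
  unfolding monom_index_def by (subst sum.Sigma) auto

text \<open>The evaluation of all monomials at a point of either chart, in closed form: by the binomial
  theorem the inner sums are powers, and the outer one is a partial sum of an exponential series.\<close>

lemma sum_monom_sq:
  assumes m: "m \<ge> 1"
  shows "(\<Sum>i\<in>monom_index m N. x ^ fst i * y ^ snd i / monom_sq m i)
      = (real m)\<^sup>2 * (1 + y) ^ m * (\<Sum>j\<le>N. (real m * x * (1 + y)) ^ j / fact j)"
    and "(\<Sum>i\<in>monom_index m N. x ^ fst i * y ^ (fst i + m - snd i) / monom_sq m i)
      = (real m)\<^sup>2 * (1 + y) ^ m * (\<Sum>j\<le>N. (real m * x * (1 + y)) ^ j / fact j)"
proof -
  have inv: "1 / monom_sq m (j,b) = (real m)\<^sup>2 * (real m ^ j / fact j) * real ((j+m) choose b)" if "b \<le> j + m" for j b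
    using m unfolding monom_sq_def binomial_fact[OF that] by (simp add: power_add power2_eq_square)
  have bin: "(\<Sum>b\<le>n. real (n choose b) * y ^ b) = (1 + y) ^ n" "(\<Sum>b\<le>n. real (n choose b) * y ^ (n - b)) = (1 + y) ^ n" for n
    using binomial_ring[of y 1 n] binomial_ring[of 1 y n] by (simp_all add: add.commute)
  have "(\<Sum>b\<le>j+m. x ^ j * y ^ e b / monom_sq m (j,b)) = (real m)\<^sup>2 * (1 + y) ^ m * ((real m * x * (1 + y)) ^ j / fact j)"
    if e: "(\<Sum>b\<le>j+m. real ((j+m) choose b) * y ^ e b) = (1 + y) ^ (j+m)" for e j
  proof -
    have "(\<Sum>b\<le>j+m. x ^ j * y ^ e b / monom_sq m (j,b))
       = (\<Sum>b\<le>j+m. (x ^ j * ((real m)\<^sup>2 * (real m ^ j / fact j))) * (real ((j+m) choose b) * y ^ e b))"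
    proof (rule sum.cong[OF refl])
      fix b assume "b \<in> {..j+m}"
      then have "x ^ j * y ^ e b / monom_sq m (j,b) = x ^ j * y ^ e b * ((real m)\<^sup>2 * (real m ^ j / fact j) * real ((j+m) choose b))"
        using inv[of b j] times_divide_eq_right[of "x ^ j * y ^ e b" 1 "monom_sq m (j,b)"] by auto
      then show "x ^ j * y ^ e b / monom_sq m (j,b) = (x ^ j * ((real m)\<^sup>2 * (real m ^ j / fact j))) * (real ((j+m) choose b) * y ^ e b)"
        by simp
    qed
    also have "\<dots> = (x ^ j * ((real m)\<^sup>2 * (real m ^ j / fact j))) * (1 + y) ^ (j+m)"
      unfolding sum_distrib_left[symmetric] e ..
    finally show ?thesis by (simp add: power_add power_mult_distrib)
  qed
  from this[of _ "\<lambda>b. b", OF bin(1)] this[OF bin(2)]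
  show "(\<Sum>i\<in>monom_index m N. x ^ fst i * y ^ snd i / monom_sq m i)
      = (real m)\<^sup>2 * (1 + y) ^ m * (\<Sum>j\<le>N. (real m * x * (1 + y)) ^ j / fact j)"
    "(\<Sum>i\<in>monom_index m N. x ^ fst i * y ^ (fst i + m - snd i) / monom_sq m i)
      = (real m)\<^sup>2 * (1 + y) ^ m * (\<Sum>j\<le>N. (real m * x * (1 + y)) ^ j / fact j)"
    unfolding sum_monom_index sum_distrib_left by simp_all
qed

section \<open>The sharp pointwise estimate\<close>

lemma l2_ip_diff_self:
  assumes "l2_fun m f" "l2_fun m g"
  shows "0 \<le> Re (l2_ip m f f) - 2 * Re (l2_ip m f g) + Re (l2_ip m g g)"
proof -
  have i: "integrable lborel (\<lambda>p. f p * cnj (f p) * of_real (l2_weight m p))"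
     "integrable lborel (\<lambda>p. f p * cnj (g p) * of_real (l2_weight m p))"
     "integrable lborel (\<lambda>p. g p * cnj (g p) * of_real (l2_weight m p))"
    using assms by (auto intro: l2_ip_integrable)
  have lin: "Re (\<integral>p. a p \<partial>lborel) - 2 * Re (\<integral>p. b p \<partial>lborel) + Re (\<integral>p. c p \<partial>lborel)
      = (\<integral>p. Re (a p) - 2 * Re (b p) + Re (c p) \<partial>lborel)"
    if "integrable lborel a" "integrable lborel b" "integrable lborel c" for a b c :: "complex \<times> complex \<Rightarrow> complex"
    using that by (simp add: integrable_Re)
  have "Re (l2_ip m f f) - 2 * Re (l2_ip m f g) + Re (l2_ip m g g)
     = (\<integral>p. Re (f p * cnj (f p) * of_real (l2_weight m p)) - 2 * Re (f p * cnj (g p) * of_real (l2_weight m p))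
         + Re (g p * cnj (g p) * of_real (l2_weight m p)) \<partial>lborel)"
    unfolding l2_ip_def by (rule lin[OF i])
  also have "\<dots> \<ge> 0"
  proof (rule integral_nonneg_AE, rule AE_I2)
    fix p
    have "Re (f p * cnj (f p) * of_real (l2_weight m p)) - 2 * Re (f p * cnj (g p) * of_real (l2_weight m p))
         + Re (g p * cnj (g p) * of_real (l2_weight m p)) = (cmod (f p - g p))\<^sup>2 * l2_weight m p"
      unfolding cmod_power2 by (simp add: algebra_simps power2_eq_square)
    then show "0 \<le> Re (f p * cnj (f p) * of_real (l2_weight m p)) - 2 * Re (f p * cnj (g p) * of_real (l2_weight m p))
         + Re (g p * cnj (g p) * of_real (l2_weight m p))"
      by (simp add: l2_weight_nonneg)
  qed
  finally show ?thesis .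
qed

text \<open>Averaging over the rotations of the first variable removes all Taylor coefficients in that variable
  other than the \<open>j\<close>-th.\<close>

lemma l2_ip_monom_circle_coeff:
  fixes f :: "complex \<Rightarrow> complex \<Rightarrow> complex"
  assumes m: "m \<ge> 1" and i: "b \<le> j + m"
    and f: "l2_fun m (\<lambda>p. f (fst p) (snd p))"
    and hol: "\<And>t. (\<lambda>z. f z t) holomorphic_on UNIV"
  shows "l2_ip m (\<lambda>p. f (fst p) (snd p)) (monom2 (j,b))
       = l2_ip m (\<lambda>p. circle_coeff j (\<lambda>z. f z (snd p)) * fst p ^ j) (monom2 (j,b))"
proof -
  define F where "F = (\<lambda>p. f (fst p) (snd p) * cnj (monom2 (j,b) p) * of_real (l2_weight m p))"
  have cont: "continuous_on UNIV F"
    using f unfolding F_def l2_fun_def by (intro continuous_intros monom2_continuous l2_weight_continuous) auto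
  have int: "integrable lborel F"
    unfolding F_def by (rule l2_ip_integrable[OF f l2_fun_monom]) (use m i in auto)
  have "integral {0..1} (\<lambda>s. F (circ s * fst p, snd p))
     = circle_coeff j (\<lambda>z. f z (snd p)) * fst p ^ j * cnj (monom2 (j,b) p) * of_real (l2_weight m p)" for p
  proof -
    have "F (circ s * fst p, snd p)
       = (f (fst p * circ s) (snd p) / circ s ^ j) * (cnj (monom2 (j,b) p) * of_real (l2_weight m p))" for s
    proof -
      have "cnj (circ s) = 1 / circ s"
        using complex_norm_square[of "circ s"] by (simp add: field_simps)
      then show ?thesis
        by (simp add: F_def monom2_def power_mult_distrib l2_weight_def fibre_weight_def norm_mult power_divide mult_ac)
    qed
    then have "integral {0..1} (\<lambda>s. F (circ s * fst p, snd p))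
      = integral {0..1} (\<lambda>s. (f (fst p * circ s) (snd p) / circ s ^ j) * (cnj (monom2 (j,b) p) * of_real (l2_weight m p)))"
      by simp
    also have "\<dots> = circle_coeff j (\<lambda>w. f (fst p * w) (snd p)) * (cnj (monom2 (j,b) p) * of_real (l2_weight m p))"
      unfolding circle_coeff_def by (rule integral_mult_left)
    finally show ?thesis
      unfolding circle_coeff_dilate[OF hol] by (simp only: mult.assoc)
  qed
  with integral_circle_average[OF cont int] show ?thesis
    unfolding l2_ip_def F_def[symmetric] by simp
qed

text \<open>Boundedness of \<open>g\<close> for \<open>u\<close> near zero bounds the \<open>j\<close>-th Taylor coefficient of \<open>f\<close> by a multiple of
  \<open>|t|\<^bsup>j+m\<^esup>\<close> for large \<open>t\<close>, and an entire function of such growth is a polynomial.\<close>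

lemma circle_coeff_polynomial:
  fixes f g :: "complex \<Rightarrow> complex \<Rightarrow> complex"
  assumes contf: "continuous_on UNIV (\<lambda>p. f (fst p) (snd p))"
    and contg: "continuous_on UNIV (\<lambda>p. g (fst p) (snd p))"
    and holz: "\<And>t. (\<lambda>z. f z t) holomorphic_on UNIV"
    and holt: "\<And>z. f z holomorphic_on UNIV"
    and fg: "\<And>w u. u \<noteq> 0 \<Longrightarrow> g w u = u ^ m * f (w * u) (1 / u)"
  shows "\<exists>c. \<forall>t. circle_coeff j (\<lambda>z. f z t) = (\<Sum>b\<le>j+m. c b * t ^ b)"
proof -
  define P where "P t = circle_coeff j (\<lambda>z. f z t)" for t
  have hol: "P holomorphic_on UNIV"
    unfolding P_def[abs_def] by (rule circle_coeff_holomorphic[OF contf holt])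
  have cg: "continuous_on S (\<lambda>x. g (a x) (b x))" if "continuous_on S a" "continuous_on S b" for S :: "'x::topological_space set" and a b
    using continuous_on_compose2[OF contg, of S "\<lambda>x. (a x, b x)"] that by (auto intro: continuous_intros)
  have "compact ((\<lambda>p. g (fst p) (snd p)) ` (cball 0 1 \<times> cball 0 1))"
    by (intro compact_continuous_image compact_Times compact_cball continuous_on_subset[OF contg]) auto
  from compact_imp_bounded[OF this]
  obtain C where "\<forall>x\<in>(\<lambda>p. g (fst p) (snd p)) ` (cball 0 1 \<times> cball 0 1). cmod x \<le> C"
    unfolding bounded_iff by blast
  then have C: "cmod (g w u) \<le> C" if "cmod w \<le> 1" "cmod u \<le> 1" for w u
    using that by auto
  have bound: "cmod (P t) \<le> C * cmod t ^ (j+m)" if t: "1 \<le> cmod t" for t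
  proof -
    define u where "u = 1 / t"
    have t0: "0 < cmod t" using t by linarith
    then have u: "u \<noteq> 0" "cmod u \<le> 1" "1 / u = t" using t by (auto simp: u_def norm_divide divide_le_eq)
    have "circle_coeff j (\<lambda>w. g w u) = integral {0..1} (\<lambda>s. u ^ m * (f (u * circ s) t / circ s ^ j))"
      unfolding circle_coeff_def by (simp add: fg u mult.commute)
    also have "\<dots> = u ^ m * circle_coeff j (\<lambda>w. f (u * w) t)"
      unfolding circle_coeff_def by (rule integral_mult_right)
    also have "\<dots> = u ^ m * (P t * u ^ j)"
      by (simp add: circle_coeff_dilate[OF holz] P_def)
    finally have eq: "circle_coeff j (\<lambda>w. g w u) = u ^ (j+m) * P t"
      by (simp add: power_add mult_ac)
    have "cmod (circle_coeff j (\<lambda>w. g w u)) \<le> C * (1 - 0)"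
      unfolding circle_coeff_def
    proof (rule integral_bound)
      show "continuous_on {0..1} (\<lambda>s. g (circ s) u / circ s ^ j)"
        by (intro continuous_intros cg) auto
      show "cmod (g (circ s) u / circ s ^ j) \<le> C" for s
        using C[of "circ s" u] u by (simp add: norm_divide norm_power)
    qed simp
    then have "cmod u ^ (j+m) * cmod (P t) \<le> C" by (simp add: eq norm_mult norm_power)
    then have "cmod t ^ (j+m) * (cmod u ^ (j+m) * cmod (P t)) \<le> cmod t ^ (j+m) * C"
      by (intro mult_left_mono) auto
    moreover have "cmod t ^ (j+m) * cmod u ^ (j+m) = 1"
    proof -
      have "cmod t * cmod u = 1" using t0 by (simp add: u_def norm_divide)
      then show ?thesis by (simp add: power_mult_distrib[symmetric])
    qed
    ultimately show ?thesis by (simp only: mult.assoc[symmetric] mult_1_left mult.commute[of C])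
  qed
  show ?thesis
  proof (intro exI allI)
    fix t
    have "P t = (\<Sum>b\<le>j+m. ((deriv ^^ b) P 0 / fact b) * t ^ b)"
      by (rule Liouville_polynomial[OF hol bound])
    then show "circle_coeff j (\<lambda>z. f z t) = (\<Sum>b\<le>j+m. ((deriv ^^ b) P 0 / fact b) * t ^ b)"
      unfolding P_def[of t] .
  qed
qed

lemma exp_partial_sum_le:
  fixes x :: real
  assumes "0 \<le> x"
  shows "(\<Sum>j\<le>N. x ^ j / fact j) \<le> exp x"
proof -
  have s: "(\<lambda>j. x ^ j / fact j) sums exp x"
    using exp_converges[of x] by (simp add: divide_inverse mult.commute)
  show ?thesis
    unfolding sums_unique[OF s] by (rule sum_le_suminf) (use s assms in \<open>auto simp: sums_iff\<close>)
qed

text \<open>The partial Taylor sums are orthogonal projections onto spans of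
  monomials, so they do not increase the norm; on such a span the estimate is the Cauchy-Schwarz inequality
  against the values of the normalized monomials.\<close>

lemma bergman_inequality:
  fixes f g :: "complex \<Rightarrow> complex \<Rightarrow> complex"
  assumes m: "m \<ge> 1"
    and f: "l2_fun m (\<lambda>p. f (fst p) (snd p))"
    and contg: "continuous_on UNIV (\<lambda>p. g (fst p) (snd p))"
    and holz: "\<And>t. (\<lambda>z. f z t) holomorphic_on UNIV"
    and holt: "\<And>z. f z holomorphic_on UNIV"
    and fg: "\<And>w u. u \<noteq> 0 \<Longrightarrow> g w u = u ^ m * f (w * u) (1 / u)"
  shows "(cmod (f z t))\<^sup>2 * fibre_weight m z t
       \<le> (real m)\<^sup>2 * Re (l2_ip m (\<lambda>p. f (fst p) (snd p)) (\<lambda>p. f (fst p) (snd p)))"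
proof -
  let ?f = "\<lambda>p. f (fst p) (snd p)"
  have contf: "continuous_on UNIV ?f" using f by (simp add: l2_fun_def)
  define E where "E = Re (l2_ip m ?f ?f)"
  have "\<forall>j. \<exists>c. \<forall>t. circle_coeff j (\<lambda>z. f z t) = (\<Sum>b\<le>j+m. c b * t ^ b)"
    using circle_coeff_polynomial[OF contf contg holz holt fg] by blast
  then obtain d where d: "\<And>j t. circle_coeff j (\<lambda>z. f z t) = (\<Sum>b\<le>j+m. d j b * t ^ b)"
    by metis
  define c where "c = (\<lambda>i. d (fst i) (snd i))"
  have c: "circle_coeff j (\<lambda>z. f z t) = (\<Sum>b\<le>j+m. c (j,b) * t ^ b)" for j t
    by (simp add: c_def d)
  define S where "S N p = (\<Sum>i\<in>monom_index m N. c i * monom2 i p)" for N p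
  have idx: "snd i \<le> fst i + m" if "i \<in> monom_index m N" for i N
    using that by (auto simp: monom_index_def)
  have ipf: "l2_ip m ?f (monom2 i) = c i * of_real (monom_sq m i)" if i: "i \<in> monom_index m N" for i N
  proof -
    obtain j b where jb: "i = (j,b)" "b \<le> j + m" using idx[OF i] by (cases i) auto
    have "l2_ip m ?f (monom2 i) = l2_ip m (\<lambda>p. \<Sum>b'\<le>j+m. c (j,b') * monom2 (j,b') p) (monom2 (j,b))"
      unfolding jb l2_ip_monom_circle_coeff[OF m jb(2) f holz] c
      by (simp add: monom2_def sum_distrib_left sum_distrib_right mult_ac)
    also have "\<dots> = (\<Sum>b'\<le>j+m. c (j,b') * l2_ip m (monom2 (j,b')) (monom2 (j,b)))"
      using m jb by (intro l2_ip_sum_left l2_fun_monom) auto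
    also have "\<dots> = (\<Sum>b'\<le>j+m. if b' = b then c (j,b) * of_real (monom_sq m (j,b)) else 0)"
      using m jb by (intro sum.cong) (auto simp: l2_ip_monom)
    also have "\<dots> = c i * of_real (monom_sq m i)" using jb by simp
    finally show ?thesis .
  qed
  have power2_cmod: "c i * cnj (c i) = (of_real (cmod (c i)))\<^sup>2" for i
    using complex_norm_square[of "c i"] by simp
  define Q where "Q N = (\<Sum>i\<in>monom_index m N. (cmod (c i))\<^sup>2 * monom_sq m i)" for N
  have SL2: "l2_fun m (S N)" for N
    unfolding S_def[abs_def] using m idx by (intro l2_fun_sum l2_fun_monom) auto
  have fS: "l2_ip m ?f (S N) = of_real (Q N)" for N
  proof -
    have "l2_ip m (S N) ?f = (\<Sum>i\<in>monom_index m N. c i * l2_ip m (monom2 i) ?f)"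
      unfolding S_def[abs_def] using m idx f by (intro l2_ip_sum_left l2_fun_monom) auto
    also have "\<dots> = (\<Sum>i\<in>monom_index m N. of_real ((cmod (c i))\<^sup>2 * monom_sq m i))"
      by (intro sum.cong refl, subst l2_ip_commute) (simp add: ipf power2_cmod mult.assoc[symmetric])
    finally show ?thesis by (subst l2_ip_commute) (simp add: Q_def)
  qed
  have SS: "l2_ip m (S N) (S N) = of_real (Q N)" for N
  proof -
    have "l2_ip m (monom2 i) (S N) = cnj (c i) * of_real (monom_sq m i)" if i: "i \<in> monom_index m N" for i
    proof -
      have "l2_ip m (S N) (monom2 i) = (\<Sum>k\<in>monom_index m N. c k * l2_ip m (monom2 k) (monom2 i))"
        unfolding S_def[abs_def] using m idx i by (intro l2_ip_sum_left l2_fun_monom) auto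
      also have "\<dots> = (\<Sum>k\<in>monom_index m N. if k = i then c i * of_real (monom_sq m i) else 0)"
        using m idx i by (intro sum.cong) (auto simp: l2_ip_monom)
      finally show ?thesis using i by (subst l2_ip_commute) simp
    qed
    moreover have "l2_ip m (S N) (S N) = (\<Sum>i\<in>monom_index m N. c i * l2_ip m (monom2 i) (S N))"
      by (subst S_def[abs_def]) (use m idx SL2 in \<open>auto intro!: l2_ip_sum_left l2_fun_monom\<close>)
    moreover have "c i * (cnj (c i) * of_real (monom_sq m i)) = of_real ((cmod (c i))\<^sup>2 * monom_sq m i)" for i
      by (simp only: of_real_mult complex_norm_square mult.assoc)
    ultimately show ?thesis
      by (simp only: Q_def of_real_sum cong: sum.cong)
  qed
  have QE: "Q N \<le> E" for N
    using l2_ip_diff_self[OF f SL2[of N]] fS SS by (simp add: E_def)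
  have pos: "0 < monom_sq m i" for i using monom_sq_pos[OF m] .
  have est: "(cmod (S N (z,t)))\<^sup>2 * fibre_weight m z t \<le> (real m)\<^sup>2 * E" for N
  proof -
    have "cmod (S N (z,t)) \<le> (\<Sum>i\<in>monom_index m N. (cmod (c i) * sqrt (monom_sq m i)) * (cmod (monom2 i (z,t)) / sqrt (monom_sq m i)))"
      unfolding S_def using pos by (intro sum_norm_le) (simp add: norm_mult less_imp_neq[symmetric])
    then have "(cmod (S N (z,t)))\<^sup>2 \<le> (\<Sum>i\<in>monom_index m N. (cmod (c i) * sqrt (monom_sq m i)) * (cmod (monom2 i (z,t)) / sqrt (monom_sq m i)))\<^sup>2"
      by (intro power_mono) auto
    also have "\<dots> \<le> (\<Sum>i\<in>monom_index m N. (cmod (c i) * sqrt (monom_sq m i))\<^sup>2) * (\<Sum>i\<in>monom_index m N. (cmod (monom2 i (z,t)) / sqrt (monom_sq m i))\<^sup>2)"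
      by (rule Cauchy_Schwarz_ineq_sum)
    also have "(\<Sum>i\<in>monom_index m N. (cmod (c i) * sqrt (monom_sq m i))\<^sup>2) = Q N"
      unfolding Q_def using pos by (intro sum.cong) (auto simp: power_mult_distrib less_imp_le)
    also have "(\<Sum>i\<in>monom_index m N. (cmod (monom2 i (z,t)) / sqrt (monom_sq m i))\<^sup>2)
       = (\<Sum>i\<in>monom_index m N. ((cmod z)\<^sup>2) ^ fst i * ((cmod t)\<^sup>2) ^ snd i / monom_sq m i)"
      using pos by (intro sum.cong) (auto simp: power_divide less_imp_le monom2_def norm_mult norm_power power_mult_distrib power_mult[symmetric] mult.commute)
    also have "\<dots> = (real m)\<^sup>2 * (1 + (cmod t)\<^sup>2) ^ m * (\<Sum>j\<le>N. (real m * (cmod z)\<^sup>2 * (1 + (cmod t)\<^sup>2)) ^ j / fact j)"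
      by (rule sum_monom_sq(1)[OF m])
    also have "Q N * \<dots> \<le> E * ((real m)\<^sup>2 * (1 + (cmod t)\<^sup>2) ^ m * exp (real m * (cmod z)\<^sup>2 * (1 + (cmod t)\<^sup>2)))"
    proof (intro mult_mono QE mult_left_mono)
      let ?x = "real m * (cmod z)\<^sup>2 * (1 + (cmod t)\<^sup>2)"
      show "(\<Sum>j\<le>N. ?x ^ j / fact j) \<le> exp ?x"
        by (rule exp_partial_sum_le) simp
      have "0 \<le> Q 0" unfolding Q_def using pos by (intro sum_nonneg mult_nonneg_nonneg) (auto simp: less_imp_le)
      then show "0 \<le> E" using QE[of 0] by linarith
    qed (auto intro!: sum_nonneg mult_nonneg_nonneg)
    finally have "(cmod (S N (z,t)))\<^sup>2 \<le> E * ((real m)\<^sup>2 / fibre_weight m z t)"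
      using one_plus_square_pos[of "cmod t"] by (simp add: fibre_weight_def exp_minus divide_inverse mult_ac)
    then show ?thesis using fibre_weight_pos[of m z t] by (simp add: field_simps)
  qed
  have "(\<lambda>N. S N (z,t)) \<longlonglongrightarrow> f z t"
  proof -
    have "S N (z,t) = (\<Sum>j\<le>N. circle_coeff j (\<lambda>z. f z t) * z ^ j)" for N
      unfolding S_def sum_monom_index c by (simp add: monom2_def sum_distrib_left sum_distrib_right mult_ac)
    then show ?thesis
      using circle_coeff_sums[OF holz, of t z] unfolding sums_def_le by simp
  qed
  then have "(\<lambda>N. (cmod (S N (z,t)))\<^sup>2 * fibre_weight m z t) \<longlonglongrightarrow> (cmod (f z t))\<^sup>2 * fibre_weight m z t"
    by (intro tendsto_intros)
  then show ?thesis unfolding E_def[symmetric]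
    by (rule LIMSEQ_le_const2) (use est in auto)
qed

section \<open>Extremal characterization of the epsilon function\<close>

text \<open>The sum of the squared values of an orthonormal basis under a linear functional is the squared norm of
  that functional: the bound, applied to the finite combination with coefficients \<open>cnj (ev b)\<close>, gives one
  inequality, and the Cauchy-Schwarz inequality for the Fourier sums of a nearly extremal element the other.\<close>

lemma orthonormal_basis_extremal:
  fixes V :: "('i, 'a) lb_section set" and ip :: "('i, 'a) lb_section \<Rightarrow> ('i, 'a) lb_section \<Rightarrow> complex"
    and ev :: "('i, 'a) lb_section \<Rightarrow> complex"
  assumes V_lc: "\<And>F u. finite F \<Longrightarrow> F \<subseteq> V \<Longrightarrow> lin_comb F u \<in> V"
    and V_diff: "\<And>s t. s \<in> V \<Longrightarrow> t \<in> V \<Longrightarrow> (\<lambda>i x. s i x - t i x) \<in> V"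
    and ip_lc: "\<And>F u t. finite F \<Longrightarrow> F \<subseteq> V \<Longrightarrow> t \<in> V \<Longrightarrow> ip (lin_comb F u) t = (\<Sum>b\<in>F. u b * ip b t)"
    and ip_diff: "\<And>r s t. r \<in> V \<Longrightarrow> s \<in> V \<Longrightarrow> t \<in> V \<Longrightarrow> ip (\<lambda>i x. s i x - t i x) r = ip s r - ip t r"
    and ip_cnj: "\<And>s t. s \<in> V \<Longrightarrow> t \<in> V \<Longrightarrow> ip s t = cnj (ip t s)"
    and ip_nonneg: "\<And>s. s \<in> V \<Longrightarrow> 0 \<le> Re (ip s s)"
    and ev_lc: "\<And>F u. finite F \<Longrightarrow> F \<subseteq> V \<Longrightarrow> ev (lin_comb F u) = (\<Sum>b\<in>F. u b * ev b)"
    and ev_diff: "\<And>s t. s \<in> V \<Longrightarrow> t \<in> V \<Longrightarrow> ev (\<lambda>i x. s i x - t i x) = ev s - ev t"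
    and bound: "\<And>s. s \<in> V \<Longrightarrow> (cmod (ev s))\<^sup>2 \<le> M * Re (ip s s)" and M: "M \<ge> 0"
    and sharp: "\<And>\<delta>. \<delta> > 0 \<Longrightarrow> \<exists>k\<in>V. Re (ip k k) > 0 \<and> (cmod (ev k))\<^sup>2 \<ge> (M - \<delta>) * Re (ip k k)"
    and B: "B \<subseteq> V" and ortho: "\<And>s t. s \<in> B \<Longrightarrow> t \<in> B \<Longrightarrow> ip s t = (if s = t then 1 else 0)"
    and dense: "\<And>s e. s \<in> V \<Longrightarrow> e > 0 \<Longrightarrow> \<exists>F u. finite F \<and> F \<subseteq> B \<and>
        Re (ip (\<lambda>i x. s i x - lin_comb F u i x) (\<lambda>i x. s i x - lin_comb F u i x)) < e"
  shows "(\<Sum>\<^sub>\<infinity>b\<in>B. (cmod (ev b))\<^sup>2) = M"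
proof -
  have lc_ip: "ip (lin_comb F u) b = u b" if "finite F" "F \<subseteq> B" "b \<in> F" for F u b
  proof -
    have "ip (lin_comb F u) b = (\<Sum>a\<in>F. u a * ip a b)" by (rule ip_lc) (use that B in auto)
    also have "\<dots> = (\<Sum>a\<in>F. if a = b then u b else 0)" by (rule sum.cong) (use that ortho[of _ b] in \<open>auto simp: subset_iff\<close>)
    finally show ?thesis using that by simp
  qed
  have lc_self: "ip (lin_comb F u) (lin_comb F u) = of_real (\<Sum>b\<in>F. (cmod (u b))\<^sup>2)" if F: "finite F" "F \<subseteq> B" for F u
  proof -
    have FV: "F \<subseteq> V" using F B by blast
    have lV: "lin_comb F u \<in> V" by (rule V_lc[OF F(1) FV])
    have "ip b (lin_comb F u) = cnj (u b)" if "b \<in> F" for b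
      using lc_ip[OF F that, of u] ip_cnj[of b "lin_comb F u"] lV FV that by auto
    then have "ip (lin_comb F u) (lin_comb F u) = (\<Sum>b\<in>F. u b * cnj (u b))"
      unfolding ip_lc[OF F(1) FV lV] by simp
    then show ?thesis by (simp add: complex_norm_square del: of_real_power)
  qed
  have fin: "(\<Sum>b\<in>F. (cmod (ev b))\<^sup>2) \<le> M" if F: "finite F" "F \<subseteq> B" for F
  proof -
    define S where "S = (\<Sum>b\<in>F. (cmod (ev b))\<^sup>2)"
    have FV: "F \<subseteq> V" using F B by blast
    have "ev (lin_comb F (\<lambda>b. cnj (ev b))) = of_real S"
      unfolding ev_lc[OF F(1) FV] S_def by (simp add: complex_norm_square mult.commute del: of_real_power)
    moreover have "Re (ip (lin_comb F (\<lambda>b. cnj (ev b))) (lin_comb F (\<lambda>b. cnj (ev b)))) = S"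
      unfolding lc_self[OF F] S_def by simp
    ultimately have "S * S \<le> M * S"
      using bound[OF V_lc[OF F(1) FV], of "\<lambda>b. cnj (ev b)"] by (simp add: power2_eq_square)
    moreover have "S \<ge> 0" unfolding S_def by (intro sum_nonneg) simp
    ultimately show ?thesis using M unfolding S_def[symmetric] by (cases "S = 0") auto
  qed
  have summable: "(\<lambda>b. (cmod (ev b))\<^sup>2) summable_on B"
    by (rule nonneg_bounded_partial_sums_imp_summable_on[where C=M]) (use fin in \<open>auto simp: eventually_finite_subsets_at_top\<close>)
  define I where "I = (\<Sum>\<^sub>\<infinity>b\<in>B. (cmod (ev b))\<^sup>2)"
  have le: "I \<le> M" unfolding I_def
    by (rule infsum_le_finite_sums[OF summable]) (use fin in auto)
  have finI: "(\<Sum>b\<in>F. (cmod (ev b))\<^sup>2) \<le> I" if "finite F" "F \<subseteq> B" for F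
    unfolding I_def by (rule finite_sum_le_infsum[OF summable that]) auto
  have I0: "I \<ge> 0" using finI[of "{}"] by simp
  have est: "cmod (ev k) \<le> sqrt (M * e) + sqrt (Re (ip k k)) * sqrt I" if k: "k \<in> V" and e: "e > 0" for k e
  proof -
    obtain F u where F: "finite F" "F \<subseteq> B"
      and u: "Re (ip (\<lambda>i x. k i x - lin_comb F u i x) (\<lambda>i x. k i x - lin_comb F u i x)) < e"
      using dense[OF k e] by blast
    have FV: "F \<subseteq> V" using F B by blast
    define c where "c b = ip k b" for b
    \<comment> \<open>Among all combinations over \<open>F\<close> the Fourier sum is the best approximation.\<close>
    have dist: "Re (ip (\<lambda>i x. k i x - lin_comb F w i x) (\<lambda>i x. k i x - lin_comb F w i x))
       = Re (ip k k) - (\<Sum>b\<in>F. (cmod (c b))\<^sup>2) + (\<Sum>b\<in>F. (cmod (w b - c b))\<^sup>2)" for w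
    proof -
      have lV: "lin_comb F w \<in> V" by (rule V_lc[OF F(1) FV])
      have dV: "(\<lambda>i x. k i x - lin_comb F w i x) \<in> V" by (rule V_diff[OF k lV])
      have a: "ip (lin_comb F w) k = (\<Sum>b\<in>F. w b * cnj (c b))"
        unfolding ip_lc[OF F(1) FV k] c_def using ip_cnj[OF _ k] FV by (intro sum.cong) auto
      have "ip (\<lambda>i x. k i x - lin_comb F w i x) (\<lambda>i x. k i x - lin_comb F w i x)
         = cnj (ip k k - ip (lin_comb F w) k) - cnj (ip k (lin_comb F w) - ip (lin_comb F w) (lin_comb F w))"
        unfolding ip_diff[OF dV k lV] using ip_diff[OF k k lV] ip_diff[OF lV k lV] ip_cnj[OF k dV] ip_cnj[OF lV dV] by simp
      then have "Re (ip (\<lambda>i x. k i x - lin_comb F w i x) (\<lambda>i x. k i x - lin_comb F w i x))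
         = Re (ip k k) - 2 * Re (ip (lin_comb F w) k) + (\<Sum>b\<in>F. (cmod (w b))\<^sup>2)"
        using ip_cnj[OF k lV] unfolding lc_self[OF F] by simp
      also have "\<dots> = Re (ip k k) - (\<Sum>b\<in>F. (cmod (c b))\<^sup>2) + (\<Sum>b\<in>F. (cmod (w b - c b))\<^sup>2)"
      proof -
        have "(cmod (w b - c b))\<^sup>2 = (cmod (w b))\<^sup>2 - 2 * Re (w b * cnj (c b)) + (cmod (c b))\<^sup>2" for b
          unfolding cmod_power2 by (simp add: power2_eq_square algebra_simps)
        then show ?thesis unfolding a by (simp add: sum.distrib sum_subtractf sum_distrib_left)
      qed
      finally show ?thesis .
    qed
    let ?d = "\<lambda>i x. k i x - lin_comb F c i x"
    have lV: "lin_comb F c \<in> V" by (rule V_lc[OF F(1) FV])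
    have dV: "?d \<in> V" by (rule V_diff[OF k lV])
    have "Re (ip ?d ?d) \<le> Re (ip (\<lambda>i x. k i x - lin_comb F u i x) (\<lambda>i x. k i x - lin_comb F u i x))"
      unfolding dist by (simp add: sum_nonneg)
    with u have de: "Re (ip ?d ?d) < e" by linarith
    have c2: "(\<Sum>b\<in>F. (cmod (c b))\<^sup>2) \<le> Re (ip k k)"
      using ip_nonneg[OF dV] unfolding dist by simp
    have "ev k = ev ?d + (\<Sum>b\<in>F. c b * ev b)"
      unfolding ev_diff[OF k lV] ev_lc[OF F(1) FV] by simp
    then have "cmod (ev k) \<le> cmod (ev ?d) + cmod (\<Sum>b\<in>F. c b * ev b)" by (simp add: norm_triangle_ineq)
    also have "cmod (ev ?d) \<le> sqrt (M * e)"
    proof (rule real_le_rsqrt)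
      have "M * Re (ip ?d ?d) \<le> M * e" using de M by (intro mult_left_mono) auto
      with bound[OF dV] show "(cmod (ev ?d))\<^sup>2 \<le> M * e" by linarith
    qed
    also have "cmod (\<Sum>b\<in>F. c b * ev b) \<le> sqrt (Re (ip k k)) * sqrt I"
    proof -
      have "cmod (\<Sum>b\<in>F. c b * ev b) \<le> (\<Sum>b\<in>F. cmod (c b) * cmod (ev b))"
        by (rule order_trans[OF norm_sum]) (simp add: norm_mult)
      then have "(cmod (\<Sum>b\<in>F. c b * ev b))\<^sup>2 \<le> (\<Sum>b\<in>F. cmod (c b) * cmod (ev b))\<^sup>2" by (intro power_mono) auto
      also have "\<dots> \<le> (\<Sum>b\<in>F. (cmod (c b))\<^sup>2) * (\<Sum>b\<in>F. (cmod (ev b))\<^sup>2)" by (rule Cauchy_Schwarz_ineq_sum)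
      also have "\<dots> \<le> Re (ip k k) * I"
        by (intro mult_mono c2 finI F) (auto intro: sum_nonneg ip_nonneg[OF k])
      finally show ?thesis by (simp add: real_le_rsqrt real_sqrt_mult[symmetric])
    qed
    finally show ?thesis by simp
  qed
  have ge: "M - \<delta> \<le> I" if \<delta>: "\<delta> > 0" for \<delta>
  proof -
    obtain k where k: "k \<in> V" "Re (ip k k) > 0" "(cmod (ev k))\<^sup>2 \<ge> (M - \<delta>) * Re (ip k k)"
      using sharp[OF \<delta>] by blast
    have "(\<lambda>n. sqrt (M * inverse (real (Suc n))) + sqrt (Re (ip k k)) * sqrt I) \<longlonglongrightarrow> sqrt (M * 0) + sqrt (Re (ip k k)) * sqrt I"
      by (intro tendsto_intros LIMSEQ_inverse_real_of_nat)
    then have "cmod (ev k) \<le> sqrt (M * 0) + sqrt (Re (ip k k)) * sqrt I"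
      by (rule LIMSEQ_le_const) (use est[OF k(1)] in auto)
    then have "(cmod (ev k))\<^sup>2 \<le> (sqrt (Re (ip k k)) * sqrt I)\<^sup>2" by (intro power_mono) auto
    also have "\<dots> = I * Re (ip k k)" using k(2) I0 by (simp add: power_mult_distrib)
    finally have "(M - \<delta>) * Re (ip k k) \<le> I * Re (ip k k)" using k(3) by linarith
    then show ?thesis using k(2) by simp
  qed
  have "M \<le> I" by (rule field_le_epsilon) (use ge in \<open>simp add: algebra_simps\<close>)
  with le show ?thesis unfolding I_def by simp
qed

section \<open>The inner product in the first chart\<close>

lemma lborel_complex2_eq: "(lborel :: (complex^2) measure) = distr lborel borel (\<lambda>p. V2 (fst p) (snd p))"
proof (rule lborel_eqI)
  have m: "(\<lambda>p. V2 (fst p) (snd p)) \<in> (lborel :: (complex \<times> complex) measure) \<rightarrow>\<^sub>M borel"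
    by (simp add: borel_measurable_continuous_onI V2_continuous continuous_intros)
  fix l u :: "complex^2" assume le: "\<And>b. b \<in> Basis \<Longrightarrow> l \<bullet> b \<le> u \<bullet> b"
  have Basis: "(Basis :: (complex^2) set) = {axis 1 1, axis 1 \<i>, axis 2 1, axis 2 \<i>}"
    by (auto simp: Basis_vec_def Basis_complex_def UNIV_2)
  have mem: "v \<in> box l u \<longleftrightarrow> v $ 1 \<in> box (l $ 1) (u $ 1) \<and> v $ 2 \<in> box (l $ 2) (u $ 2)" for v
    by (auto simp: box_def Basis inner_axis Basis_complex_def)
  have vim: "(\<lambda>p. V2 (fst p) (snd p)) -` box l u = box (l $ 1) (u $ 1) \<times> box (l $ 2) (u $ 2)"
    by (auto simp: mem)
  have le': "\<And>b. b \<in> Basis \<Longrightarrow> l $ k \<bullet> b \<le> u $ k \<bullet> b" for k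
    using le[of "axis k _"] by (auto simp: Basis_vec_def inner_axis)
  have "emeasure (distr lborel borel (\<lambda>p. V2 (fst p) (snd p))) (box l u)
      = emeasure (lborel \<Otimes>\<^sub>M lborel) (box (l $ 1) (u $ 1) \<times> box (l $ 2) (u $ 2))"
    by (subst emeasure_distr[OF m]) (simp_all add: vim lborel_prod)
  also have "\<dots> = emeasure lborel (box (l $ 1) (u $ 1)) * emeasure lborel (box (l $ 2) (u $ 2))"
    by (rule lborel.emeasure_pair_measure_Times) auto
  also have "\<dots> = ennreal ((\<Prod>b\<in>Basis. (u $ 1 - l $ 1) \<bullet> b) * (\<Prod>b\<in>Basis. (u $ 2 - l $ 2) \<bullet> b))"
    using le' by (simp add: ennreal_mult inner_diff_left prod_nonneg)
  also have "(\<Prod>b\<in>Basis. (u $ 1 - l $ 1) \<bullet> b) * (\<Prod>b\<in>Basis. (u $ 2 - l $ 2) \<bullet> b) = (\<Prod>b\<in>Basis. (u - l) \<bullet> b)"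
  proof -
    have "axis 1 1 \<noteq> (axis 1 \<i> :: complex^2)" "axis 1 1 \<noteq> (axis 2 1 :: complex^2)" "axis 1 1 \<noteq> (axis 2 \<i> :: complex^2)"
      "axis 1 \<i> \<noteq> (axis 2 1 :: complex^2)" "axis 1 \<i> \<noteq> (axis 2 \<i> :: complex^2)" "axis 2 1 \<noteq> (axis 2 \<i> :: complex^2)"
      by (auto simp: axis_eq_axis complex_eq_iff)
    then show ?thesis by (simp add: Basis Basis_complex_def inner_axis mult.assoc)
  qed
  finally show "emeasure (distr lborel borel (\<lambda>p. V2 (fst p) (snd p))) (box l u) = (\<Prod>b\<in>Basis. (u - l) \<bullet> b)" .
qed simp

lemma V2_measurable[measurable]: "(\<lambda>p. V2 (fst p) (snd p)) \<in> borel_measurable borel"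
  by (intro borel_measurable_continuous_onI V2_continuous continuous_intros)

lemma null_line: "{v :: complex^2. v $ 2 = 0} \<in> null_sets lborel"
proof
  have cl: "closed {v :: complex^2. v $ 2 = 0}" by (intro closed_Collect_eq continuous_intros)
  then show "{v :: complex^2. v $ 2 = 0} \<in> sets lborel" by auto
  have "emeasure lborel {v :: complex^2. v $ 2 = 0} = emeasure lborel ((\<lambda>p. V2 (fst p) (snd p)) -` {v :: complex^2. v $ 2 = 0})"
    using cl by (subst lborel_complex2_eq, subst emeasure_distr) auto
  also have "(\<lambda>p. V2 (fst p) (snd p)) -` {v :: complex^2. v $ 2 = 0} = UNIV \<times> {0}" by auto
  also have "emeasure lborel (UNIV \<times> {0} :: (complex \<times> complex) set) = emeasure lborel (UNIV :: complex set) * emeasure lborel {0 :: complex}"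
    unfolding lborel_prod[symmetric] by (rule lborel.emeasure_pair_measure_Times) auto
  finally show "emeasure lborel {v :: complex^2. v $ 2 = 0} = 0" by simp
qed

lemma piece_blowup: "piece blowup_atlas 0 = UNIV" "piece blowup_atlas 1 = {v. v $ 2 = 0}"
proof -
  show "piece blowup_atlas 0 = UNIV"
    using coord1_blow1 blow1_in_dom1 by (simp add: piece_def blowup_atlas_def) (metis UNIV_eq_I image_eqI)
  have "piece blowup_atlas 1 = coord blowup_chart2 ` (range blow2 - dom blowup_chart1)"
    by (simp add: piece_def blowup_atlas_def dom2_eq lessThan_Suc)
  also have "\<dots> = {v. v $ 2 = 0}"
  proof (intro equalityI subsetI)
    fix v :: "complex^2" assume "v \<in> {v. v $ 2 = 0}"
    then show "v \<in> coord blowup_chart2 ` (range blow2 - dom blowup_chart1)"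
      using blow2_in_dom1[of v] by (intro image_eqI[of _ _ "blow2 v"]) (simp_all add: coord2_blow2)
  qed (auto simp: coord2_blow2 blow2_in_dom1)
  finally show "piece blowup_atlas 1 = {v. v $ 2 = 0}" .
qed

text \<open>The complement of the first coordinate domain is a complex line in the second chart, hence a null
  set, so integrals over the blow-up are integrals over the first chart.\<close>

lemma mf_integral_blowup:
  assumes c2: "continuous_on UNIV (\<lambda>w. f (blow2 w) * of_real (vol_density \<omega> blowup_chart2 (blow2 w)))"
    and c1: "continuous_on UNIV (\<lambda>w. f (blow1 w) * of_real (vol_density \<omega> blowup_chart1 (blow1 w)))"
  defines "G \<equiv> \<lambda>p. f (blow1 (V2 (fst p) (snd p))) * of_real (vol_density \<omega> blowup_chart1 (blow1 (V2 (fst p) (snd p))))"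
  shows "mf_integrable blowup_atlas \<omega> f \<longleftrightarrow> integrable lborel G" "mf_integral blowup_atlas \<omega> f = (\<integral>p. G p \<partial>lborel)"
proof -
  let ?g1 = "\<lambda>w. f (blow1 w) * of_real (vol_density \<omega> blowup_chart1 (blow1 w))"
  let ?g2 = "\<lambda>w. f (blow2 w) * of_real (vol_density \<omega> blowup_chart2 (blow2 w))"
  have [measurable]: "?g1 \<in> borel_measurable borel" "?g2 \<in> borel_measurable borel"
    using c1 c2 by (auto intro: borel_measurable_continuous_onI)
  have nth: "blowup_atlas ! 0 = blowup_chart1" "blowup_atlas ! 1 = blowup_chart2" "length blowup_atlas = 2"
    by (simp_all add: blowup_atlas_def)
  have i1: "integrable lborel ?g1 \<longleftrightarrow> integrable lborel G" "(\<integral>w. ?g1 w \<partial>lborel) = (\<integral>p. G p \<partial>lborel)"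
    unfolding G_def by (subst lborel_complex2_eq, subst integrable_distr_eq, simp, simp, rule refl)
      (subst lborel_complex2_eq, subst integral_distr, simp, simp, rule refl)
  have [measurable]: "{v :: complex^2. v $ 2 = 0} \<in> sets borel" using null_line by auto
  have ae: "AE w in lborel. indicator {v :: complex^2. v $ 2 = 0} w *\<^sub>R ?g2 w = 0"
    by (rule AE_I'[OF null_line]) (auto simp: indicator_def)
  have i2: "set_integrable lborel {v. v $ 2 = 0} ?g2" "set_lebesgue_integral lborel {v. v $ 2 = 0} ?g2 = 0"
  proof -
    have m: "(\<lambda>w. indicator {v :: complex^2. v $ 2 = 0} w *\<^sub>R ?g2 w) \<in> borel_measurable lborel" by measurable
    have "AE w in lborel. (0::complex) = indicator {v :: complex^2. v $ 2 = 0} w *\<^sub>R ?g2 w"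
      using ae by (rule AE_mp) (auto intro!: AE_I2)
    then have "AE w in lborel. indicator {v :: complex^2. v $ 2 = 0} w *\<^sub>R ?g2 w = (0::complex)"
      by (rule AE_mp) (auto intro!: AE_I2)
    from integrable_cong_AE[THEN iffD2, OF m borel_measurable_const this integrable_zero]
    show "set_integrable lborel {v. v $ 2 = 0} ?g2" unfolding set_integrable_def .
    show "set_lebesgue_integral lborel {v. v $ 2 = 0} ?g2 = 0"
      unfolding set_lebesgue_integral_def by (rule integral_eq_zero_AE[OF ae])
  qed
  have all: "(\<forall>k<2. P k) \<longleftrightarrow> P 0 \<and> P 1" for P :: "nat \<Rightarrow> bool" by (auto simp: less_2_cases_iff)
  show "mf_integrable blowup_atlas \<omega> f \<longleftrightarrow> integrable lborel G"
    unfolding mf_integrable_def nth(3) all nth(1,2) piece_blowup param1 param2 using i2(1) i1(1)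
    by (simp add: set_integrable_def)
  have sum2: "(\<Sum>k<2. P k) = P 0 + P 1" for P :: "nat \<Rightarrow> complex" by (simp add: numeral_2_eq_2)
  show "mf_integral blowup_atlas \<omega> f = (\<integral>p. G p \<partial>lborel)"
    unfolding mf_integral_def nth(3) sum2 nth(1,2) piece_blowup param1 param2 i2(2) using i1(2)
    by (simp add: set_lebesgue_integral_def)
qed

text \<open>The determinant of the coefficient matrix is \<open>(1 + |t|\<^sup>2) (|z|\<^sup>2 + (1 + |t|\<^sup>2)\<^sup>-\<^sup>2) - |z|\<^sup>2 |t|\<^sup>2\<close>.\<close>

lemma vol_density_blowup:
  assumes "simanca_form \<omega>" "c \<in> set blowup_atlas"
  shows "vol_density \<omega> c (param c v) = ((cmod (v $ 1))\<^sup>2 + 1 / (1 + (cmod (v $ 2))\<^sup>2)) / pi\<^sup>2"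
proof -
  define z t where "z = v $ 1" "t = v $ 2"
  define T R where "T = (cmod t)\<^sup>2" "R = (cmod z)\<^sup>2"
  have T: "t * cnj t = of_real T" "z * cnj z = of_real R" by (simp_all add: T_R_def complex_norm_square del: of_real_power)
  have "1 + T \<noteq> 0" using one_plus_square_pos(1)[of "cmod t"] by (simp add: T_R_def)
  have "det (chart_matrix z t) = (1 + t * cnj t) * (z * cnj z + 1 / (1 + t * cnj t)\<^sup>2) - (z * cnj z) * (t * cnj t)"
    by (simp add: det_2 chart_matrix_nth)
  also have "\<dots> = of_real ((1 + T) * (R + 1 / (1 + T)\<^sup>2) - R * T)" unfolding T by simp
  also have "(1 + T) * (R + 1 / (1 + T)\<^sup>2) - R * T = R + 1 / (1 + T)"
  proof -
    have "X * (R + 1 / X\<^sup>2) - R * (X - 1) = R + 1 / X" if "X \<noteq> 0" for X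
      using that by (simp add: field_simps power2_eq_square)
    from this[OF \<open>1 + T \<noteq> 0\<close>] show ?thesis by simp
  qed
  finally show ?thesis
    unfolding vol_density_def simanca_form_chart[OF assms] z_t_def[symmetric] T_R_def by simp
qed

lemma fibre_weight_potential: "exp (- real m * chart_potential v) = fibre_weight m (v $ 1) (v $ 2)"
proof -
  have "exp (real m * ln (1 + (cmod (v $ 2))\<^sup>2)) = (1 + (cmod (v $ 2))\<^sup>2) ^ m"
    using one_plus_square_pos(1) by (simp add: exp_of_nat_mult)
  then show ?thesis
    by (simp add: chart_potential_def fibre_weight_def distrib_left exp_diff mult.assoc)
qed

section \<open>The epsilon function of the Simanca metric\<close>

text \<open>Here \<open>L\<close> and \<open>h\<close> stand for the power \<open>L\<^sup>m\<close> of the bundle and its metric, and \<open>\<tau>1\<close>, \<open>\<tau>2\<close> for frames as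
  above. All constructions below take place in this setting.\<close>

locale framed_bundle =
  fixes \<omega> :: "(blowup_point, 2) form11" and L :: "('i, blowup_point) line_bundle" and h :: "('i, blowup_point) lb_metric"
    and m :: nat and \<tau>1 \<tau>2 :: "complex^2 \<Rightarrow> 'i \<Rightarrow> complex"
  assumes \<omega>: "simanca_form \<omega>" and L: "hol_line_bundle blowup_atlas L" and h: "hermitian_metric blowup_atlas L h"
    and m: "m \<ge> 1"
    and \<tau>1: "\<And>v. unit_frame L h m blowup_chart1 \<tau>1 v" and \<tau>2: "\<And>v. unit_frame L h m blowup_chart2 \<tau>2 v"
    and \<tau>12: "\<And>v i. v $ 2 \<noteq> 0 \<Longrightarrow> \<tau>2 (chart_change v) i = (v $ 2) ^ m * \<tau>1 v i"
begin

lemma charts: "blowup_chart1 \<in> set blowup_atlas" "blowup_chart2 \<in> set blowup_atlas"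
  by (auto simp: set_blowup_atlas)

definition triv :: "blowup_point \<Rightarrow> 'i" where
  "triv x = (SOME i. i \<in> lb_index L \<and> x \<in> lb_cover L i)"

lemma triv: "triv (blow1 v) \<in> lb_index L" "blow1 v \<in> lb_cover L (triv (blow1 v))"
  "triv (blow2 v) \<in> lb_index L" "blow2 v \<in> lb_cover L (triv (blow2 v))"
  using someI_ex[of "\<lambda>i. i \<in> lb_index L \<and> blow1 v \<in> lb_cover L i"] line_bundle_cover(1)[OF L charts(1), of v]
    someI_ex[of "\<lambda>i. i \<in> lb_index L \<and> blow2 v \<in> lb_cover L i"] line_bundle_cover(1)[OF L charts(2), of v]
  unfolding triv_def param1 param2 by blast+

lemma herm_triv: "herm L h s t x = of_real (h (triv x) x) * s (triv x) x * cnj (t (triv x) x)"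
  unfolding herm_def triv_def Let_def ..

lemma frame_triv:
  "\<tau>1 v (triv (blow1 v)) \<noteq> 0" "(cmod (\<tau>1 v (triv (blow1 v))))\<^sup>2 * h (triv (blow1 v)) (blow1 v) = fibre_weight m (v $ 1) (v $ 2)"
  "\<tau>2 v (triv (blow2 v)) \<noteq> 0" "(cmod (\<tau>2 v (triv (blow2 v))))\<^sup>2 * h (triv (blow2 v)) (blow2 v) = fibre_weight m (v $ 1) (v $ 2)"
  using unit_frame_nonzero[OF \<tau>1[of v], of "triv (blow1 v)"] unit_frame_nonzero[OF \<tau>2[of v], of "triv (blow2 v)"]
    unit_frameD(2)[OF \<tau>1[of v], of "triv (blow1 v)"] unit_frameD(2)[OF \<tau>2[of v], of "triv (blow2 v)"] triv[of v]
  by (simp_all add: param1 param2 fibre_weight_potential[symmetric])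

text \<open>The coefficient functions of a section with respect to the two frames. Computing them in a chosen
  trivialization makes them linear in the section by definition.\<close>

definition crd1 :: "('i, blowup_point) lb_section \<Rightarrow> complex^2 \<Rightarrow> complex" where
  "crd1 s v = s (triv (blow1 v)) (blow1 v) / \<tau>1 v (triv (blow1 v))"

definition crd2 :: "('i, blowup_point) lb_section \<Rightarrow> complex^2 \<Rightarrow> complex" where
  "crd2 s v = s (triv (blow2 v)) (blow2 v) / \<tau>2 v (triv (blow2 v))"

lemma herm_crd:
  "herm L h s t (blow1 v) = crd1 s v * cnj (crd1 t v) * of_real (fibre_weight m (v $ 1) (v $ 2))"
  "herm L h s t (blow2 v) = crd2 s v * cnj (crd2 t v) * of_real (fibre_weight m (v $ 1) (v $ 2))"
proof -
  have gen: "of_real H * a * cnj b = a / c * cnj (b / c) * of_real ((cmod c)\<^sup>2 * H)" if "c \<noteq> 0" for H and a b c :: complex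
    using that by (simp add: complex_norm_square del: of_real_power)
  show "herm L h s t (blow1 v) = crd1 s v * cnj (crd1 t v) * of_real (fibre_weight m (v $ 1) (v $ 2))"
    unfolding herm_triv crd1_def frame_triv(2)[symmetric] by (rule gen[OF frame_triv(1)])
  show "herm L h s t (blow2 v) = crd2 s v * cnj (crd2 t v) * of_real (fibre_weight m (v $ 1) (v $ 2))"
    unfolding herm_triv crd2_def frame_triv(4)[symmetric] by (rule gen[OF frame_triv(3)])
qed

lemma crd_frame:
  assumes "hol_section blowup_atlas L s"
  shows "hol_at (crd1 s) v" "hol_at (crd2 s) v"
    "v $ 2 \<noteq> 0 \<Longrightarrow> crd1 s v = (v $ 2) ^ m * crd2 s (chart_change v)"
proof -
  obtain f where f: "\<And>v. hol_at f v" "\<And>v i. i \<in> lb_index L \<Longrightarrow> blow1 v \<in> lb_cover L i \<Longrightarrow> s i (blow1 v) = f v * \<tau>1 v i"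
    using section_in_frame[OF L charts(1) \<tau>1 assms] unfolding param1 by blast
  obtain g where g: "\<And>v. hol_at g v" "\<And>v i. i \<in> lb_index L \<Longrightarrow> blow2 v \<in> lb_cover L i \<Longrightarrow> s i (blow2 v) = g v * \<tau>2 v i"
    using section_in_frame[OF L charts(2) \<tau>2 assms] unfolding param2 by blast
  have fe: "crd1 s v = f v" for v unfolding crd1_def f(2)[OF triv(1,2)] using frame_triv(1) by simp
  have ge: "crd2 s v = g v" for v unfolding crd2_def g(2)[OF triv(3,4)] using frame_triv(3) by simp
  show "hol_at (crd1 s) v" "hol_at (crd2 s) v" using f(1)[of v] g(1)[of v] by (simp_all add: fe[abs_def] ge[abs_def])
  assume v: "v $ 2 \<noteq> 0"
  have b: "blow2 (chart_change v) = blow1 v" using chart_change_param(1)[OF v] by (simp add: param1 param2)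
  have "crd2 s (chart_change v) = s (triv (blow1 v)) (blow1 v) / ((v $ 2) ^ m * \<tau>1 v (triv (blow1 v)))"
    unfolding crd2_def b \<tau>12[OF v] ..
  then show "crd1 s v = (v $ 2) ^ m * crd2 s (chart_change v)" using v by (simp add: crd1_def)
qed

lemma hol_at_UNIV_continuous: "(\<And>v. hol_at f v) \<Longrightarrow> continuous_on UNIV f"
  by (auto simp: continuous_on_eq_continuous_at intro: hol_at_continuous)

lemma crd_continuous:
  assumes "hol_section blowup_atlas L s"
  shows "continuous_on S (crd1 s)" "continuous_on S (crd2 s)"
  using crd_frame(1,2)[OF assms] by (auto intro: continuous_on_subset[OF hol_at_UNIV_continuous])

lemma V2_surj_continuous: "continuous_on UNIV (\<lambda>p. V2 (fst p) (snd p))"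
  by (intro V2_continuous continuous_intros)

definition pair_fun :: "('i, blowup_point) lb_section \<Rightarrow> complex \<times> complex \<Rightarrow> complex" where
  "pair_fun s p = crd1 s (V2 (fst p) (snd p))"

lemma pair_fun_continuous: "hol_section blowup_atlas L s \<Longrightarrow> continuous_on UNIV (pair_fun s)"
  unfolding pair_fun_def by (rule continuous_on_compose2[OF crd_continuous(1) V2_surj_continuous]) auto

lemma fibre_weight_continuous: "continuous_on S (\<lambda>v::complex^2. fibre_weight m (v $ 1) (v $ 2))"
  unfolding fibre_weight_def by (intro continuous_intros) (auto simp: one_plus_square_pos)

lemma vol_continuous: "continuous_on S (\<lambda>v::complex^2. ((cmod (v $ 1))\<^sup>2 + 1 / (1 + (cmod (v $ 2))\<^sup>2)) / pi\<^sup>2)"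
  by (intro continuous_intros) (auto simp: one_plus_square_pos)

lemma section_integral:
  assumes s: "hol_section blowup_atlas L s" and t: "hol_section blowup_atlas L t"
  shows "mf_integrable blowup_atlas \<omega> (herm L h s t) \<longleftrightarrow> integrable lborel (\<lambda>p. pair_fun s p * cnj (pair_fun t p) * of_real (l2_weight m p))"
    and "l2_inner blowup_atlas \<omega> L h s t = l2_ip m (pair_fun s) (pair_fun t)"
proof -
  have v1: "vol_density \<omega> blowup_chart1 (blow1 v) = ((cmod (v $ 1))\<^sup>2 + 1 / (1 + (cmod (v $ 2))\<^sup>2)) / pi\<^sup>2" for v
    using vol_density_blowup[OF \<omega> charts(1)] by (simp add: param1)
  have v2: "vol_density \<omega> blowup_chart2 (blow2 v) = ((cmod (v $ 1))\<^sup>2 + 1 / (1 + (cmod (v $ 2))\<^sup>2)) / pi\<^sup>2" for v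
    using vol_density_blowup[OF \<omega> charts(2)] by (simp add: param2)
  have c1: "continuous_on UNIV (\<lambda>w. herm L h s t (blow1 w) * of_real (vol_density \<omega> blowup_chart1 (blow1 w)))"
    unfolding herm_crd v1
    by (intro continuous_on_mult continuous_on_cnj continuous_on_of_real crd_continuous s t fibre_weight_continuous vol_continuous)
  have c2: "continuous_on UNIV (\<lambda>w. herm L h s t (blow2 w) * of_real (vol_density \<omega> blowup_chart2 (blow2 w)))"
    unfolding herm_crd v2
    by (intro continuous_on_mult continuous_on_cnj continuous_on_of_real crd_continuous s t fibre_weight_continuous vol_continuous)
  have eq: "(\<lambda>p. herm L h s t (blow1 (V2 (fst p) (snd p))) * of_real (vol_density \<omega> blowup_chart1 (blow1 (V2 (fst p) (snd p)))))
     = (\<lambda>p. pair_fun s p * cnj (pair_fun t p) * of_real (l2_weight m p))"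
    unfolding herm_crd v1 pair_fun_def l2_weight_def by (simp add: mult.assoc)
  show "mf_integrable blowup_atlas \<omega> (herm L h s t) \<longleftrightarrow> integrable lborel (\<lambda>p. pair_fun s p * cnj (pair_fun t p) * of_real (l2_weight m p))"
    using mf_integral_blowup(1)[OF c2 c1] unfolding eq .
  show "l2_inner blowup_atlas \<omega> L h s t = l2_ip m (pair_fun s) (pair_fun t)"
    unfolding l2_inner_def l2_ip_def using mf_integral_blowup(2)[OF c2 c1] unfolding eq .
qed

text \<open>Square integrability over the blow-up becomes membership in the model space.\<close>

lemma l2_sections_iff:
  "s \<in> l2_sections blowup_atlas \<omega> L h \<longleftrightarrow> hol_section blowup_atlas L s \<and> l2_fun m (pair_fun s)"
proof -
  have eq: "pair_fun s p * cnj (pair_fun s p) * of_real (l2_weight m p) = complex_of_real ((cmod (pair_fun s p))\<^sup>2 * l2_weight m p)" for p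
    by (simp add: complex_norm_square del: of_real_power)
  show ?thesis
    unfolding l2_sections_def l2_fun_def using section_integral(1)[of s s] pair_fun_continuous[of s]
    unfolding eq complex_of_real_integrable_eq by auto
qed

abbreviation "V \<equiv> l2_sections blowup_atlas \<omega> L h"

lemma hol_section_add:
  assumes s: "hol_section blowup_atlas L s" and t: "hol_section blowup_atlas L t"
  shows "hol_section blowup_atlas L (\<lambda>i x. s i x + a * t i x)"
  unfolding hol_section_def mf_hol_on_blowup comp_def
proof (intro conjI ballI allI impI)
  fix i c v assume i: "i \<in> lb_index L" and c: "c \<in> set blowup_atlas" "param c v \<in> lb_cover L i"
  show "hol_at (\<lambda>v. s i (param c v) + a * t i (param c v)) v"
    using hol_sectionD(1)[OF s i c] hol_sectionD(1)[OF t i c] unfolding comp_def by (intro hol_at_add hol_at_mult hol_at_const)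
next
  fix i j x assume i: "i \<in> lb_index L" and j: "j \<in> lb_index L" and x: "x \<in> lb_cover L i \<inter> lb_cover L j"
  have e: "s i x = lb_trans L i j x * s j x" "t i x = lb_trans L i j x * t j x"
    using x by (auto intro: hol_sectionD(2)[OF s i j] hol_sectionD(2)[OF t i j])
  show "s i x + a * t i x = lb_trans L i j x * (s j x + a * t j x)"
    unfolding e by (simp add: algebra_simps)
qed

lemma hol_section_zero: "hol_section blowup_atlas L (\<lambda>i x. 0)"
  unfolding hol_section_def mf_hol_on_blowup comp_def by (auto intro: hol_at_const)

lemma hol_section_lin_comb:
  "finite F \<Longrightarrow> (\<And>b. b \<in> F \<Longrightarrow> hol_section blowup_atlas L b) \<Longrightarrow> hol_section blowup_atlas L (lin_comb F u)"
proof (induction F rule: finite_induct)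
  case empty then show ?case using hol_section_zero by (simp add: lin_comb_def)
next
  case (insert b F)
  have "lin_comb (insert b F) u = (\<lambda>i x. lin_comb F u i x + u b * b i x)"
    using insert.hyps by (simp add: lin_comb_def add.commute fun_eq_iff)
  with insert show ?case by (auto intro!: hol_section_add)
qed

lemma pair_fun_lin_comb: "pair_fun (lin_comb F u) = (\<lambda>p. \<Sum>b\<in>F. u b * pair_fun b p)"
  by (simp add: pair_fun_def crd1_def lin_comb_def sum_divide_distrib fun_eq_iff)

lemma pair_fun_diff: "pair_fun (\<lambda>i x. s i x - t i x) = (\<lambda>p. pair_fun s p + (- 1) * pair_fun t p)"
  by (simp add: pair_fun_def crd1_def diff_divide_distrib fun_eq_iff)

lemma lin_comb_in_V: "finite F \<Longrightarrow> F \<subseteq> V \<Longrightarrow> lin_comb F u \<in> V"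
  unfolding l2_sections_iff pair_fun_lin_comb
  by (intro conjI hol_section_lin_comb l2_fun_sum) (auto simp: l2_sections_iff subset_iff)

lemma diff_in_V: "s \<in> V \<Longrightarrow> t \<in> V \<Longrightarrow> (\<lambda>i x. s i x - t i x) \<in> V"
  unfolding l2_sections_iff pair_fun_diff
proof (elim conjE, intro conjI)
  show "hol_section blowup_atlas L s \<Longrightarrow> hol_section blowup_atlas L t \<Longrightarrow> hol_section blowup_atlas L (\<lambda>i x. s i x - t i x)"
    using hol_section_add[of s t "- 1"] by simp
qed (rule l2_fun_add[OF _ l2_fun_scale])

text \<open>Evaluation at a point as a linear functional, scaled such that its squared modulus is the pointwise norm of
  the section.\<close>

definition evaluate :: "blowup_point \<Rightarrow> ('i, blowup_point) lb_section \<Rightarrow> complex" where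
  "evaluate x s = of_real (sqrt (h (triv x) x)) * s (triv x) x"

lemma evaluate_square:
  assumes "x \<in> blowup"
  shows "(cmod (evaluate x s))\<^sup>2 = Re (herm L h s s x)"
proof -
  have "triv x \<in> lb_index L \<and> x \<in> lb_cover L (triv x)"
  proof -
    have "x \<in> mf_points blowup_atlas" using assms by (simp add: mf_points_blowup_atlas)
    then show ?thesis using triv by (auto simp: mf_points_def set_blowup_atlas dom1_eq dom2_eq)
  qed
  then have "h (triv x) x > 0" using hermitian_metricD(2)[OF h] by blast
  then have "(cmod (evaluate x s))\<^sup>2 = h (triv x) x * (cmod (s (triv x) x))\<^sup>2"
    by (simp add: evaluate_def norm_mult power_mult_distrib)
  also have "\<dots> = Re (herm L h s s x)"
    unfolding herm_triv cmod_power2 by (simp add: power2_eq_square algebra_simps)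
  finally show ?thesis .
qed

lemma V2_hol: "(\<lambda>z. F (V2 z t)) holomorphic_on UNIV" "(\<lambda>t. F (V2 z t)) holomorphic_on UNIV"
  if F: "\<And>v. hol_at F v" for F
proof -
  have axis: "((\<lambda>z. V2 z t) has_derivative (\<lambda>z. V2 z 0)) (at z)" "((\<lambda>t. V2 z t) has_derivative (\<lambda>t. V2 0 t)) (at t)" for z t
  proof -
    have bl: "bounded_linear (\<lambda>z. V2 z 0)" "bounded_linear (\<lambda>t. V2 0 t)"
      by (auto intro!: linear_conv_bounded_linear[THEN iffD1] linearI simp: vec_eq_iff forall_2)
    have split: "V2 0 t + V2 z 0 = V2 z t" "V2 z 0 + V2 0 t = V2 z t" for z t by (auto simp: vec_eq_iff forall_2)
    show "((\<lambda>z. V2 z t) has_derivative (\<lambda>z. V2 z 0)) (at z)"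
      using has_derivative_add[OF has_derivative_const[of "V2 0 t"] bounded_linear_imp_has_derivative[OF bl(1), of "at z"]]
      by (simp only: split add_0_left)
    show "((\<lambda>t. V2 z t) has_derivative (\<lambda>t. V2 0 t)) (at t)"
      using has_derivative_add[OF has_derivative_const[of "V2 z 0"] bounded_linear_imp_has_derivative[OF bl(2), of "at t"]]
      by (simp only: split add_0_left)
  qed
  have "(\<lambda>z. F (V2 z t)) field_differentiable (at z)" "(\<lambda>t. F (V2 z t)) field_differentiable (at t)" for z t
  proof -
    obtain D where D: "(F has_derivative D) (at (V2 z t))" "\<And>c v. D (c *s v) = c * D v"
      using F[of "V2 z t"] by (auto simp: hol_at_def)
    have e: "V2 x 0 = x *s V2 1 0" "V2 0 x = x *s V2 0 1" for x by (auto simp: vec_eq_iff forall_2)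
    have d: "D (V2 x 0) = D (V2 1 0) * x" "D (V2 0 x) = D (V2 0 1) * x" for x
      unfolding e[of x] D(2) by simp_all
    have "(\<lambda>x. D (V2 x 0)) = (*) (D (V2 1 0))" "(\<lambda>x. D (V2 0 x)) = (*) (D (V2 0 1))"
      by (intro ext d)+
    with has_derivative_compose[OF axis(1) D(1)] has_derivative_compose[OF axis(2) D(1)]
    have "((\<lambda>z. F (V2 z t)) has_derivative (*) (D (V2 1 0))) (at z)" "((\<lambda>t. F (V2 z t)) has_derivative (*) (D (V2 0 1))) (at t)"
      by (simp_all only: )
    note d1 = this(1) and d2 = this(2)
    show "(\<lambda>z. F (V2 z t)) field_differentiable (at z)"
      unfolding field_differentiable_def has_field_derivative_def by (rule exI, rule d1)
    show "(\<lambda>t. F (V2 z t)) field_differentiable (at t)"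
      unfolding field_differentiable_def has_field_derivative_def by (rule exI, rule d2)
  qed
  then show "(\<lambda>z. F (V2 z t)) holomorphic_on UNIV" "(\<lambda>t. F (V2 z t)) holomorphic_on UNIV"
    by (simp_all add: holomorphic_on_def field_differentiable_at_within)
qed

lemma bound_blow1:
  assumes s: "s \<in> V"
  shows "Re (herm L h s s (blow1 v)) \<le> (real m)\<^sup>2 * Re (l2_inner blowup_atlas \<omega> L h s s)"
proof -
  have hs: "hol_section blowup_atlas L s" "l2_fun m (pair_fun s)" using s by (simp_all add: l2_sections_iff)
  have "(cmod (crd1 s (V2 (v $ 1) (v $ 2))))\<^sup>2 * fibre_weight m (v $ 1) (v $ 2)
      \<le> (real m)\<^sup>2 * Re (l2_ip m (\<lambda>p. crd1 s (V2 (fst p) (snd p))) (\<lambda>p. crd1 s (V2 (fst p) (snd p))))"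
  proof (rule bergman_inequality[where g="\<lambda>w u. crd2 s (V2 w u)", OF m])
    show "l2_fun m (\<lambda>p. crd1 s (V2 (fst p) (snd p)))" using hs(2) by (simp add: pair_fun_def[abs_def])
    show "continuous_on UNIV (\<lambda>p. crd2 s (V2 (fst p) (snd p)))"
      by (rule continuous_on_compose2[OF crd_continuous(2)[OF hs(1)] V2_surj_continuous]) auto
    show "(\<lambda>z. crd1 s (V2 z t)) holomorphic_on UNIV" "(\<lambda>t. crd1 s (V2 z t)) holomorphic_on UNIV" for z t
      using V2_hol[OF crd_frame(1)[OF hs(1)]] by auto
    show "crd2 s (V2 w u) = u ^ m * crd1 s (V2 (w * u) (1 / u))" if u: "u \<noteq> 0" for w u
    proof -
      have "chart_change (V2 (w * u) (1 / u)) = V2 w u" using u by (simp add: chart_change_def)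
      then show ?thesis using crd_frame(3)[OF hs(1), of "V2 (w * u) (1 / u)"] u by (simp add: power_divide)
    qed
  qed
  moreover have "Re (herm L h s s (blow1 v)) = (cmod (crd1 s v))\<^sup>2 * fibre_weight m (v $ 1) (v $ 2)"
    unfolding herm_crd complex_norm_square[symmetric] by (simp del: of_real_power)
  ultimately show ?thesis
    unfolding section_integral(2)[OF hs(1) hs(1)] pair_fun_def[abs_def] V2_eta by simp
qed

lemma bound:
  assumes s: "s \<in> V" and x: "x \<in> blowup"
  shows "(cmod (evaluate x s))\<^sup>2 \<le> (real m)\<^sup>2 * Re (l2_inner blowup_atlas \<omega> L h s s)"
proof -
  have "x \<in> mf_points blowup_atlas" using x by (simp add: mf_points_blowup_atlas)
  then consider v where "x = blow1 v" | v where "x = blow2 v"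
    by (auto simp: mf_points_def set_blowup_atlas dom1_eq dom2_eq)
  then show ?thesis unfolding evaluate_square[OF x]
  proof cases
    case 1 then show "Re (herm L h s s x) \<le> (real m)\<^sup>2 * Re (l2_inner blowup_atlas \<omega> L h s s)" using bound_blow1[OF s] by simp
  next
    case (2 v)
    have hs: "hol_section blowup_atlas L s" using s by (simp add: l2_sections_iff)
    \<comment> \<open>The points outside the first chart are limits of points inside, and both sides are continuous.\<close>
    define y where "y n = v + inverse (real (Suc n)) *\<^sub>R axis 2 1" for n
    have "y \<longlonglongrightarrow> v + 0 *\<^sub>R axis 2 1"
      unfolding y_def by (intro tendsto_intros LIMSEQ_inverse_real_of_nat)
    then have y: "y \<longlonglongrightarrow> v" by simp
    have "continuous_on UNIV (\<lambda>w. herm L h s s (blow2 w))"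
      unfolding herm_crd by (intro continuous_on_mult continuous_on_cnj continuous_on_of_real crd_continuous hs fibre_weight_continuous)
    then have lim: "(\<lambda>n. Re (herm L h s s (blow2 (y n)))) \<longlonglongrightarrow> Re (herm L h s s (blow2 v))"
      using y by (intro tendsto_Re) (auto simp: continuous_on_eq_continuous_at intro: isCont_tendsto_compose)
    have "\<forall>\<^sub>F n in sequentially. y n $ 2 \<noteq> 0"
    proof (cases "v $ 2 = 0")
      case True then show ?thesis by (simp add: y_def axis_def del: of_nat_Suc)
    next
      case False
      have "(\<lambda>n. y n $ 2) \<longlonglongrightarrow> v $ 2" by (intro tendsto_vec_nth y)
      then show ?thesis using False by (rule tendsto_imp_eventually_ne)
    qed
    then have "\<forall>\<^sub>F n in sequentially. Re (herm L h s s (blow2 (y n))) \<le> (real m)\<^sup>2 * Re (l2_inner blowup_atlas \<omega> L h s s)"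
      by eventually_elim (simp add: blow2_eq_blow1 bound_blow1[OF s])
    then show "Re (herm L h s s x) \<le> (real m)\<^sup>2 * Re (l2_inner blowup_atlas \<omega> L h s s)"
      unfolding 2 by (rule tendsto_upperbound[OF lim]) simp
  qed
qed

text \<open>The monomial \<open>z\<^sup>j t\<^sup>b\<close> in the frame over the first chart is \<open>w\<^sup>j u\<^sup>j\<^sup>+\<^sup>m\<^sup>-\<^sup>b\<close> in the frame over the second.\<close>

definition monom2' :: "nat \<times> nat \<Rightarrow> complex \<times> complex \<Rightarrow> complex" where
  "monom2' i p = fst p ^ fst i * snd p ^ (fst i + m - snd i)"

lemma monomial_section:
  fixes a :: "nat \<times> nat \<Rightarrow> complex"
  shows "\<exists>k\<in>V. Re (l2_inner blowup_atlas \<omega> L h k k) = (\<Sum>i\<in>monom_index m N. (cmod (a i))\<^sup>2 * monom_sq m i) \<and>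
     (\<forall>v. crd1 k v = (\<Sum>i\<in>monom_index m N. a i * monom2 i (v $ 1, v $ 2))) \<and>
     (\<forall>v. crd2 k v = (\<Sum>i\<in>monom_index m N. a i * monom2' i (v $ 1, v $ 2)))"
proof -
  let ?f = "\<lambda>v::complex^2. \<Sum>i\<in>monom_index m N. a i * monom2 i (v $ 1, v $ 2)"
  let ?g = "\<lambda>v::complex^2. \<Sum>i\<in>monom_index m N. a i * monom2' i (v $ 1, v $ 2)"
  have idx: "snd i \<le> fst i + m" if "i \<in> monom_index m N" for i using that by (auto simp: monom_index_def)
  have hf: "hol_at ?f v" "hol_at ?g v" for v
    unfolding monom2_def monom2'_def fst_conv snd_conv
    by (intro hol_at_sum finite_monom_index hol_at_mult hol_at_const hol_at_power hol_at_coord)+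
  have fg: "?f v = (v $ 2) ^ m * ?g (chart_change v)" if v: "v $ 2 \<noteq> 0" for v :: "complex^2"
    unfolding sum_distrib_left
  proof (rule sum.cong[OF refl])
    fix i assume i: "i \<in> monom_index m N"
    obtain t where t: "v $ 2 = t" "t \<noteq> 0" using v by blast
    have "t ^ (fst i + m) = t ^ (fst i + m - snd i) * t ^ snd i" using idx[OF i] by (simp add: power_add[symmetric])
    then have "t ^ m * (t ^ fst i * (1 / t) ^ (fst i + m - snd i)) = t ^ snd i"
      using t(2) by (simp add: power_divide power_add field_simps)
    then have "(v $ 1) ^ fst i * t ^ snd i = t ^ m * ((v $ 1 * t) ^ fst i * (1 / t) ^ (fst i + m - snd i))"
      by (simp add: power_mult_distrib mult_ac)
    then show "a i * monom2 i (v $ 1, v $ 2) = v $ 2 ^ m * (a i * monom2' i (chart_change v $ 1, chart_change v $ 2))"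
      by (simp add: monom2_def monom2'_def chart_change_def t(1) mult_ac)
  qed
  obtain k where k: "hol_section blowup_atlas L k" "\<And>i v. k i (blow1 v) = ?f v * \<tau>1 v i" "\<And>i v. k i (blow2 v) = ?g v * \<tau>2 v i"
    using section_from_frames[OF \<tau>1 \<tau>2 \<tau>12 L hf fg] by blast
  have c1: "crd1 k v = ?f v" and c2: "crd2 k v = ?g v" for v
    unfolding crd1_def crd2_def k(2,3) using frame_triv(1,3) by simp_all
  have pf: "pair_fun k = (\<lambda>p. \<Sum>i\<in>monom_index m N. a i * monom2 i p)"
    unfolding pair_fun_def[abs_def] c1 by simp
  have kV: "k \<in> V" unfolding l2_sections_iff pf using k(1) idx m by (auto intro!: l2_fun_sum l2_fun_monom)
  have "l2_ip m (monom2 i) (pair_fun k) = cnj (a i) * of_real (monom_sq m i)" if i: "i \<in> monom_index m N" for i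
  proof -
    have "l2_ip m (pair_fun k) (monom2 i) = (\<Sum>j\<in>monom_index m N. a j * l2_ip m (monom2 j) (monom2 i))"
      unfolding pf using m idx i by (intro l2_ip_sum_left l2_fun_monom) auto
    also have "\<dots> = (\<Sum>j\<in>monom_index m N. if j = i then a i * of_real (monom_sq m i) else 0)"
      using m idx i by (intro sum.cong) (auto simp: l2_ip_monom)
    finally show ?thesis using i by (subst l2_ip_commute) simp
  qed
  moreover have "l2_ip m (pair_fun k) (pair_fun k) = (\<Sum>i\<in>monom_index m N. a i * l2_ip m (monom2 i) (pair_fun k))"
    by (subst pf) (use m idx kV in \<open>auto intro!: l2_ip_sum_left l2_fun_monom simp: l2_sections_iff\<close>)
  moreover have "a i * (cnj (a i) * of_real (monom_sq m i)) = of_real ((cmod (a i))\<^sup>2 * monom_sq m i)" for i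
    by (simp only: of_real_mult complex_norm_square mult.assoc)
  ultimately have "l2_ip m (pair_fun k) (pair_fun k) = of_real (\<Sum>i\<in>monom_index m N. (cmod (a i))\<^sup>2 * monom_sq m i)"
    by (simp only: of_real_sum cong: sum.cong)
  then have "Re (l2_inner blowup_atlas \<omega> L h k k) = (\<Sum>i\<in>monom_index m N. (cmod (a i))\<^sup>2 * monom_sq m i)"
    unfolding section_integral(2)[OF k(1) k(1)] by simp
  with kV c1 c2 show ?thesis by blast
qed

text \<open>On the span of the monomials of degree at most \<open>N\<close> in \<open>z\<close> the evaluation at \<open>x\<close> is represented by the section
  whose coefficients are the conjugate values of the monomials divided by their squared norms. Its quotient of
  squared value and squared norm is \<open>m\<^sup>2 e\<^sup>-\<^sup>X\<close> times a partial sum of \<open>e\<^sup>X\<close>, with \<open>X = m |z|\<^sup>2 (1 + |t|\<^sup>2)\<close>.\<close>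

lemma sharp:
  assumes x: "x \<in> blowup" and \<delta>: "\<delta> > 0"
  shows "\<exists>k\<in>V. Re (l2_inner blowup_atlas \<omega> L h k k) > 0 \<and>
     (cmod (evaluate x k))\<^sup>2 \<ge> ((real m)\<^sup>2 - \<delta>) * Re (l2_inner blowup_atlas \<omega> L h k k)"
proof -
  have main: "\<exists>k\<in>V. Re (l2_inner blowup_atlas \<omega> L h k k) > 0 \<and>
     (cmod (evaluate x k))\<^sup>2 \<ge> ((real m)\<^sup>2 - \<delta>) * Re (l2_inner blowup_atlas \<omega> L h k k)"
    if sum: "\<And>N. (\<Sum>i\<in>monom_index m N. (cmod (e i))\<^sup>2 / monom_sq m i)
        = (real m)\<^sup>2 * (1 + (cmod t)\<^sup>2) ^ m * (\<Sum>j\<le>N. (real m * (cmod z)\<^sup>2 * (1 + (cmod t)\<^sup>2)) ^ j / fact j)"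
      and ev: "\<And>k N a. k \<in> V \<Longrightarrow> (\<forall>v. crd1 k v = (\<Sum>i\<in>monom_index m N. a i * monom2 i (v $ 1, v $ 2))) \<Longrightarrow>
          (\<forall>v. crd2 k v = (\<Sum>i\<in>monom_index m N. a i * monom2' i (v $ 1, v $ 2))) \<Longrightarrow>
          (cmod (evaluate x k))\<^sup>2 = (cmod (\<Sum>i\<in>monom_index m N. a i * e i))\<^sup>2 * fibre_weight m z t"
    for e z t
  proof -
    define X where "X = real m * (cmod z)\<^sup>2 * (1 + (cmod t)\<^sup>2)"
    define S where "S N = (\<Sum>i\<in>monom_index m N. (cmod (e i))\<^sup>2 / monom_sq m i)" for N
    have X: "X \<ge> 0" by (simp add: X_def)
    have W: "S N * fibre_weight m z t = (real m)\<^sup>2 * (exp (- X) * (\<Sum>j\<le>N. X ^ j / fact j))" for N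
      unfolding S_def sum X_def[symmetric] fibre_weight_def using one_plus_square_pos(2)[of "cmod t"] by (simp add: X_def mult_ac)
    have "(\<lambda>j. X ^ j / fact j) sums exp X" using exp_converges[of X] by (simp add: divide_inverse mult.commute)
    then have "(\<lambda>N. (real m)\<^sup>2 * (exp (- X) * (\<Sum>j\<le>N. X ^ j / fact j))) \<longlonglongrightarrow> (real m)\<^sup>2 * (exp (- X) * exp X)"
      unfolding sums_def_le by (intro tendsto_intros)
    then have "(\<lambda>N. S N * fibre_weight m z t) \<longlonglongrightarrow> (real m)\<^sup>2" unfolding W by (simp add: exp_minus)
    then have "\<forall>\<^sub>F N in sequentially. (real m)\<^sup>2 - \<delta> < S N * fibre_weight m z t"
      by (rule order_tendstoD) (use \<delta> in simp)
    then obtain N where N: "(real m)\<^sup>2 - \<delta> < S N * fibre_weight m z t" by (auto simp: eventually_sequentially)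
    have "(\<Sum>j\<le>N. X ^ j / fact j) \<ge> X ^ 0 / fact 0" using X by (intro member_le_sum) auto
    then have Spos: "S N > 0"
      unfolding S_def sum X_def[symmetric] using m one_plus_square_pos(1)[of "cmod t"] by (intro mult_pos_pos) auto
    define a where "a i = cnj (e i) / of_real (monom_sq m i)" for i
    have pos: "0 < monom_sq m i" for i using monom_sq_pos[OF m] .
    obtain k where k: "k \<in> V" "Re (l2_inner blowup_atlas \<omega> L h k k) = (\<Sum>i\<in>monom_index m N. (cmod (a i))\<^sup>2 * monom_sq m i)"
      "\<forall>v. crd1 k v = (\<Sum>i\<in>monom_index m N. a i * monom2 i (v $ 1, v $ 2))"
      "\<forall>v. crd2 k v = (\<Sum>i\<in>monom_index m N. a i * monom2' i (v $ 1, v $ 2))"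
      using monomial_section[where N=N and a=a] by blast
    have "(cmod (a i))\<^sup>2 * monom_sq m i = (cmod (e i))\<^sup>2 / monom_sq m i" for i
      using pos[of i] by (simp add: a_def norm_divide power_divide power2_eq_square)
    then have ip: "Re (l2_inner blowup_atlas \<omega> L h k k) = S N" unfolding k(2) S_def by simp
    have "a i * e i = of_real ((cmod (e i))\<^sup>2 / monom_sq m i)" for i
      unfolding of_real_divide complex_norm_square by (simp add: a_def)
    then have "(\<Sum>i\<in>monom_index m N. a i * e i) = of_real (S N)" unfolding S_def by simp
    then have "(cmod (evaluate x k))\<^sup>2 = (S N * fibre_weight m z t) * S N"
      unfolding ev[OF k(1,3,4)] using Spos by (simp add: power2_eq_square)
    also have "\<dots> \<ge> ((real m)\<^sup>2 - \<delta>) * S N" using N Spos by (intro mult_right_mono) auto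
    finally have "((real m)\<^sup>2 - \<delta>) * Re (l2_inner blowup_atlas \<omega> L h k k) \<le> (cmod (evaluate x k))\<^sup>2" by (simp only: ip)
    moreover have "0 < Re (l2_inner blowup_atlas \<omega> L h k k)" using Spos by (simp only: ip)
    ultimately show ?thesis using k(1) by blast
  qed
  have nrm: "Re (c * cnj c * complex_of_real w) = (cmod c)\<^sup>2 * w" for c w
    unfolding complex_norm_square[symmetric] by (simp del: of_real_power)
  have "x \<in> mf_points blowup_atlas" using x by (simp add: mf_points_blowup_atlas)
  then consider v where "x = blow1 v" | v where "x = blow2 v"
    by (auto simp: mf_points_def set_blowup_atlas dom1_eq dom2_eq)
  then show ?thesis
  proof cases
    case (1 v)
    show ?thesis
    proof (rule main[of "\<lambda>i. monom2 i (v $ 1, v $ 2)" "v $ 2" "v $ 1"])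
      show "(\<Sum>i\<in>monom_index m N. (cmod (monom2 i (v $ 1, v $ 2)))\<^sup>2 / monom_sq m i)
        = (real m)\<^sup>2 * (1 + (cmod (v $ 2))\<^sup>2) ^ m * (\<Sum>j\<le>N. (real m * (cmod (v $ 1))\<^sup>2 * (1 + (cmod (v $ 2))\<^sup>2)) ^ j / fact j)" for N
      proof -
        have "(cmod (monom2 i (v $ 1, v $ 2)))\<^sup>2 = ((cmod (v $ 1))\<^sup>2) ^ fst i * ((cmod (v $ 2))\<^sup>2) ^ snd i" for i
          by (simp add: monom2_def norm_mult norm_power power_mult_distrib power_mult[symmetric] mult.commute)
        then show ?thesis by (simp only: sum_monom_sq(1)[OF m])
      qed
    qed (simp only: 1 evaluate_square[OF x[unfolded 1]] herm_crd nrm)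
  next
    case (2 v)
    show ?thesis
    proof (rule main[of "\<lambda>i. monom2' i (v $ 1, v $ 2)" "v $ 2" "v $ 1"])
      show "(\<Sum>i\<in>monom_index m N. (cmod (monom2' i (v $ 1, v $ 2)))\<^sup>2 / monom_sq m i)
        = (real m)\<^sup>2 * (1 + (cmod (v $ 2))\<^sup>2) ^ m * (\<Sum>j\<le>N. (real m * (cmod (v $ 1))\<^sup>2 * (1 + (cmod (v $ 2))\<^sup>2)) ^ j / fact j)" for N
      proof -
        have "(cmod (monom2' i (v $ 1, v $ 2)))\<^sup>2 = ((cmod (v $ 1))\<^sup>2) ^ fst i * ((cmod (v $ 2))\<^sup>2) ^ (fst i + m - snd i)" for i
          by (simp add: monom2'_def norm_mult norm_power power_mult_distrib power_mult[symmetric] mult.commute)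
        then show ?thesis by (simp only: sum_monom_sq(2)[OF m])
      qed
    qed (simp only: 2 evaluate_square[OF x[unfolded 2]] herm_crd nrm)
  qed
qed

lemma epsilon_fun_eq:
  assumes B: "orthonormal_basis blowup_atlas \<omega> L h B" and x: "x \<in> blowup"
  shows "epsilon_fun L h B x = (real m)\<^sup>2"
proof -
  let ?ip = "l2_inner blowup_atlas \<omega> L h"
  have hs: "hol_section blowup_atlas L s" "l2_fun m (pair_fun s)" if "s \<in> V" for s
    using that by (simp_all add: l2_sections_iff)
  have ip: "?ip s t = l2_ip m (pair_fun s) (pair_fun t)" if "s \<in> V" "t \<in> V" for s t
    by (rule section_integral(2)[OF hs(1)[OF that(1)] hs(1)[OF that(2)]])
  have "(\<Sum>\<^sub>\<infinity>b\<in>B. (cmod (evaluate x b))\<^sup>2) = (real m)\<^sup>2"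
  proof (rule orthonormal_basis_extremal[where V=V and ip="?ip"])
    show "lin_comb F u \<in> V" if "finite F" "F \<subseteq> V" for F u using lin_comb_in_V that .
    show "(\<lambda>i x. s i x - t i x) \<in> V" if "s \<in> V" "t \<in> V" for s t using diff_in_V that .
    show "?ip (lin_comb F u) t = (\<Sum>b\<in>F. u b * ?ip b t)" if F: "finite F" "F \<subseteq> V" "t \<in> V" for F u t
    proof -
      have "?ip (lin_comb F u) t = l2_ip m (\<lambda>p. \<Sum>b\<in>F. u b * pair_fun b p) (pair_fun t)"
        using ip[OF lin_comb_in_V[OF F(1,2)] F(3)] by (simp only: pair_fun_lin_comb)
      also have "\<dots> = (\<Sum>b\<in>F. u b * l2_ip m (pair_fun b) (pair_fun t))"
        using F hs by (intro l2_ip_sum_left) auto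
      finally show ?thesis using F by (simp add: ip subset_iff)
    qed
    show "?ip (\<lambda>i x. s i x - t i x) r = ?ip s r - ?ip t r" if "r \<in> V" "s \<in> V" "t \<in> V" for r s t
    proof -
      have "l2_ip m (\<lambda>p. pair_fun s p + (- 1) * pair_fun t p) (pair_fun r) = l2_ip m (pair_fun s) (pair_fun r) - l2_ip m (pair_fun t) (pair_fun r)"
        unfolding l2_ip_def
        using l2_ip_integrable[OF hs(2)[OF that(2)] hs(2)[OF that(1)]] l2_ip_integrable[OF hs(2)[OF that(3)] hs(2)[OF that(1)]]
        by (simp add: left_diff_distrib)
      then show ?thesis using that by (simp only: ip diff_in_V pair_fun_diff)
    qed
    show "?ip s t = cnj (?ip t s)" if "s \<in> V" "t \<in> V" for s t
      unfolding ip[OF that] ip[OF that(2,1)] by (rule l2_ip_commute)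
    show "0 \<le> Re (?ip s s)" if "s \<in> V" for s
      unfolding ip[OF that that] l2_ip_self by (simp add: l2_weight_nonneg)
    show "evaluate x (lin_comb F u) = (\<Sum>b\<in>F. u b * evaluate x b)" for F u
      by (simp add: evaluate_def lin_comb_def sum_distrib_left mult.left_commute)
    show "evaluate x (\<lambda>i x. s i x - t i x) = evaluate x s - evaluate x t" for s t
      by (simp add: evaluate_def right_diff_distrib)
    show "(cmod (evaluate x s))\<^sup>2 \<le> (real m)\<^sup>2 * Re (?ip s s)" if "s \<in> V" for s by (rule bound[OF that x])
    show "\<exists>k\<in>V. 0 < Re (?ip k k) \<and> ((real m)\<^sup>2 - \<delta>) * Re (?ip k k) \<le> (cmod (evaluate x k))\<^sup>2" if "\<delta> > 0" for \<delta>
      by (rule sharp[OF x that])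
    show "B \<subseteq> V" using B by (simp add: orthonormal_basis_def)
    show "?ip s t = (if s = t then 1 else 0)" if "s \<in> B" "t \<in> B" for s t
      using B that unfolding orthonormal_basis_def by blast
    show "\<exists>F u. finite F \<and> F \<subseteq> B \<and> Re (?ip (\<lambda>i x. s i x - lin_comb F u i x) (\<lambda>i x. s i x - lin_comb F u i x)) < e"
      if "s \<in> V" "e > 0" for s e
      using B that unfolding orthonormal_basis_def Let_def by blast
  qed simp
  then show ?thesis unfolding epsilon_fun_def evaluate_square[OF x] .
qed

end

lemma hol_line_bundle_tensor_power:
  assumes "hol_line_bundle blowup_atlas L"
  shows "hol_line_bundle blowup_atlas (tensor_power L m)"
proof -
  note a = assms[unfolded hol_line_bundle_def]
  have T: "lb_index (tensor_power L m) = lb_index L" "lb_cover (tensor_power L m) = lb_cover L"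
    "lb_trans (tensor_power L m) i j = (\<lambda>x. lb_trans L i j x ^ m)" for i j
    by (simp_all add: tensor_power_def)
  show ?thesis
    unfolding hol_line_bundle_def T
  proof (intro conjI ballI)
    fix i j assume i: "i \<in> lb_index L" and j: "j \<in> lb_index L"
    show "mf_hol_on blowup_atlas (lb_cover L i \<inter> lb_cover L j) (\<lambda>x. lb_trans L i j x ^ m)"
      using line_bundleD(1)[OF assms i j] unfolding mf_hol_on_blowup comp_def by (intro ballI allI impI hol_at_power) simp
    show "lb_trans L i j x ^ m \<noteq> 0" if "x \<in> lb_cover L i \<inter> lb_cover L j" for x
      using a i j that by simp
    fix k x assume k: "k \<in> lb_index L" and x: "x \<in> lb_cover L i \<inter> lb_cover L j \<inter> lb_cover L k"
    have "lb_trans L i j x * lb_trans L j k x = lb_trans L i k x"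
      using x by (intro line_bundleD(2)[OF assms i j k]) auto
    then show "lb_trans L i j x ^ m * lb_trans L j k x ^ m = lb_trans L i k x ^ m"
      by (simp only: power_mult_distrib[symmetric])
  qed (use a in simp_all)
qed

theorem epsilon_fun_simanca:
  assumes \<omega>: "simanca_form \<omega>" and Q: "quantization blowup_atlas \<omega> L h" and m: "m \<ge> 1"
    and B: "orthonormal_basis blowup_atlas \<omega> (tensor_power L m) (h m) B" and x: "x \<in> blowup"
  shows "epsilon_fun (tensor_power L m) (h m) B x = (real m)\<^sup>2"
proof -
  let ?L = "tensor_power L m"
  have L: "hol_line_bundle blowup_atlas ?L" using Q unfolding quantization_def by (intro hol_line_bundle_tensor_power) simp
  have hm: "hermitian_metric blowup_atlas ?L (h m)"
    and ric: "has_ricci blowup_atlas ?L (h m) (\<lambda>c p. \<chi> j k. of_nat m * \<omega> c p $ j $ k)"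
    using Q m unfolding quantization_def by auto
  obtain \<tau>1 \<tau>2 where "\<And>v. unit_frame ?L (h m) m blowup_chart1 \<tau>1 v" "\<And>v. unit_frame ?L (h m) m blowup_chart2 \<tau>2 v"
     "\<And>v i. v $ 2 \<noteq> 0 \<Longrightarrow> \<tau>2 (chart_change v) i = (v $ 2) ^ m * \<tau>1 v i"
    using unit_frames_two_charts[OF L hm ric \<omega>] by blast
  then interpret framed_bundle \<omega> ?L "h m" m \<tau>1 \<tau>2
    using \<omega> L hm m by unfold_locales
  show ?thesis by (rule epsilon_fun_eq[OF B x])
qed

section \<open>The Tian-Yau-Zelditch coefficients\<close>

lemma mf_cr_on_zero:
  fixes f :: "blowup_point \<Rightarrow> real"
  assumes "\<And>x. x \<in> blowup \<Longrightarrow> f x = 0"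
  shows "mf_cr_on blowup_atlas r W f"
    "c \<in> set blowup_atlas \<Longrightarrow> iter_pderiv vs (f \<circ> param c) = (\<lambda>_. 0)"
proof -
  have z: "iter_pderiv vs (\<lambda>_. 0) = (\<lambda>_. 0 :: real)" for vs :: "(complex^2) list"
    by (induction vs) (auto simp: pderiv_at_def)
  have f: "f \<circ> param c = (\<lambda>_. 0)" if "c \<in> set blowup_atlas" for c
    using assms[OF param_in_blowup[OF that]] by (simp add: fun_eq_iff)
  show "mf_cr_on blowup_atlas r W f"
    unfolding mf_cr_on_def cr_on_def by (auto simp: f z)
  show "c \<in> set blowup_atlas \<Longrightarrow> iter_pderiv vs (f \<circ> param c) = (\<lambda>_. 0)"
    by (simp add: f z)
qed

lemma tyz_expansion_constant:
  fixes eps :: "nat \<Rightarrow> blowup_point \<Rightarrow> real"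
  assumes eps: "\<And>m x. m \<ge> 1 \<Longrightarrow> x \<in> blowup \<Longrightarrow> eps m x = (real m)\<^sup>2"
  shows "tyz_expansion blowup_atlas eps (\<lambda>j x. if j = 0 then 1 else 0)"
proof -
  have "\<exists>C. \<forall>\<^sub>F m in sequentially. cr_norm_le blowup_atlas r D
      (\<lambda>x. eps m x - (\<Sum>j\<le>k. (if j = 0 then 1 else 0) * real m powi (int CARD(2) - int j)))
      (C * real m powi (int CARD(2) - int k - 1))"
    if D: "chart_decomposition blowup_atlas K D" for k r K D
  proof (intro exI[of _ 0])
    show "\<forall>\<^sub>F m in sequentially. cr_norm_le blowup_atlas r D
      (\<lambda>x. eps m x - (\<Sum>j\<le>k. (if j = 0 then 1 else 0) * real m powi (int CARD(2) - int j)))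
      (0 * real m powi (int CARD(2) - int k - 1))"
      using eventually_ge_at_top[of 1]
    proof eventually_elim
      fix m :: nat assume m: "m \<ge> 1"
      let ?f = "\<lambda>x. eps m x - (\<Sum>j\<le>k. (if j = 0 then 1 else 0) * real m powi (int CARD(2) - int j))"
      have "(\<Sum>j\<le>k. (if j = 0 then 1 else 0) * real m powi (int CARD(2) - int j)) = (\<Sum>j\<le>k. if j = 0 then (real m)\<^sup>2 else 0)"
        by (intro sum.cong) auto
      then have zero: "?f x = 0" if "x \<in> blowup" for x using eps[OF m that] by simp
      have z1: "mf_cr_on blowup_atlas r W ?f" for W by (rule mf_cr_on_zero(1)) (rule zero)
      have z2: "iter_pderiv vs (?f \<circ> param c) = (\<lambda>_. 0)" if "c \<in> set blowup_atlas" for vs c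
        by (rule mf_cr_on_zero(2)[OF _ that]) (rule zero)
      show "cr_norm_le blowup_atlas r D ?f (0 * real m powi (int CARD(2) - int k - 1))"
        unfolding cr_norm_le_def
      proof (intro conjI z1 ballI, clarify)
        fix c K' p and vs :: "(complex^2) list" assume "(c, K') \<in> D"
        then have "c \<in> set blowup_atlas" using D unfolding chart_decomposition_def by blast
        from z2[OF this] show "\<bar>iter_pderiv vs (?f \<circ> param c) (coord c p)\<bar> \<le> 0 * real m powi (int CARD(2) - int k - 1)"
          by simp
      qed
    qed
  qed
  then show ?thesis
    unfolding tyz_expansion_def mf_smooth_on_def by (auto intro!: mf_cr_on_zero(1))
qed

text \<open>Evaluating the expansion at a single point determines the coefficients one after the other.\<close>

lemma tyz_expansion_unique:
  fixes eps :: "nat \<Rightarrow> blowup_point \<Rightarrow> real"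
  assumes eps: "\<And>m x. m \<ge> 1 \<Longrightarrow> x \<in> blowup \<Longrightarrow> eps m x = (real m)\<^sup>2"
    and a: "tyz_expansion blowup_atlas eps a" and x: "x \<in> blowup"
  shows "j \<ge> 1 \<Longrightarrow> a j x = 0"
proof (induction j rule: less_induct)
  case (less k)
  have a0: "a 0 x = 1" using a x unfolding tyz_expansion_def mf_points_blowup_atlas by blast
  obtain c where c: "c \<in> set blowup_atlas" "x \<in> dom c"
    using x unfolding mf_points_blowup_atlas[symmetric] mf_points_def by blast
  have K: "compactin (mf_topology blowup_atlas) {x}" using x by (simp add: topspace_blowup)
  then have D: "chart_decomposition blowup_atlas {x} {(c, {x})}"
    using c unfolding chart_decomposition_def by simp
  obtain C where C: "\<forall>\<^sub>F m in sequentially. cr_norm_le blowup_atlas 0 {(c, {x})}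
      (\<lambda>x. eps m x - (\<Sum>j\<le>k. a j x * real m powi (int CARD(2) - int j))) (C * real m powi (int CARD(2) - int k - 1))"
    using a K D unfolding tyz_expansion_def by blast
  have "\<forall>\<^sub>F m in sequentially. \<bar>a k x\<bar> \<le> C / real m"
    using C eventually_ge_at_top[of 1]
  proof eventually_elim
    case (elim m)
    have m: "real m > 0" using elim(2) by simp
    have "\<bar>eps m x - (\<Sum>j\<le>k. a j x * real m powi (int CARD(2) - int j))\<bar> \<le> C * real m powi (int CARD(2) - int k - 1)"
      using elim(1) param_blow(4)[OF c] unfolding cr_norm_le_def by (auto dest: spec[of _ "[]"])
    moreover have "(\<Sum>j\<le>k. a j x * real m powi (int CARD(2) - int j)) = (real m)\<^sup>2 + a k x * real m powi (2 - int k)"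
    proof -
      have "(\<Sum>j\<le>k. a j x * real m powi (int CARD(2) - int j))
         = (\<Sum>j\<le>k. (if j = 0 then (real m)\<^sup>2 else 0) + (if j = k then a k x * real m powi (2 - int k) else 0))"
        using less by (intro sum.cong) (auto simp: a0)
      then show ?thesis by (simp add: sum.distrib)
    qed
    ultimately have "\<bar>a k x\<bar> * real m powi (2 - int k) \<le> C * real m powi (2 - int k - 1)"
      using eps[OF elim(2) x] m by (simp add: abs_mult)
    also have "real m powi (2 - int k - 1) = real m powi (2 - int k) / real m"
      using m power_int_diff[of "real m" "2 - int k" 1] by simp
    finally have "\<bar>a k x\<bar> * real m powi (2 - int k) \<le> (C / real m) * real m powi (2 - int k)" by simp
    then show "\<bar>a k x\<bar> \<le> C / real m" using m by (simp only: mult_le_cancel_right_pos zero_less_power_int)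
  qed
  moreover have "(\<lambda>m. C / real m) \<longlonglongrightarrow> 0" by (rule lim_const_over_n)
  ultimately have "\<bar>a k x\<bar> \<le> 0" by (intro tendsto_lowerbound[of "\<lambda>m. C / real m"]) auto
  then show ?case by simp
qed

theorem corollary1p2:
  fixes \<omega> :: "(blowup_point, 2) form11"
    and L :: "('i, blowup_point) line_bundle"
    and h :: "nat \<Rightarrow> ('i, blowup_point) lb_metric"
    and B :: "nat \<Rightarrow> ('i, blowup_point) lb_section set"
  assumes "simanca_form \<omega>"
    and "quantization blowup_atlas \<omega> L h"
    and "\<And>m. m \<ge> 1 \<Longrightarrow> orthonormal_basis blowup_atlas \<omega> (tensor_power L m) (h m) (B m)"
  shows "(\<exists>a. tyz_expansion blowup_atlas (\<lambda>m. epsilon_fun (tensor_power L m) (h m) (B m)) a) \<and>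
         (\<forall>a. tyz_expansion blowup_atlas (\<lambda>m. epsilon_fun (tensor_power L m) (h m) (B m)) a
              \<longrightarrow> (\<forall>j\<ge>1. \<forall>x\<in>blowup. a j x = 0))"
proof -
  have eps: "epsilon_fun (tensor_power L m) (h m) (B m) x = (real m)\<^sup>2" if "m \<ge> 1" "x \<in> blowup" for m x
    using epsilon_fun_simanca[OF assms(1,2) that(1) assms(3)[OF that(1)] that(2)] .
  show ?thesis
    using tyz_expansion_constant[of "\<lambda>m. epsilon_fun (tensor_power L m) (h m) (B m)", OF eps]
      tyz_expansion_unique[of "\<lambda>m. epsilon_fun (tensor_power L m) (h m) (B m)", OF eps] by blast
qed

end
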